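(* Consider the kinetic Fokker-Planck generator $L=y\partial_x-U'(x)\partial_y-y\partial_y+\partial_y^2$ on $\mathbb R^2$, and assume that $U:\mathbb R\to\mathbb R$ is smooth, that $U''$ is bounded, and that $\mu_1\propto e^{-U(x)}dx$ satisfies a Poincaré inequality with constant $c_U>0$. Then there exist $\lambda>0$, $\eta>0$ and $\nu_*\in\mathbb R$ with $\mathcal Re(\eta-\sqrt{-\nu_*})>0$ (that is, either $\nu_*\ge0$, or $\nu_*<0$ and $\sqrt{|\nu_*|}<\eta$) such that for every $f\in\mathcal D$ there is a function $t\mapsto\nu_t$ with $\nu_t\ge\nu_*$ for all $t\ge0$ such that $F_t=\|P_tf-\mu f\|_{L^2(\mu)}^2$ satisfies, for all $t\ge 0$, $$(\partial_t+\lambda)\Big[(\partial_t+\eta)^2+\nu_t\Big]F_t\le 0 .$$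
   Context: The left-hand side means $g'(t)+\lambda g(t)$ with $g(t)=F_t''+2\eta F_t'+(\eta^2+\nu_t)F_t$ (in particular $\nu_tF_t$ is differentiable in $t$). $(P_t)_{t\ge0}$ is the Markov semigroup with generator $L$, i.e. the semigroup $P_tf(x,y)=\mathbb E(f(X_t,Y_t)\mid X_0=x,Y_0=y)$ of $dX_t=Y_tdt$, $dY_t=-U'(X_t)dt-Y_tdt+\sqrt2\,dB_t$. Its invariant measure is the probability measure $\mu\propto e^{-U(x)}dx\otimes e^{-y^2/2}dy$, with first marginal $\mu_1$; $\mu f=\int f\,d\mu$. A probability measure $\nu$ on $\mathbb R$ satisfies a Poincaré inequality with constant $c$ if $\int|g'|^2d\nu\ge c\int|g|^2d\nu$ whenever $\int g\,d\nu=0$. Standing assumption: $\mathcal D$ is a core, dense in $L^2(\mu)$ and stable by $L$, and $f\in\mathcal D$; it is understood that the functions $f_t=P_tf-\mu f$ are regular enough that $\|\partial_xf_t\|^2$ is finite and differentiable in $t$, and that the differential operators involved can be applied to $f_t$ and integrated by parts in $L^2(\mu)$. *)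

theory Defs
  imports "HOL-Probability.Probability"
begin

definition smooth1 :: "(real \<Rightarrow> real) \<Rightarrow> bool" where
  "smooth1 U \<longleftrightarrow> (\<forall>k x. (deriv ^^ k) U differentiable (at x))"

definition dx :: "(real \<times> real \<Rightarrow> real) \<Rightarrow> real \<times> real \<Rightarrow> real" where
  "dx f = (\<lambda>(x, y). deriv (\<lambda>s. f (s, y)) x)"

definition dy :: "(real \<times> real \<Rightarrow> real) \<Rightarrow> real \<times> real \<Rightarrow> real" where
  "dy f = (\<lambda>(x, y). deriv (\<lambda>s. f (x, s)) y)"

text \<open>Existence of the partial derivatives is demanded explicitly, since \<open>deriv\<close> is total.\<close>

primrec C_k :: "nat \<Rightarrow> (real \<times> real \<Rightarrow> real) \<Rightarrow> bool" where
  "C_k 0 f \<longleftrightarrow> continuous_on UNIV f"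
| "C_k (Suc k) f \<longleftrightarrow>
     (\<forall>x y. (\<lambda>s. f (s, y)) differentiable (at x) \<and> (\<lambda>s. f (x, s)) differentiable (at y)) \<and>
     C_k k (dx f) \<and> C_k k (dy f)"

definition smooth2 :: "(real \<times> real \<Rightarrow> real) \<Rightarrow> bool" where
  "smooth2 f \<longleftrightarrow> (\<forall>k. C_k k f)"

text \<open>Time derivative on the half-line; at \<open>t = 0\<close> it is the right derivative.\<close>

definition dt :: "(real \<Rightarrow> real) \<Rightarrow> real \<Rightarrow> real" where
  "dt F t = vector_derivative F (at t within {0..})"

definition dt_exists :: "(real \<Rightarrow> real) \<Rightarrow> real \<Rightarrow> bool" where
  "dt_exists F t \<longleftrightarrow> F differentiable (at t within {0..})"

definition kfp :: "(real \<Rightarrow> real) \<Rightarrow> (real \<times> real \<Rightarrow> real) \<Rightarrow> real \<times> real \<Rightarrow> real" where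
  "kfp U f = (\<lambda>(x, y). y * dx f (x, y) - deriv U x * dy f (x, y)
                       - y * dy f (x, y) + dy (dy f) (x, y))"

text \<open>If \<open>exp (- V)\<close> is Lebesgue integrable, this is the probability measure proportional
  to \<open>exp (- V x) dx\<close>.\<close>

definition gibbs :: "(real \<Rightarrow> real) \<Rightarrow> real measure" where
  "gibbs V = density lborel (\<lambda>x. ennreal (exp (- V x) / (\<integral>s. exp (- V s) \<partial>lborel)))"

definition kin_measure :: "(real \<Rightarrow> real) \<Rightarrow> (real \<times> real) measure" where
  "kin_measure U = gibbs U \<Otimes>\<^sub>M gibbs (\<lambda>y. y\<^sup>2 / 2)"

definition L2 :: "'a measure \<Rightarrow> ('a \<Rightarrow> real) \<Rightarrow> bool" where
  "L2 M f \<longleftrightarrow> f \<in> borel_measurable M \<and> integrable M (\<lambda>z. (f z)\<^sup>2)"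

definition normsq :: "'a measure \<Rightarrow> ('a \<Rightarrow> real) \<Rightarrow> real" where
  "normsq M f = (\<integral>z. (f z)\<^sup>2 \<partial>M)"

text \<open>Only continuously differentiable test functions with \<open>g\<close> and \<open>g'\<close> square integrable
  are considered: otherwise the Bochner integrals would be \<open>0\<close> by convention.\<close>

definition poincare :: "real measure \<Rightarrow> real \<Rightarrow> bool" where
  "poincare N c \<longleftrightarrow>
     (\<forall>g. (\<forall>x. g differentiable (at x)) \<and> continuous_on UNIV (deriv g) \<and>
          L2 N g \<and> L2 N (deriv g) \<and> (\<integral>x. g x \<partial>N) = 0
          \<longrightarrow> normsq N (deriv g) \<ge> c * normsq N g)"

definition brownian_motion :: "'w measure \<Rightarrow> (real \<Rightarrow> 'w \<Rightarrow> real) \<Rightarrow> bool" where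
  "brownian_motion W B \<longleftrightarrow>
     prob_space W \<and>
     (\<forall>t\<ge>0. B t \<in> borel_measurable W) \<and>
     (AE \<omega> in W. B 0 \<omega> = 0 \<and> continuous_on {0..} (\<lambda>t. B t \<omega>)) \<and>
     (\<forall>s t. 0 \<le> s \<and> s < t \<longrightarrow>
        distributed W lborel (\<lambda>\<omega>. B t \<omega> - B s \<omega>) (normal_density 0 (sqrt (t - s)))) \<and>
     (\<forall>n (\<tau> :: nat \<Rightarrow> real). 0 \<le> \<tau> 0 \<and> (\<forall>i<n. \<tau> i < \<tau> (Suc i)) \<longrightarrow>
        prob_space.indep_vars W (\<lambda>_. borel) (\<lambda>i \<omega>. B (\<tau> (Suc i)) \<omega> - B (\<tau> i) \<omega>) {..<n})"

text \<open>The noise in \<open>dX = Y dt\<close>, \<open>dY = - U'(X) dt - Y dt + sqrt 2 dB\<close> is additive, so the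
  integral form of the equation needs no stochastic integral. The first argument of \<open>X\<close> and \<open>Y\<close>
  is the initial condition.\<close>

definition kinetic_solution ::
  "(real \<Rightarrow> real) \<Rightarrow> 'w measure \<Rightarrow> (real \<Rightarrow> 'w \<Rightarrow> real) \<Rightarrow>
   (real \<times> real \<Rightarrow> real \<Rightarrow> 'w \<Rightarrow> real) \<Rightarrow> (real \<times> real \<Rightarrow> real \<Rightarrow> 'w \<Rightarrow> real) \<Rightarrow> bool" where
  "kinetic_solution U W B X Y \<longleftrightarrow>
     (\<forall>z. \<forall>t\<ge>0. X z t \<in> borel_measurable W \<and> Y z t \<in> borel_measurable W) \<and>
     (\<forall>x y. AE \<omega> in W.
        continuous_on {0..} (\<lambda>t. X (x, y) t \<omega>) \<and>
        continuous_on {0..} (\<lambda>t. Y (x, y) t \<omega>) \<and>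
        (\<forall>t\<ge>0. X (x, y) t \<omega> = x + integral {0..t} (\<lambda>s. Y (x, y) s \<omega>) \<and>
               Y (x, y) t \<omega> = y
                 - integral {0..t} (\<lambda>s. deriv U (X (x, y) s \<omega>) + Y (x, y) s \<omega>)
                 + sqrt 2 * B t \<omega>))"

definition transition ::
  "'w measure \<Rightarrow> (real \<times> real \<Rightarrow> real \<Rightarrow> 'w \<Rightarrow> real) \<Rightarrow> (real \<times> real \<Rightarrow> real \<Rightarrow> 'w \<Rightarrow> real) \<Rightarrow>
   real \<Rightarrow> (real \<times> real \<Rightarrow> real) \<Rightarrow> real \<times> real \<Rightarrow> real" where
  "transition W X Y t f = (\<lambda>z. \<integral>\<omega>. f (X z t \<omega>, Y z t \<omega>) \<partial>W)"

text \<open>Elements of \<open>L\<^sup>2(M)\<close> are represented by functions, so identities between them are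
  required almost everywhere.\<close>

definition markov_semigroup ::
  "'a measure \<Rightarrow> (real \<Rightarrow> ('a \<Rightarrow> real) \<Rightarrow> 'a \<Rightarrow> real) \<Rightarrow> bool" where
  "markov_semigroup M P \<longleftrightarrow>
     (\<forall>t\<ge>0. \<forall>f. L2 M f \<longrightarrow> L2 M (P t f) \<and> normsq M (P t f) \<le> normsq M f) \<and>
     (\<forall>t\<ge>0. \<forall>f g a b. L2 M f \<and> L2 M g \<longrightarrow>
        (AE z in M. P t (\<lambda>w. a * f w + b * g w) z = a * P t f z + b * P t g z)) \<and>
     (\<forall>t\<ge>0. \<forall>f. L2 M f \<and> (AE z in M. f z \<ge> 0) \<longrightarrow> (AE z in M. P t f z \<ge> 0)) \<and>
     (\<forall>t\<ge>0. AE z in M. P t (\<lambda>_. 1) z = 1) \<and>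
     (\<forall>f. L2 M f \<longrightarrow> (AE z in M. P 0 f z = f z)) \<and>
     (\<forall>s\<ge>0. \<forall>t\<ge>0. \<forall>f. L2 M f \<longrightarrow> (AE z in M. P (s + t) f z = P s (P t f) z)) \<and>
     (\<forall>f. L2 M f \<longrightarrow> ((\<lambda>t. normsq M (\<lambda>z. P t f z - f z)) \<longlongrightarrow> 0) (at_right 0))"

definition invariant_measure ::
  "'a measure \<Rightarrow> (real \<Rightarrow> ('a \<Rightarrow> real) \<Rightarrow> 'a \<Rightarrow> real) \<Rightarrow> bool" where
  "invariant_measure M P \<longleftrightarrow> (\<forall>t\<ge>0. \<forall>f. L2 M f \<longrightarrow> (\<integral>z. P t f z \<partial>M) = (\<integral>z. f z \<partial>M))"

definition generator ::
  "'a measure \<Rightarrow> (real \<Rightarrow> ('a \<Rightarrow> real) \<Rightarrow> 'a \<Rightarrow> real) \<Rightarrow> ('a \<Rightarrow> real) \<Rightarrow> ('a \<Rightarrow> real) \<Rightarrow> bool" where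
  "generator M P f g \<longleftrightarrow> L2 M f \<and> L2 M g \<and>
     ((\<lambda>h. normsq M (\<lambda>z. (P h f z - f z) / h - g z)) \<longlongrightarrow> 0) (at_right 0)"

text \<open>The operator \<open>A\<close> acts on functions; the generator is required to be the closure of the
  restriction of \<open>A\<close> to \<open>D\<close>.\<close>

definition core ::
  "'a measure \<Rightarrow> (real \<Rightarrow> ('a \<Rightarrow> real) \<Rightarrow> 'a \<Rightarrow> real) \<Rightarrow>
   (('a \<Rightarrow> real) \<Rightarrow> 'a \<Rightarrow> real) \<Rightarrow> ('a \<Rightarrow> real) set \<Rightarrow> bool" where
  "core M P A D \<longleftrightarrow>
     D \<noteq> {} \<and> (\<forall>f\<in>D. \<forall>g\<in>D. \<forall>a b. (\<lambda>z. a * f z + b * g z) \<in> D) \<and>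
     (\<forall>f\<in>D. generator M P f (A f)) \<and>
     (\<forall>f g. generator M P f g \<longrightarrow>
        (\<exists>u :: nat \<Rightarrow> 'a \<Rightarrow> real. (\<forall>n. u n \<in> D) \<and>
           (\<lambda>n. normsq M (\<lambda>z. u n z - f z)) \<longlonglongrightarrow> 0 \<and>
           (\<lambda>n. normsq M (\<lambda>z. A (u n) z - g z)) \<longlonglongrightarrow> 0))"

definition dense_L2 :: "'a measure \<Rightarrow> ('a \<Rightarrow> real) set \<Rightarrow> bool" where
  "dense_L2 M D \<longleftrightarrow> (\<forall>f\<in>D. L2 M f) \<and>
     (\<forall>f. L2 M f \<longrightarrow> (\<forall>e>0. \<exists>g\<in>D. normsq M (\<lambda>z. f z - g z) < e))"

definition centered ::
  "'a measure \<Rightarrow> (real \<Rightarrow> ('a \<Rightarrow> real) \<Rightarrow> 'a \<Rightarrow> real) \<Rightarrow> ('a \<Rightarrow> real) \<Rightarrow> real \<Rightarrow> 'a \<Rightarrow> real" where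
  "centered M P f t = (\<lambda>z. P t f z - (\<integral>w. f w \<partial>M))"

text \<open>The trajectory \<open>u\<close> takes its values in smooth functions; the derivatives listed are those
  occurring, after integration by parts, in the time derivatives of \<open>normsq M (u t)\<close> up to order
  three and in that of \<open>normsq M (dx (u t))\<close>. The integrations by parts themselves are not assumed.\<close>

definition regular_trajectory ::
  "(real \<times> real) measure \<Rightarrow> (real \<Rightarrow> real \<times> real \<Rightarrow> real) \<Rightarrow> bool" where
  "regular_trajectory M u \<longleftrightarrow>
     (\<forall>t\<ge>0. smooth2 (u t) \<and> L2 M (dx (u t)) \<and> L2 M (dy (u t)) \<and> L2 M (dx (dy (u t))) \<and>
        L2 M (dy (dy (u t))) \<and> L2 M (dy (dy (dy (u t)))) \<and>
        dt_exists (\<lambda>s. normsq M (dx (u s))) t)"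

end

theory Submission
  imports Defs
begin

text \<open>
  Write \<open>u = P\<^sub>t f - \<mu> f\<close>, \<open>w = \<partial>\<^sub>x u\<close>, \<open>h = \<partial>\<^sub>y u\<close> and \<open>k = \<partial>\<^sub>y h\<close>, with norms and inner
  products in \<open>L\<^sup>2(\<mu>)\<close>. The transport part \<open>y \<partial>\<^sub>x - U' \<partial>\<^sub>y\<close> of \<open>L\<close> is antisymmetric there, so \<open>F = |u|\<^sup>2\<close>
  is dissipated in the velocity direction only: \<open>F' = - 2|h|\<^sup>2\<close>. The commutators
  \<open>[\<partial>\<^sub>y, L] = \<partial>\<^sub>x - \<partial>\<^sub>y\<close> and \<open>[\<partial>\<^sub>x, L] = - U'' \<partial>\<^sub>y\<close> make the position derivative visible in the higher time
  derivatives: \<open>F'''\<close> contains \<open>- 4|w|\<^sup>2\<close>, together with cross terms (\<open>dissipation_identities\<close>). One of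
  these, \<open>24\<langle>k, \<partial>\<^sub>y w\<rangle>\<close>, cannot be absorbed by the negative terms of \<open>F'''\<close>, and the terms with
  \<open>\<langle>h, w\<rangle>\<close> and \<open>U''\<close> cost large multiples of \<open>|h|\<^sup>2\<close>.

  The function \<open>\<nu>\<close> pays for both. With \<open>\<eta> = 1\<close> and \<open>\<nu>\<^sub>t F = b F + 6|w|\<^sup>2\<close>, the derivative of \<open>6|w|\<^sup>2\<close>
  contributes \<open>- 12|\<partial>\<^sub>y w|\<^sup>2\<close> and that of \<open>b F\<close> contributes \<open>- 2b|h|\<^sup>2\<close>. For \<open>b\<close> large the time derivative of the
  bracket is then bounded by a negative multiple of \<open>|w|\<^sup>2 + |h|\<^sup>2 + |k|\<^sup>2\<close>, and for small \<open>\<lambda>\<close> this dominates \<open>\<lambda>\<close> times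
  the bracket, because \<open>\<mu>\<close> satisfies a Poincare inequality (\<open>poincare_kinetic\<close>). That bookkeeping is
  \<open>hypocoercive_inequality\<close>. Moreover \<open>\<nu> \<ge> b > 0\<close>, so \<open>sqrt (- b)\<close> is purely imaginary and the condition on
  \<open>\<eta>\<close> and \<open>\<nu>\<^sub>*\<close> reads \<open>\<eta> > 0\<close>.

  Four points need analysis.
  \<^item> Integrations by parts are justified with a cutoff at scale \<open>n\<close>. Since \<open>U''\<close> is bounded, the drift grows at
    most linearly, so that the adjoint of \<open>L\<close> applied to the cutoff stays bounded and tends to \<open>0\<close>
    (\<open>cut_adj_bounds\<close>, \<open>dirichlet_form\<close>).
  \<^item> The abstract derivative \<open>P\<^sub>t (L f)\<close> of \<open>P\<^sub>t f\<close> must be the differential operator applied to the smooth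
    function \<open>P\<^sub>t f\<close>. The core property gives this against test functions, hence pointwise (\<open>kfp_traj\<close>).
  \<^item> The curve \<open>w\<close> must be differentiable in \<open>L\<^sup>2(\<mu>)\<close>. Only inner products of \<open>w\<close> with test functions can be
    differentiated directly; testing the Taylor remainder of \<open>w\<close> with a cutoff of itself turns this weak
    information into a norm estimate (\<open>traj_dx_taylor\<close>).
  \<^item> The Poincare inequality for \<open>\<mu>\<close> combines that of its first marginal with the Gaussian one, by an argument
    that never differentiates a conditional expectation (\<open>marginal_means_le\<close>).
\<close>

section \<open>Partial derivatives of functions of two variables\<close>

definition partials :: "(real \<times> real \<Rightarrow> real) \<Rightarrow> bool" where
  "partials f \<longleftrightarrow> (\<forall>x y. (\<lambda>s. f (s, y)) differentiable (at x) \<and> (\<lambda>s. f (x, s)) differentiable (at y))"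

lemma partialsD:
  assumes "partials f"
  shows "((\<lambda>s. f (s, y)) has_real_derivative dx f (x, y)) (at x)"
    and "((\<lambda>s. f (x, s)) has_real_derivative dy f (x, y)) (at y)"
  using assms unfolding partials_def dx_def dy_def
  by (auto simp: DERIV_deriv_iff_real_differentiable)

lemma dx_eqI:
  assumes "\<And>x y. ((\<lambda>s. f (s, y)) has_real_derivative f' (x, y)) (at x)"
  shows "dx f = f'"
  using assms by (auto simp: dx_def fun_eq_iff DERIV_imp_deriv)

lemma dy_eqI:
  assumes "\<And>x y. ((\<lambda>s. f (x, s)) has_real_derivative f' (x, y)) (at y)"
  shows "dy f = f'"
  using assms by (auto simp: dy_def fun_eq_iff DERIV_imp_deriv)

lemma partialsI:
  assumes "\<And>x y. ((\<lambda>s. f (s, y)) has_real_derivative f1 (x, y)) (at x)"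
    and "\<And>x y. ((\<lambda>s. f (x, s)) has_real_derivative f2 (x, y)) (at y)"
  shows "partials f"
  using assms unfolding partials_def by (meson real_differentiable_def)

lemma partials_mult:
  assumes "partials f" "partials g"
  shows "partials (\<lambda>z. f z * g z)"
    and "dx (\<lambda>z. f z * g z) = (\<lambda>z. dx f z * g z + f z * dx g z)"
    and "dy (\<lambda>z. f z * g z) = (\<lambda>z. dy f z * g z + f z * dy g z)"
proof -
  have 1: "((\<lambda>s. f (s, y) * g (s, y)) has_real_derivative dx f (x, y) * g (x, y) + f (x, y) * dx g (x, y)) (at x)" for x y
    by (auto intro!: derivative_eq_intros partialsD assms)
  have 2: "((\<lambda>s. f (x, s) * g (x, s)) has_real_derivative dy f (x, y) * g (x, y) + f (x, y) * dy g (x, y)) (at y)" for x y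
    by (auto intro!: derivative_eq_intros partialsD assms)
  show "partials (\<lambda>z. f z * g z)"
    by (rule partialsI[where ?f1.0="\<lambda>z. dx f z * g z + f z * dx g z" and ?f2.0="\<lambda>z. dy f z * g z + f z * dy g z"]) (use 1 2 in auto)
  show "dx (\<lambda>z. f z * g z) = (\<lambda>z. dx f z * g z + f z * dx g z)"
    by (rule dx_eqI) (use 1 in auto)
  show "dy (\<lambda>z. f z * g z) = (\<lambda>z. dy f z * g z + f z * dy g z)"
    by (rule dy_eqI) (use 2 in auto)
qed

lemma partials_linear:
  assumes "partials f" "partials g"
  shows "partials (\<lambda>z. a * f z + b * g z)"
    and "dx (\<lambda>z. a * f z + b * g z) = (\<lambda>z. a * dx f z + b * dx g z)"
    and "dy (\<lambda>z. a * f z + b * g z) = (\<lambda>z. a * dy f z + b * dy g z)"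
proof -
  have 1: "((\<lambda>s. a * f (s, y) + b * g (s, y)) has_real_derivative a * dx f (x, y) + b * dx g (x, y)) (at x)" for x y
    by (auto intro!: derivative_eq_intros partialsD assms)
  have 2: "((\<lambda>s. a * f (x, s) + b * g (x, s)) has_real_derivative a * dy f (x, y) + b * dy g (x, y)) (at y)" for x y
    by (auto intro!: derivative_eq_intros partialsD assms)
  show "partials (\<lambda>z. a * f z + b * g z)"
    by (rule partialsI[where ?f1.0="\<lambda>z. a * dx f z + b * dx g z" and ?f2.0="\<lambda>z. a * dy f z + b * dy g z"]) (use 1 2 in auto)
  show "dx (\<lambda>z. a * f z + b * g z) = (\<lambda>z. a * dx f z + b * dx g z)"
    by (rule dx_eqI) (use 1 in auto)
  show "dy (\<lambda>z. a * f z + b * g z) = (\<lambda>z. a * dy f z + b * dy g z)"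
    by (rule dy_eqI) (use 2 in auto)
qed

lemma C_k_Suc_iff: "C_k (Suc k) f \<longleftrightarrow> partials f \<and> C_k k (dx f) \<and> C_k k (dy f)"
  by (simp add: partials_def)

lemma smooth2_partials: "smooth2 f \<Longrightarrow> partials f"
  and smooth2_continuous: "smooth2 f \<Longrightarrow> continuous_on UNIV f"
  and smooth2_dx: "smooth2 f \<Longrightarrow> smooth2 (dx f)"
  and smooth2_dy: "smooth2 f \<Longrightarrow> smooth2 (dy f)"
  unfolding smooth2_def by (metis C_k_Suc_iff C_k.simps(1))+

lemma C_k_linear: "C_k k f \<Longrightarrow> C_k k g \<Longrightarrow> C_k k (\<lambda>z. a * f z + b * g z)"
proof (induction k arbitrary: f g)
  case 0
  then show ?case by (auto intro!: continuous_intros)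
next
  case (Suc k)
  then show ?case by (simp add: C_k_Suc_iff partials_linear del: C_k.simps)
qed

lemma smooth2_linear: "smooth2 f \<Longrightarrow> smooth2 g \<Longrightarrow> smooth2 (\<lambda>z. a * f z + b * g z)"
  unfolding smooth2_def using C_k_linear by blast

text \<open>The induction on the order must run over all pairs of factors, since the derivative of a product is a sum of
  other products.\<close>

lemma smooth2_mult: assumes "smooth2 f" "smooth2 g" shows "smooth2 (\<lambda>z. f z * g z)"
proof -
  have "C_k k (\<lambda>z. f z * g z)" if "smooth2 f" "smooth2 g" for k f g
    using that
  proof (induction k arbitrary: f g)
    case 0
    then show ?case by (simp add: continuous_on_mult smooth2_continuous)
  next
    case (Suc k)
    have "C_k k (\<lambda>z. 1 * (dx f z * g z) + 1 * (f z * dx g z))"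
      "C_k k (\<lambda>z. 1 * (dy f z * g z) + 1 * (f z * dy g z))"
      by (intro C_k_linear Suc smooth2_dx smooth2_dy)+
    then show ?case
      using partials_mult[OF Suc.prems[THEN smooth2_partials]] by (simp add: C_k_Suc_iff del: C_k.simps)
  qed
  then show ?thesis using assms by (simp add: smooth2_def)
qed

lemma partials_const:
  "partials (\<lambda>z. c)" "dx (\<lambda>z. c) = (\<lambda>z. 0)" "dy (\<lambda>z. c) = (\<lambda>z. 0)"
  by (auto simp: partials_def dx_def dy_def)

lemma smooth2_const: "smooth2 (\<lambda>z. c)"
proof -
  have "C_k k (\<lambda>z. c)" for k
  proof (induction k arbitrary: c)
    case (Suc k)
    then show ?case by (simp add: C_k_Suc_iff partials_const del: C_k.simps)
  qed simp
  then show ?thesis by (simp add: smooth2_def)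
qed

lemma smooth2_add: "smooth2 f \<Longrightarrow> smooth2 g \<Longrightarrow> smooth2 (\<lambda>z. f z + g z)"
  using smooth2_linear[of f g 1 1] by simp

lemma smooth2_diff: "smooth2 f \<Longrightarrow> smooth2 g \<Longrightarrow> smooth2 (\<lambda>z. f z - g z)"
  using smooth2_linear[of f g 1 "-1"] by simp

lemma smooth2_snd: "smooth2 snd"
proof -
  have d: "dx snd = (\<lambda>z. 0)" "dy snd = (\<lambda>z. 1)" "partials snd"
    by (auto simp: dx_def dy_def partials_def)
  have "C_k k snd" for k
    using smooth2_const[unfolded smooth2_def] d
    by (cases k) (auto simp: C_k_Suc_iff simp del: C_k.simps(2) intro: continuous_intros)
  then show ?thesis by (simp add: smooth2_def)
qed

lemma smooth1_deriv: "smooth1 V \<Longrightarrow> smooth1 (deriv V)"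
  unfolding smooth1_def by (metis funpow_Suc_right o_apply)

lemma smooth1_DERIV: "smooth1 V \<Longrightarrow> (V has_real_derivative deriv V x) (at x)"
  unfolding smooth1_def using DERIV_deriv_iff_real_differentiable funpow_0 by metis

lemma smooth1_continuous: "smooth1 V \<Longrightarrow> continuous_on S V"
  by (meson DERIV_isCont continuous_at_imp_continuous_on smooth1_DERIV)

lemma partials_fst:
  assumes "smooth1 V"
  shows "partials (\<lambda>z. V (fst z))" "dx (\<lambda>z. V (fst z)) = (\<lambda>z. deriv V (fst z))"
    "dy (\<lambda>z. V (fst z)) = (\<lambda>z. 0)"
  using assms by (auto simp: partials_def dx_def dy_def real_differentiable_def intro: smooth1_DERIV DERIV_imp_deriv)

lemma smooth2_fst: assumes "smooth1 V" shows "smooth2 (\<lambda>z. V (fst z))"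
proof -
  have "C_k k (\<lambda>z. V (fst z))" if "smooth1 V" for k V
    using that
  proof (induction k arbitrary: V)
    case 0
    have "continuous_on UNIV (\<lambda>z::real\<times>real. V (fst z))"
      by (rule continuous_on_compose2[OF smooth1_continuous[OF 0]]) (auto intro!: continuous_intros)
    then show ?case by simp
  next
    case (Suc k)
    have "C_k k (\<lambda>z. 0)" using smooth2_const by (auto simp: smooth2_def)
    then show ?case using Suc by (simp add: C_k_Suc_iff partials_fst smooth1_deriv del: C_k.simps)
  qed
  then show ?thesis using assms by (simp add: smooth2_def)
qed

lemma kfp_fun_eq: "kfp U f = (\<lambda>z. snd z * dx f z - deriv U (fst z) * dy f z - snd z * dy f z + dy (dy f) z)"
  by (auto simp: kfp_def)

lemma smooth2_kfp: "smooth1 U \<Longrightarrow> smooth2 f \<Longrightarrow> smooth2 (kfp U f)"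
  unfolding kfp_fun_eq
  by (intro smooth2_add smooth2_diff smooth2_mult smooth2_snd smooth2_dx smooth2_dy
      smooth2_fst[OF smooth1_deriv])

text \<open>Schwarz' theorem: write \<open>f\<close> as the integral of \<open>\<partial>\<^sub>y f\<close> in the second variable and differentiate under the integral
  sign in the first.\<close>

lemma dx_dy_commute:
  assumes f: "smooth2 f"
  shows "dx (dy f) = dy (dx f)"
proof (rule ext, safe)
  fix x y :: real
  have pf: "partials f" and pfy: "partials (dy f)"
    using f by (auto intro: smooth2_partials smooth2_dy)
  have cont: "continuous_on UNIV (dy f)" "continuous_on UNIV (dx (dy f))"
    using f by (auto intro: smooth2_continuous smooth2_dy smooth2_dx)
  have cont1: "continuous_on S (\<lambda>s. dy f (x, s))" "continuous_on S (\<lambda>s. dx (dy f) (x, s))" for x S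
    by (rule continuous_on_compose2[OF cont(1)], auto intro!: continuous_intros)
       (rule continuous_on_compose2[OF cont(2)], auto intro!: continuous_intros)
  \<comment> \<open>Any interval with \<open>y\<close> in its interior would do.\<close>
  define a where "a = y - 1"
  define b where "b = y + 1"
  have rep: "f (r, s) = f (r, a) + integral {a..s} (\<lambda>t. dy f (r, t))" if "a \<le> s" for r s
  proof -
    have "((\<lambda>t. dy f (r, t)) has_integral f (r, s) - f (r, a)) {a..s}"
      using that by (intro fundamental_theorem_of_calculus)
        (auto simp: has_real_derivative_iff_has_vector_derivative[symmetric]
          intro!: has_field_derivative_at_within partialsD[OF pf])
    then show ?thesis by (simp add: integral_unique)
  qed
  have dxr: "dx f (x, s) = dx f (x, a) + integral {a..s} (\<lambda>t. dx (dy f) (x, t))" if "a \<le> s" for s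
  proof -
    have "((\<lambda>r. integral (cbox a s) (\<lambda>t. dy f (r, t))) has_real_derivative
           integral (cbox a s) (\<lambda>t. dx (dy f) (x, t))) (at x within UNIV)"
    proof (rule leibniz_rule_field_derivative)
      show "((\<lambda>r. dy f (r, t)) has_real_derivative dx (dy f) (r, t)) (at r within UNIV)" for r t
        using partialsD(1)[OF pfy] by simp
      show "(\<lambda>t. dy f (r, t)) integrable_on cbox a s" for r
        using cont1 by (intro integrable_continuous) auto
      show "continuous_on (UNIV \<times> cbox a s) (\<lambda>(r, t). dx (dy f) (r, t))"
        using cont(2) by (auto intro: continuous_on_subset)
    qed auto
    then have "((\<lambda>r. f (r, a) + integral {a..s} (\<lambda>t. dy f (r, t))) has_real_derivative
        dx f (x, a) + integral {a..s} (\<lambda>t. dx (dy f) (x, t))) (at x)"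
      by (intro DERIV_add partialsD[OF pf]) auto
    then have "((\<lambda>r. f (r, s)) has_real_derivative
        dx f (x, a) + integral {a..s} (\<lambda>t. dx (dy f) (x, t))) (at x)"
      using rep[OF that] by simp
    then show ?thesis using partialsD(1)[OF pf, of s x] DERIV_unique by blast
  qed
  have "((\<lambda>s. integral {a..s} (\<lambda>t. dx (dy f) (x, t))) has_real_derivative dx (dy f) (x, y)) (at y within {a..b})"
    using integral_has_real_derivative[OF cont1(2), of y a b] by (auto simp: a_def b_def)
  then have "((\<lambda>s. integral {a..s} (\<lambda>t. dx (dy f) (x, t))) has_real_derivative dx (dy f) (x, y)) (at y)"
    by (simp add: a_def b_def at_within_Icc_at)
  then have "((\<lambda>s. dx f (x, a) + integral {a..s} (\<lambda>t. dx (dy f) (x, t))) has_real_derivative dx (dy f) (x, y)) (at y)"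
    by (auto intro!: derivative_eq_intros)
  moreover have "((\<lambda>s. dx f (x, s)) has_real_derivative D) (at y)
      \<longleftrightarrow> ((\<lambda>s. dx f (x, a) + integral {a..s} (\<lambda>t. dx (dy f) (x, t))) has_real_derivative D) (at y)" for D
  proof (rule DERIV_cong_ev[OF refl _ refl])
    have "eventually (\<lambda>s. s \<in> {a<..}) (nhds y)"
      by (intro eventually_nhds_in_open) (auto simp: a_def)
    then show "eventually (\<lambda>s. dx f (x, s) = dx f (x, a) + integral {a..s} (\<lambda>t. dx (dy f) (x, t))) (nhds y)"
      by eventually_elim (rule dxr, auto)
  qed
  ultimately have "((\<lambda>s. dx f (x, s)) has_real_derivative dx (dy f) (x, y)) (at y)" by blast
  then show "dx (dy f) (x, y) = dy (dx f) (x, y)"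
    using partialsD(2)[OF smooth2_partials[OF smooth2_dx[OF f]], of x y] DERIV_unique by blast
qed

text \<open>The two commutators that drive the whole argument: differentiating \<open>L f\<close> in the velocity produces a position
  derivative, and differentiating it in the position produces only a velocity derivative, weighted by \<open>U''\<close>.\<close>

lemma dy_kfp:
  assumes "smooth1 U" "smooth2 f"
  shows "dy (kfp U f) = (\<lambda>z. dx f z + kfp U (dy f) z - dy f z)"
proof (rule dy_eqI)
  fix x y
  note p = smooth2_partials[OF smooth2_dx[OF assms(2)]] smooth2_partials[OF smooth2_dy[OF assms(2)]]
     smooth2_partials[OF smooth2_dy[OF smooth2_dy[OF assms(2)]]]
  show "((\<lambda>s. kfp U f (x, s)) has_real_derivative dx f (x, y) + kfp U (dy f) (x, y) - dy f (x, y)) (at y)"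
    unfolding kfp_fun_eq fst_conv snd_conv
    by (auto intro!: derivative_eq_intros partialsD p simp: dx_dy_commute[OF assms(2)] algebra_simps)
qed

lemma dx_kfp:
  assumes "smooth1 U" "smooth2 f"
  shows "dx (kfp U f) = (\<lambda>z. kfp U (dx f) z - deriv (deriv U) (fst z) * dy f z)"
proof (rule dx_eqI)
  fix x y
  note p = smooth2_partials[OF smooth2_dx[OF assms(2)]] smooth2_partials[OF smooth2_dy[OF assms(2)]]
     smooth2_partials[OF smooth2_dy[OF smooth2_dy[OF assms(2)]]]
  show "((\<lambda>s. kfp U f (s, y)) has_real_derivative kfp U (dx f) (x, y) - deriv (deriv U) (fst (x, y)) * dy f (x, y)) (at x)"
    unfolding kfp_fun_eq fst_conv snd_conv
    by (auto intro!: derivative_eq_intros partialsD p smooth1_DERIV smooth1_deriv assms(1)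
        simp: dx_dy_commute[OF assms(2)] dx_dy_commute[OF smooth2_dy[OF assms(2)]] algebra_simps)
qed

text \<open>Functions to which the generator applies with a continuous result: one derivative in the position, two in the
  velocity. Smooth functions, the cutoffs below and their products all belong to this class.\<close>

definition C12 :: "(real \<times> real \<Rightarrow> real) \<Rightarrow> bool" where
  "C12 f \<longleftrightarrow> partials f \<and> partials (dy f) \<and> continuous_on UNIV f \<and> continuous_on UNIV (dx f) \<and>
     continuous_on UNIV (dy f) \<and> continuous_on UNIV (dy (dy f))"

lemma smooth2_C12: "smooth2 f \<Longrightarrow> C12 f"
  by (simp add: C12_def smooth2_partials smooth2_continuous smooth2_dx smooth2_dy)

lemma C12_mult:
  assumes "C12 f" "C12 g"
  shows "C12 (\<lambda>z. f z * g z)"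
    and "dx (\<lambda>z. f z * g z) = (\<lambda>z. dx f z * g z + f z * dx g z)"
    and "dy (\<lambda>z. f z * g z) = (\<lambda>z. dy f z * g z + f z * dy g z)"
    and "dy (dy (\<lambda>z. f z * g z)) = (\<lambda>z. dy (dy f) z * g z + 2 * dy f z * dy g z + f z * dy (dy g) z)"
proof -
  have p: "partials f" "partials g" "partials (dy f)" "partials (dy g)"
    using assms by (auto simp: C12_def)
  note m = partials_mult[OF p(1,2)]
  show "dx (\<lambda>z. f z * g z) = (\<lambda>z. dx f z * g z + f z * dx g z)"
    and 1: "dy (\<lambda>z. f z * g z) = (\<lambda>z. dy f z * g z + f z * dy g z)"
    by fact+
  have 2: "dy (\<lambda>z. f z * g z) = (\<lambda>z. 1 * (dy f z * g z) + 1 * (f z * dy g z))"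
    using 1 by simp
  note mm = partials_mult[OF p(3,2)] partials_mult[OF p(1,4)]
  have 3: "partials (dy (\<lambda>z. f z * g z))"
    unfolding 2 by (intro partials_linear mm)
  show 4: "dy (dy (\<lambda>z. f z * g z)) = (\<lambda>z. dy (dy f) z * g z + 2 * dy f z * dy g z + f z * dy (dy g) z)"
    unfolding 2 partials_linear(3)[OF mm(1) mm(4)] mm by (auto simp: algebra_simps)
  show "C12 (\<lambda>z. f z * g z)"
    unfolding C12_def 4 using 3 m assms by (auto simp: C12_def intro!: continuous_intros)
qed

text \<open>The diffusion property: its last term is twice the carre du champ of the generator.\<close>

lemma kfp_mult:
  assumes "C12 f" "C12 g"
  shows "kfp U (\<lambda>z. f z * g z) z = f z * kfp U g z + g z * kfp U f z + 2 * (dy f z * dy g z)"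
  unfolding kfp_fun_eq C12_mult(4)[OF assms]
  unfolding C12_mult(2,3)[OF assms] by (simp add: algebra_simps)

section \<open>Square integrable functions\<close>

lemma L2_measurable: "L2 M f \<Longrightarrow> f \<in> borel_measurable M"
  by (simp add: L2_def)

lemma L2_mult_integrable:
  assumes "L2 M f" "L2 M g"
  shows "integrable M (\<lambda>z. f z * g z)"
proof (rule Bochner_Integration.integrable_bound)
  show "integrable M (\<lambda>z. (f z)\<^sup>2 + (g z)\<^sup>2)"
    using assms by (simp add: L2_def)
  show "(\<lambda>z. f z * g z) \<in> borel_measurable M"
    using assms by (intro borel_measurable_times) (simp_all add: L2_def)
  have "\<bar>a * b\<bar> \<le> a\<^sup>2 + b\<^sup>2" for a b :: real
    using sum_squares_bound[of "\<bar>a\<bar>" "\<bar>b\<bar>"] mult_nonneg_nonneg[of "\<bar>a\<bar>" "\<bar>b\<bar>"]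
    unfolding abs_mult power2_abs by linarith
  then show "AE z in M. norm (f z * g z) \<le> norm ((f z)\<^sup>2 + (g z)\<^sup>2)"
    by (auto intro: order_trans[OF _ abs_ge_self])
qed

lemma L2_linear:
  assumes "L2 M f" "L2 M g"
  shows "L2 M (\<lambda>z. a * f z + b * g z)"
proof -
  have "integrable M (\<lambda>z. a\<^sup>2 * (f z)\<^sup>2 + 2 * a * b * (f z * g z) + b\<^sup>2 * (g z)\<^sup>2)"
    using assms L2_mult_integrable[OF assms] by (auto simp: L2_def)
  then show ?thesis
    using assms by (auto simp: L2_def power2_sum power_mult_distrib algebra_simps)
qed

lemma L2_add: "L2 M f \<Longrightarrow> L2 M g \<Longrightarrow> L2 M (\<lambda>z. f z + g z)"
  using L2_linear[of M f g 1 1] by simp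

lemma L2_diff: "L2 M f \<Longrightarrow> L2 M g \<Longrightarrow> L2 M (\<lambda>z. f z - g z)"
  using L2_linear[of M f g 1 "-1"] by simp

lemma L2_scale: "L2 M f \<Longrightarrow> L2 M (\<lambda>z. a * f z)"
  using L2_linear[of M f f a 0] by simp

lemma L2_bounded_mult:
  assumes "L2 M f" "b \<in> borel_measurable M" "\<And>z. \<bar>b z\<bar> \<le> K"
  shows "L2 M (\<lambda>z. b z * f z)"
proof -
  have "integrable M (\<lambda>z. (b z * f z)\<^sup>2)"
  proof (rule Bochner_Integration.integrable_bound)
    show "integrable M (\<lambda>z. K\<^sup>2 * (f z)\<^sup>2)"
      using assms by (simp add: L2_def)
    have "(b z)\<^sup>2 \<le> K\<^sup>2" for z
      using assms(3)[of z] by (simp add: abs_le_square_iff[symmetric])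
    then show "AE z in M. norm ((b z * f z)\<^sup>2) \<le> norm (K\<^sup>2 * (f z)\<^sup>2)"
      by (auto simp: power_mult_distrib intro!: mult_right_mono)
  qed (use assms in \<open>auto simp: L2_def\<close>)
  then show ?thesis using assms unfolding L2_def by (intro conjI borel_measurable_times) auto
qed

lemma normsq_nonneg: "normsq M f \<ge> 0"
  by (simp add: normsq_def)

lemma normsq_linear:
  assumes "L2 M f" "L2 M g"
  shows "normsq M (\<lambda>z. a * f z + b * g z) =
    a\<^sup>2 * normsq M f + 2 * a * b * (\<integral>z. f z * g z \<partial>M) + b\<^sup>2 * normsq M g"
proof -
  have "normsq M (\<lambda>z. a * f z + b * g z) =
     (\<integral>z. a\<^sup>2 * (f z)\<^sup>2 + 2 * a * b * (f z * g z) + b\<^sup>2 * (g z)\<^sup>2 \<partial>M)"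
    unfolding normsq_def
    by (intro Bochner_Integration.integral_cong) (auto simp: power2_sum power_mult_distrib algebra_simps)
  also have "\<dots> = a\<^sup>2 * normsq M f + 2 * a * b * (\<integral>z. f z * g z \<partial>M) + b\<^sup>2 * normsq M g"
    using assms L2_mult_integrable[OF assms] by (simp add: L2_def normsq_def)
  finally show ?thesis .
qed

lemma normsq_add:
  assumes "L2 M f" "L2 M g"
  shows "normsq M (\<lambda>z. f z + g z) = normsq M f + 2 * (\<integral>z. f z * g z \<partial>M) + normsq M g"
  using normsq_linear[OF assms, of 1 1] by simp

lemma normsq_diff:
  assumes "L2 M f" "L2 M g"
  shows "normsq M (\<lambda>z. f z - g z) = normsq M f - 2 * (\<integral>z. f z * g z \<partial>M) + normsq M g"
  using normsq_linear[OF assms, of 1 "-1"] by simp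

lemma normsq_scale: "normsq M (\<lambda>z. a * f z) = a\<^sup>2 * normsq M f"
  by (simp add: normsq_def power_mult_distrib)

text \<open>The quadratic form \<open>a\<^sup>2|f|\<^sup>2 + 2ab\<langle>f, g\<rangle> + b\<^sup>2|g|\<^sup>2\<close> is nonnegative; the two cases avoid a division by \<open>|g|\<^sup>2\<close>.\<close>

lemma L2_Cauchy_Schwarz:
  assumes f: "L2 M f" and g: "L2 M g"
  shows "(\<integral>z. f z * g z \<partial>M)\<^sup>2 \<le> normsq M f * normsq M g"
proof -
  define A where "A = normsq M f"
  define B where "B = (\<integral>z. f z * g z \<partial>M)"
  define C where "C = normsq M g"
  have q: "0 \<le> a\<^sup>2 * A + 2 * a * b * B + b\<^sup>2 * C" for a b
    using normsq_linear[OF f g, of a b] normsq_nonneg[of M "\<lambda>z. a * f z + b * g z"]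
    by (simp add: A_def B_def C_def)
  show ?thesis
  proof (cases "C = 0")
    case True
    have "B = 0"
    proof (rule ccontr)
      assume "B \<noteq> 0"
      then show False using q[of 1 "- (A + 1) / (2 * B)"] True by (simp add: field_simps)
    qed
    then show ?thesis by (simp add: normsq_nonneg B_def)
  next
    case False
    then have "C > 0" using normsq_nonneg[of M g] by (simp add: C_def)
    moreover have "0 \<le> C * (A * C - B\<^sup>2)"
      using q[of C "- B"] by (simp add: power2_eq_square algebra_simps)
    ultimately show ?thesis
      by (simp add: zero_le_mult_iff A_def B_def C_def)
  qed
qed

lemma L2_Cauchy_Schwarz_abs:
  assumes f: "L2 M f" and g: "L2 M g"
  shows "\<bar>\<integral>z. f z * g z \<partial>M\<bar> \<le> sqrt (normsq M f) * sqrt (normsq M g)"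
  using real_sqrt_le_mono[OF L2_Cauchy_Schwarz[OF assms]] by (simp add: real_sqrt_mult)

lemma normsq_add_le:
  assumes f: "L2 M f" and g: "L2 M g"
  shows "normsq M (\<lambda>z. f z + g z) \<le> 2 * normsq M f + 2 * normsq M g"
  using normsq_nonneg[of M "\<lambda>z. f z - g z"] normsq_add[OF f g] normsq_diff[OF f g] by simp

definition l2_inner :: "'a measure \<Rightarrow> ('a \<Rightarrow> real) \<Rightarrow> ('a \<Rightarrow> real) \<Rightarrow> real" where
  "l2_inner N f g = (\<integral>z. f z * g z \<partial>N)"

lemma l2_inner_commute: "l2_inner N f g = l2_inner N g f"
  by (simp add: l2_inner_def mult.commute)

lemma l2_inner_self: "l2_inner N f f = normsq N f"
  by (simp add: l2_inner_def normsq_def power2_eq_square)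

lemma l2_inner_linear:
  assumes "L2 N f" "L2 N g" "L2 N h"
  shows "l2_inner N h (\<lambda>z. f z + g z) = l2_inner N h f + l2_inner N h g"
    and "l2_inner N h (\<lambda>z. f z - g z) = l2_inner N h f - l2_inner N h g"
    and "l2_inner N h (\<lambda>z. c * f z) = c * l2_inner N h f"
proof -
  note i = L2_mult_integrable[OF assms(3,1)] L2_mult_integrable[OF assms(3,2)]
  show "l2_inner N h (\<lambda>z. f z + g z) = l2_inner N h f + l2_inner N h g"
    and "l2_inner N h (\<lambda>z. f z - g z) = l2_inner N h f - l2_inner N h g"
    using i by (simp_all add: l2_inner_def distrib_left right_diff_distrib)
  show "l2_inner N h (\<lambda>z. c * f z) = c * l2_inner N h f"
    by (simp add: l2_inner_def mult.left_commute)
qed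

lemma l2_inner_diff_left:
  assumes "L2 N f" "L2 N g" "L2 N h"
  shows "l2_inner N (\<lambda>z. f z - g z) h = l2_inner N f h - l2_inner N g h"
  unfolding l2_inner_commute[of N _ h] by (rule l2_inner_linear(2)[OF assms])

lemma l2_inner_abs_le: "L2 N f \<Longrightarrow> L2 N g \<Longrightarrow> \<bar>l2_inner N f g\<bar> \<le> sqrt (normsq N f) * sqrt (normsq N g)"
  unfolding l2_inner_def by (rule L2_Cauchy_Schwarz_abs)

lemma l2_inner_square_le: "L2 N f \<Longrightarrow> L2 N g \<Longrightarrow> (l2_inner N f g)\<^sup>2 \<le> normsq N f * normsq N g"
  unfolding l2_inner_def by (rule L2_Cauchy_Schwarz)

section \<open>Gibbs measures on the line\<close>

lemma sets_gibbs [measurable_cong, simp]: "sets (gibbs V) = sets borel"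
  and space_gibbs [simp]: "space (gibbs V) = UNIV"
  by (simp_all add: gibbs_def)

lemma gibbs_normaliser_pos:
  assumes "smooth1 V" "integrable lborel (\<lambda>x. exp (- V x))"
  shows "(\<integral>x. exp (- V x) \<partial>lborel) > 0"
proof -
  have "\<not> (AE x in lborel. exp (- V x) = 0)"
    using ae_filter_eq_bot_iff[of "lborel :: real measure"] trivial_limit_def[of "ae_filter lborel"] by simp
  then have "(\<integral>x. exp (- V x) \<partial>lborel) \<noteq> 0"
    using integral_nonneg_eq_0_iff_AE[OF assms(2)] by auto
  moreover have "(\<integral>x. exp (- V x) \<partial>lborel) \<ge> 0" by simp
  ultimately show ?thesis by linarith
qed

lemma gibbs_density_measurable:
  assumes "smooth1 V"
  shows "(\<lambda>x. exp (- V x)) \<in> borel_measurable borel"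
  by (intro borel_measurable_continuous_onI continuous_intros smooth1_continuous assms)

lemma integral_gibbs:
  assumes "smooth1 V" "f \<in> borel_measurable borel"
  shows "(\<integral>x. f x \<partial>gibbs V) = (\<integral>x. exp (- V x) * f x \<partial>lborel) / (\<integral>x. exp (- V x) \<partial>lborel)"
proof -
  let ?Z = "\<integral>x. exp (- V x) \<partial>lborel"
  have [measurable]: "(\<lambda>x. exp (- V x)) \<in> borel_measurable borel"
    by (rule gibbs_density_measurable[OF assms(1)])
  have "(\<integral>x. f x \<partial>gibbs V) = (\<integral>x. (exp (- V x) / ?Z) *\<^sub>R f x \<partial>lborel)"
    unfolding gibbs_def using assms(2) by (subst integral_density) auto
  also have "\<dots> = (\<integral>x. (exp (- V x) * f x) / ?Z \<partial>lborel)"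
    by (intro Bochner_Integration.integral_cong) auto
  finally show ?thesis by simp
qed

lemma prob_space_gibbs:
  assumes "smooth1 V" "integrable lborel (\<lambda>x. exp (- V x))"
  shows "prob_space (gibbs V)"
proof -
  let ?Z = "\<integral>x. exp (- V x) \<partial>lborel"
  have Z: "?Z > 0" by (rule gibbs_normaliser_pos[OF assms])
  have "(\<integral>\<^sup>+x. ennreal (exp (- V x) / ?Z) \<partial>lborel) = ennreal (\<integral>x. exp (- V x) / ?Z \<partial>lborel)"
    using assms(2) Z by (intro nn_integral_eq_integral) auto
  also have "\<dots> = 1" using Z by simp
  finally have "(\<integral>\<^sup>+x. ennreal (exp (- V x) / ?Z) \<partial>lborel) = 1" .
  then have "emeasure (gibbs V) UNIV = 1"
    unfolding gibbs_def using gibbs_density_measurable[OF assms(1)]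
    by (subst emeasure_density) auto
  then show ?thesis by (intro prob_spaceI) simp
qed

text \<open>The integrand is \<open>exp V\<close> times the derivative of the compactly supported function \<open>g exp (- V)\<close>.\<close>

lemma gibbs_integration_by_parts:
  assumes V: "smooth1 V" and g: "\<And>x. (g has_real_derivative g' x) (at x)"
    and cont: "continuous_on UNIV g'" and supp: "\<And>x. R < \<bar>x\<bar> \<Longrightarrow> g x = 0"
  shows "(\<integral>x. (g' x - deriv V x * g x) \<partial>gibbs V) = 0"
proof -
  define S where "S = \<bar>R\<bar> + 1"
  have S: "S > 0" "R < S" by (auto simp: S_def)
  have cg: "continuous_on A g" for A
    using g by (meson DERIV_isCont continuous_at_imp_continuous_on)
  have cV: "continuous_on UNIV V" "continuous_on UNIV (deriv V)"
    by (auto intro: smooth1_continuous smooth1_deriv V)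
  have g'0: "g' x = 0" if "R < \<bar>x\<bar>" for x
  proof -
    have "\<forall>y. \<bar>x - y\<bar> < \<bar>x\<bar> - R \<longrightarrow> g x = g y"
      using supp that by (smt (verit))
    then show ?thesis using DERIV_local_const[OF g, of "\<bar>x\<bar> - R" x] that by auto
  qed
  let ?F' = "\<lambda>x. exp (- V x) * (g' x - deriv V x * g x)"
  have F: "((\<lambda>x. exp (- V x) * g x) has_real_derivative ?F' x) (at x)" for x
    by (auto intro!: derivative_eq_intros g smooth1_DERIV V simp: algebra_simps)
  have cF: "continuous_on UNIV ?F'"
    by (intro continuous_intros cV cont cg)
  have "(\<integral>x. ?F' x \<partial>lborel) = (\<integral>x. ?F' x * indicator {- S .. S} x \<partial>lborel)"
  proof (intro Bochner_Integration.integral_cong refl)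
    fix x show "?F' x = ?F' x * indicator {- S .. S} x"
    proof (cases "x \<in> {- S .. S}")
      case False
      then have "R < \<bar>x\<bar>" using S by auto
      then show ?thesis using supp g'0 by simp
    qed simp
  qed
  also have "\<dots> = exp (- V S) * g S - exp (- V (- S)) * g (- S)"
    using S F cF by (intro integral_FTC_Icc_real) (auto simp: continuous_on_eq_continuous_at)
  also have "\<dots> = 0" using supp[of S] supp[of "- S"] S by simp
  finally have *: "(\<integral>x. ?F' x \<partial>lborel) = 0" .
  have "(\<lambda>x. g' x - deriv V x * g x) \<in> borel_measurable borel"
    by (intro borel_measurable_continuous_onI continuous_intros cV cont cg)
  then show ?thesis using * by (subst integral_gibbs[OF V]) auto
qed

lemma smooth1_half_square: "smooth1 (\<lambda>y. y\<^sup>2 / 2)"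
proof -
  have quadratic: "\<exists>a b c. (deriv ^^ k) (\<lambda>y::real. y\<^sup>2 / 2) = (\<lambda>y. a * y\<^sup>2 + b * y + c)" for k
  proof (induction k)
    case 0
    show ?case by (rule exI[of _ "1/2"], rule exI[of _ 0], rule exI[of _ 0]) auto
  next
    case (Suc k)
    then obtain a b c where *: "(deriv ^^ k) (\<lambda>y::real. y\<^sup>2 / 2) = (\<lambda>y. a * y\<^sup>2 + b * y + c)" by blast
    have "deriv (\<lambda>y::real. a * y\<^sup>2 + b * y + c) = (\<lambda>y. 0 * y\<^sup>2 + (2 * a) * y + b)"
      by (intro ext DERIV_imp_deriv) (auto intro!: derivative_eq_intros)
    then show ?case unfolding funpow.simps o_apply * by blast
  qed
  then have "(deriv ^^ k) (\<lambda>y::real. y\<^sup>2 / 2) differentiable (at x)" for k x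
  proof -
    obtain a b c where *: "(deriv ^^ k) (\<lambda>y::real. y\<^sup>2 / 2) = (\<lambda>y. a * y\<^sup>2 + b * y + c)"
      using quadratic[of k] by blast
    have "((\<lambda>y. a * y\<^sup>2 + b * y + c) has_real_derivative 2 * a * x + b) (at x)"
      by (auto intro!: derivative_eq_intros)
    then show ?thesis unfolding * real_differentiable_def by blast
  qed
  then show ?thesis by (simp add: smooth1_def)
qed

lemma deriv_half_square: "deriv (\<lambda>y::real. y\<^sup>2 / 2) = (\<lambda>y. y)"
  by (intro ext DERIV_imp_deriv) (auto intro!: derivative_eq_intros)

lemma integrable_half_square: "integrable lborel (\<lambda>y::real. exp (- (y\<^sup>2 / 2)))"
proof -
  have "integrable lborel (\<lambda>y::real. sqrt (2 * pi) * std_normal_density y)"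
    using integrable_normal_density[of 1 0] by auto
  moreover have "(\<lambda>y::real. sqrt (2 * pi) * std_normal_density y) = (\<lambda>y. exp (- (y\<^sup>2 / 2)))"
    by (auto simp: std_normal_density_def)
  ultimately show ?thesis by simp
qed

section \<open>Integration by parts for the kinetic generator\<close>

definition compact_supp :: "(real \<times> real \<Rightarrow> real) \<Rightarrow> bool" where
  "compact_supp f \<longleftrightarrow> (\<exists>R. \<forall>x y. R < \<bar>x\<bar> \<or> R < \<bar>y\<bar> \<longrightarrow> f (x, y) = 0)"

lemma compact_supp_mult: "compact_supp f \<Longrightarrow> compact_supp (\<lambda>z. f z * g z)" "compact_supp f \<Longrightarrow> compact_supp (\<lambda>z. g z * f z)"
  unfolding compact_supp_def by fastforce+

lemma compact_supp_add: assumes "compact_supp f" "compact_supp g" shows "compact_supp (\<lambda>z. f z + g z)"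
proof -
  obtain R1 where R1: "\<forall>x y. R1 < \<bar>x\<bar> \<or> R1 < \<bar>y\<bar> \<longrightarrow> f (x, y) = 0"
    using assms(1) compact_supp_def by auto
  obtain R2 where R2: "\<forall>x y. R2 < \<bar>x\<bar> \<or> R2 < \<bar>y\<bar> \<longrightarrow> g (x, y) = 0"
    using assms(2) compact_supp_def by auto
  show ?thesis unfolding compact_supp_def
    by (rule exI[of _ "max R1 R2"]) (use R1 R2 in auto)
qed

lemma compact_supp_derivative:
  assumes "compact_supp f" "partials f"
  shows "compact_supp (dx f)" "compact_supp (dy f)"
proof -
  obtain R where R: "\<forall>x y. R < \<bar>x\<bar> \<or> R < \<bar>y\<bar> \<longrightarrow> f (x, y) = 0"
    using assms(1) compact_supp_def by auto
  have "dx f (x, y) = 0" if "R < \<bar>x\<bar> \<or> R < \<bar>y\<bar>" for x y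
  proof -
    define e where "e = (if R < \<bar>x\<bar> then \<bar>x\<bar> - R else 1)"
    have "e > 0" by (auto simp: e_def)
    moreover have "\<forall>r. \<bar>x - r\<bar> < e \<longrightarrow> f (x, y) = f (r, y)"
      using R that by (smt (verit) e_def)
    ultimately show ?thesis using DERIV_local_const[OF partialsD(1)[OF assms(2)]] by blast
  qed
  then show "compact_supp (dx f)" unfolding compact_supp_def by blast
  have "dy f (x, y) = 0" if "R < \<bar>x\<bar> \<or> R < \<bar>y\<bar>" for x y
  proof -
    define e where "e = (if R < \<bar>y\<bar> then \<bar>y\<bar> - R else 1)"
    have "e > 0" by (auto simp: e_def)
    moreover have "\<forall>r. \<bar>y - r\<bar> < e \<longrightarrow> f (x, y) = f (x, r)"
      using R that by (smt (verit) e_def)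
    ultimately show ?thesis using DERIV_local_const[OF partialsD(2)[OF assms(2)]] by blast
  qed
  then show "compact_supp (dy f)" unfolding compact_supp_def by blast
qed

lemma compact_supp_bounded:
  assumes "compact_supp f" "continuous_on UNIV f"
  obtains K where "\<And>z. \<bar>f z\<bar> \<le> K"
proof -
  obtain R where R: "\<forall>x y. R < \<bar>x\<bar> \<or> R < \<bar>y\<bar> \<longrightarrow> f (x, y) = 0"
    using assms(1) compact_supp_def by auto
  have "compact (f ` ({-\<bar>R\<bar>..\<bar>R\<bar>} \<times> {-\<bar>R\<bar>..\<bar>R\<bar>}))"
    by (intro compact_continuous_image compact_Times) (auto intro: continuous_on_subset assms(2))
  then obtain K where K: "\<And>z. z \<in> {-\<bar>R\<bar>..\<bar>R\<bar>} \<times> {-\<bar>R\<bar>..\<bar>R\<bar>} \<Longrightarrow> \<bar>f z\<bar> \<le> K"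
    by (metis (no_types, lifting) bounded_iff compact_imp_bounded image_eqI real_norm_def)
  have "\<bar>f (x, y)\<bar> \<le> \<bar>K\<bar>" for x y
  proof (cases "R < \<bar>x\<bar> \<or> R < \<bar>y\<bar>")
    case True
    then show ?thesis using R by auto
  next
    case False
    then have "(x, y) \<in> {-\<bar>R\<bar>..\<bar>R\<bar>} \<times> {-\<bar>R\<bar>..\<bar>R\<bar>}" by auto
    then show ?thesis using K[of "(x, y)"] by linarith
  qed
  then show thesis by (intro that[of "\<bar>K\<bar>"]) auto
qed

text \<open>A power of the positive part of \<open>1 - s\<^sup>2\<close>: the exponent \<open>3\<close> gives a compactly supported function with two
  continuous derivatives, which is all that the generator requires of a cutoff.\<close>

definition bump :: "nat \<Rightarrow> real \<Rightarrow> real" where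
  "bump n s = max 0 (1 - s\<^sup>2) ^ n"

lemma bump_DERIV:
  "(bump (Suc (Suc n)) has_real_derivative (- 2 * real (Suc (Suc n))) * s * bump (Suc n) s) (at s)"
proof -
  have pos: "((\<lambda>x::real. max 0 x ^ Suc (Suc n)) has_real_derivative real (Suc (Suc n)) * max 0 x ^ Suc n) (at x)" for x
  proof -
    consider "x > 0" | "x < 0" | "x = 0" by linarith
    then show ?thesis
    proof cases
      case 1
      have "((\<lambda>x::real. x ^ Suc (Suc n)) has_real_derivative real (Suc (Suc n)) * x ^ Suc n) (at x)"
        by (rule DERIV_power_Suc[OF DERIV_ident, THEN DERIV_cong]) auto
      moreover have "eventually (\<lambda>r. r \<in> {0<..}) (nhds x)"
        using 1 by (intro eventually_nhds_in_open) auto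
      then have "eventually (\<lambda>r. max 0 r ^ Suc (Suc n) = r ^ Suc (Suc n)) (nhds x)"
        by eventually_elim auto
      then have "((\<lambda>r. max 0 r ^ Suc (Suc n)) has_real_derivative D) (at x)
          \<longleftrightarrow> ((\<lambda>r. r ^ Suc (Suc n)) has_real_derivative D) (at x)" for D
        by (rule DERIV_cong_ev[OF refl _ refl])
      ultimately show ?thesis using 1 by simp
    next
      case 2
      have "eventually (\<lambda>r. r \<in> {..<0}) (nhds x)"
        using 2 by (intro eventually_nhds_in_open) auto
      then have "eventually (\<lambda>r. max 0 r ^ Suc (Suc n) = 0) (nhds x)"
        by eventually_elim auto
      then have "((\<lambda>r. max 0 r ^ Suc (Suc n)) has_real_derivative D) (at x)
          \<longleftrightarrow> ((\<lambda>r. 0) has_real_derivative D) (at x)" for D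
        by (rule DERIV_cong_ev[OF refl _ refl])
      then show ?thesis using 2 by simp
    next
      case 3
      have "((\<lambda>h::real. max 0 h ^ Suc n) \<longlongrightarrow> max 0 0 ^ Suc n) (at 0)"
        by (intro tendsto_intros)
      then have "((\<lambda>h::real. max 0 h ^ Suc n) \<longlongrightarrow> 0) (at 0)" by simp
      then have "((\<lambda>h::real. (max 0 (0 + h) ^ Suc (Suc n) - max 0 0 ^ Suc (Suc n)) / h) \<longlongrightarrow> 0) (at 0)"
        by (rule Lim_transform_eventually) (auto simp: eventually_at_filter max_def)
      then show ?thesis using 3 by (auto simp: DERIV_def)
    qed
  qed
  have "((\<lambda>s. 1 - s\<^sup>2) has_real_derivative - 2 * s) (at s)"
    by (auto intro!: derivative_eq_intros)
  from DERIV_chain2[OF pos this]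
  have "((\<lambda>s. max 0 (1 - s\<^sup>2) ^ Suc (Suc n)) has_real_derivative
       (real (Suc (Suc n)) * max 0 (1 - s\<^sup>2) ^ Suc n) * (- 2 * s)) (at s)" .
  from DERIV_cong[OF this] show ?thesis
    unfolding bump_def by (simp add: algebra_simps)
qed

lemma bump_bounds: "0 \<le> bump n s" "bump n s \<le> 1"
  by (auto simp: bump_def intro!: power_le_one)

lemma bump_zero:
  assumes "1 \<le> \<bar>s\<bar>"
  shows "bump (Suc n) s = 0"
proof -
  have "1 \<le> s\<^sup>2" using assms abs_le_square_iff[of 1 s] by simp
  then show ?thesis by (simp add: bump_def max_def)
qed

lemma bump_continuous: "continuous_on A (bump n)"
  unfolding bump_def by (intro continuous_intros)

text \<open>The adjoint of \<open>kfp U\<close> in \<open>L\<^sup>2\<close> of the kinetic measure: the transport part changes its sign, the velocity part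
  does not.\<close>

definition kfp_adj :: "(real \<Rightarrow> real) \<Rightarrow> (real \<times> real \<Rightarrow> real) \<Rightarrow> real \<times> real \<Rightarrow> real" where
  "kfp_adj U f = (\<lambda>z. - (snd z * dx f z) + deriv U (fst z) * dy f z - snd z * dy f z + dy (dy f) z)"

locale kinetic =
  fixes U :: "real \<Rightarrow> real" and M :: real
  assumes smooth: "smooth1 U"
    and integrable_weight: "integrable lborel (\<lambda>x. exp (- U x))"
    and hess_bounded: "\<And>x. \<bar>deriv (deriv U) x\<bar> \<le> M"
begin

abbreviation \<mu> :: "(real \<times> real) measure" where "\<mu> \<equiv> kin_measure U"
abbreviation \<gamma> :: "real measure" where "\<gamma> \<equiv> gibbs (\<lambda>y. y\<^sup>2 / 2)"

sublocale X: prob_space "gibbs U"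
  by (rule prob_space_gibbs[OF smooth integrable_weight])

sublocale Y: prob_space \<gamma>
  by (rule prob_space_gibbs[OF smooth1_half_square integrable_half_square])

sublocale XY: pair_prob_space "gibbs U" \<gamma> ..

lemma \<mu>_eq: "\<mu> = gibbs U \<Otimes>\<^sub>M \<gamma>"
  by (simp add: kin_measure_def)

sublocale kin: prob_space \<mu>
  unfolding \<mu>_eq by unfold_locales

lemma sets_\<mu>: "sets \<mu> = sets borel"
  unfolding \<mu>_eq borel_prod[symmetric] by (intro sets_pair_measure_cong) simp_all

lemma measurable_\<mu>: "borel_measurable \<mu> = borel_measurable borel"
  by (intro measurable_cong_sets sets_\<mu> refl)

lemma continuous_measurable: "continuous_on UNIV f \<Longrightarrow> f \<in> borel_measurable \<mu>"
  unfolding measurable_\<mu> by (rule borel_measurable_continuous_onI)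

lemma M_nonneg: "M \<ge> 0"
  using hess_bounded[of 0] by linarith

lemma continuous_drift: "continuous_on A (\<lambda>z::real\<times>real. deriv U (fst z))"
  by (rule continuous_on_compose2[OF smooth1_continuous[OF smooth1_deriv[OF smooth]]])
     (auto intro!: continuous_intros)

lemma continuous_hess: "continuous_on A (\<lambda>z::real\<times>real. deriv (deriv U) (fst z))"
  by (rule continuous_on_compose2[OF smooth1_continuous[OF smooth1_deriv[OF smooth1_deriv[OF smooth]]]])
     (auto intro!: continuous_intros)

lemma compact_supp_integrable:
  assumes "compact_supp f" "continuous_on UNIV f"
  shows "integrable \<mu> f" "L2 \<mu> f"
proof -
  have *: "integrable \<mu> f" if f: "compact_supp f" "continuous_on UNIV f" for f
  proof -
    obtain K where "\<And>z. \<bar>f z\<bar> \<le> K" using compact_supp_bounded[OF f] by blast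
    then show ?thesis
      using continuous_measurable[OF f(2)] by (intro kin.integrable_const_bound[of _ K]) auto
  qed
  show "integrable \<mu> f" by (rule *[OF assms])
  have "integrable \<mu> (\<lambda>z. f z * f z)"
    by (intro * compact_supp_mult continuous_intros assms)
  then show "L2 \<mu> f"
    using continuous_measurable[OF assms(2)] by (simp add: L2_def power2_eq_square)
qed

lemma integration_by_parts_x:
  assumes "partials \<phi>" "compact_supp \<phi>" "continuous_on UNIV \<phi>" "continuous_on UNIV (dx \<phi>)"
  shows "(\<integral>z. (dx \<phi> z - deriv U (fst z) * \<phi> z) \<partial>\<mu>) = 0"
proof -
  let ?h = "\<lambda>z. dx \<phi> z - deriv U (fst z) * \<phi> z"
  obtain R where R: "\<forall>x y. R < \<bar>x\<bar> \<or> R < \<bar>y\<bar> \<longrightarrow> \<phi> (x, y) = 0"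
    using assms(2) compact_supp_def by auto
  have "compact_supp (\<lambda>z. dx \<phi> z + (- deriv U (fst z)) * \<phi> z)"
    by (intro compact_supp_add compact_supp_mult compact_supp_derivative assms)
  then have int: "integrable (gibbs U \<Otimes>\<^sub>M \<gamma>) (case_prod (\<lambda>x y. ?h (x, y)))"
    using compact_supp_integrable(1)[of ?h] assms continuous_drift
    by (simp add: case_prod_beta' \<mu>_eq[symmetric] continuous_on_diff continuous_on_mult)
  have "(\<integral>x. (dx \<phi> (x, y) - deriv U x * \<phi> (x, y)) \<partial>gibbs U) = 0" for y
  proof (rule gibbs_integration_by_parts[OF smooth])
    show "((\<lambda>x. \<phi> (x, y)) has_real_derivative dx \<phi> (x, y)) (at x)" for x
      by (rule partialsD[OF assms(1)])
    show "continuous_on UNIV (\<lambda>x. dx \<phi> (x, y))"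
      by (rule continuous_on_compose2[OF assms(4)]) (auto intro!: continuous_intros)
    show "\<And>x. R < \<bar>x\<bar> \<Longrightarrow> \<phi> (x, y) = 0" using R by auto
  qed
  then have "(\<integral>y. (\<integral>x. ?h (x, y) \<partial>gibbs U) \<partial>\<gamma>) = 0" by simp
  then show ?thesis
    using XY.integral_snd[OF int] by (simp add: case_prod_beta' \<mu>_eq)
qed

lemma integration_by_parts_y:
  assumes "partials \<phi>" "compact_supp \<phi>" "continuous_on UNIV \<phi>" "continuous_on UNIV (dy \<phi>)"
  shows "(\<integral>z. (dy \<phi> z - snd z * \<phi> z) \<partial>\<mu>) = 0"
proof -
  let ?h = "\<lambda>z. dy \<phi> z - snd z * \<phi> z"
  obtain R where R: "\<forall>x y. R < \<bar>x\<bar> \<or> R < \<bar>y\<bar> \<longrightarrow> \<phi> (x, y) = 0"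
    using assms(2) compact_supp_def by auto
  have "compact_supp (\<lambda>z. dy \<phi> z + (- snd z) * \<phi> z)"
    by (intro compact_supp_add compact_supp_mult compact_supp_derivative assms)
  then have int: "integrable (gibbs U \<Otimes>\<^sub>M \<gamma>) (case_prod (\<lambda>x y. ?h (x, y)))"
    using compact_supp_integrable(1)[of ?h] assms
    by (simp add: case_prod_beta' \<mu>_eq[symmetric] continuous_on_diff continuous_on_mult continuous_on_snd)
  have "(\<integral>y. (dy \<phi> (x, y) - deriv (\<lambda>y. y\<^sup>2 / 2) y * \<phi> (x, y)) \<partial>\<gamma>) = 0" for x
  proof (rule gibbs_integration_by_parts[OF smooth1_half_square])
    show "((\<lambda>y. \<phi> (x, y)) has_real_derivative dy \<phi> (x, y)) (at y)" for y
      by (rule partialsD[OF assms(1)])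
    show "continuous_on UNIV (\<lambda>y. dy \<phi> (x, y))"
      by (rule continuous_on_compose2[OF assms(4)]) (auto intro!: continuous_intros)
    show "\<And>y. R < \<bar>y\<bar> \<Longrightarrow> \<phi> (x, y) = 0" using R by auto
  qed
  then have "(\<integral>x. (\<integral>y. ?h (x, y) \<partial>\<gamma>) \<partial>gibbs U) = 0" by (simp add: deriv_half_square)
  then show ?thesis
    using XY.integral_fst[OF int] by (simp add: case_prod_beta' \<mu>_eq)
qed

lemma continuous_kfp: "C12 f \<Longrightarrow> continuous_on UNIV (kfp U f)"
  unfolding kfp_fun_eq C12_def by (intro continuous_intros continuous_drift) auto

lemma continuous_kfp_adj: "C12 f \<Longrightarrow> continuous_on UNIV (kfp_adj U f)"
  unfolding kfp_adj_def C12_def by (intro continuous_intros continuous_drift) auto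

lemma compact_supp_kfp_adj:
  assumes "C12 f" "compact_supp f" shows "compact_supp (kfp_adj U f)"
proof -
  have "compact_supp (dx f)" "compact_supp (dy f)" "compact_supp (dy (dy f))"
    using assms by (auto simp: C12_def intro!: compact_supp_derivative)
  then have "compact_supp (\<lambda>z. (- snd z * dx f z + deriv U (fst z) * dy f z) + (- snd z * dy f z + dy (dy f) z))"
    by (intro compact_supp_add compact_supp_mult)
  then show ?thesis by (simp add: kfp_adj_def algebra_simps)
qed

text \<open>The difference of the two integrands is a divergence with respect to the kinetic measure, of the vector field with
  components \<open>y \<psi> p\<close> and \<open>\<psi> \<partial>\<^sub>y p - p \<partial>\<^sub>y \<psi> - U' \<psi> p\<close>.\<close>

lemma kfp_adjoint:
  assumes p: "C12 p" and \<psi>: "C12 \<psi>" "compact_supp \<psi>"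
  shows "(\<integral>z. \<psi> z * kfp U p z \<partial>\<mu>) = (\<integral>z. p z * kfp_adj U \<psi> z \<partial>\<mu>)"
    and "integrable \<mu> (\<lambda>z. \<psi> z * kfp U p z)" "integrable \<mu> (\<lambda>z. p z * kfp_adj U \<psi> z)"
proof -
  have pp: "partials p" "partials (dy p)" "partials \<psi>" "partials (dy \<psi>)"
    and cc: "continuous_on UNIV p" "continuous_on UNIV (dx p)" "continuous_on UNIV (dy p)" "continuous_on UNIV (dy (dy p))"
     "continuous_on UNIV \<psi>" "continuous_on UNIV (dx \<psi>)" "continuous_on UNIV (dy \<psi>)" "continuous_on UNIV (dy (dy \<psi>))"
    using assms by (auto simp: C12_def)
  have cs: "compact_supp \<psi>" "compact_supp (dx \<psi>)" "compact_supp (dy \<psi>)" "compact_supp (dy (dy \<psi>))"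
    using \<psi>(2) pp by (auto intro: compact_supp_derivative)
  show int: "integrable \<mu> (\<lambda>z. \<psi> z * kfp U p z)" "integrable \<mu> (\<lambda>z. p z * kfp_adj U \<psi> z)"
    by (intro compact_supp_integrable compact_supp_mult \<psi> continuous_on_mult cc continuous_kfp continuous_kfp_adj
        p compact_supp_kfp_adj)+
  define \<Phi>1 where "\<Phi>1 = (\<lambda>z. snd z * (\<psi> z * p z))"
  define \<Phi>2 where "\<Phi>2 = (\<lambda>z. 1 * (1 * (\<psi> z * dy p z) + (-1) * (p z * dy \<psi> z)) + (-1) * (deriv U (fst z) * (\<psi> z * p z)))"
  note ps = smooth2_partials[OF smooth2_snd] partials_fst(1)[OF smooth1_deriv[OF smooth]]
  have sndd: "dx snd = (\<lambda>z. 0)" "dy snd = (\<lambda>z. 1)"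
    by (auto simp: dx_def dy_def)
  have p1: "partials \<Phi>1" unfolding \<Phi>1_def by (intro partials_mult ps pp)
  have p2: "partials \<Phi>2" unfolding \<Phi>2_def by (intro partials_linear partials_mult ps pp)
  have d1: "dx \<Phi>1 = (\<lambda>z. snd z * (dx \<psi> z * p z + \<psi> z * dx p z))"
    unfolding \<Phi>1_def by (subst partials_mult) (auto intro!: partials_mult ps pp simp: partials_mult pp sndd)
  have d2: "dy \<Phi>2 = (\<lambda>z. \<psi> z * dy (dy p) z - p z * dy (dy \<psi>) z
      - deriv U (fst z) * (dy \<psi> z * p z + \<psi> z * dy p z))"
  proof (rule dy_eqI)
    fix x y
    show "((\<lambda>s. \<Phi>2 (x, s)) has_real_derivative \<psi> (x, y) * dy (dy p) (x, y) - p (x, y) * dy (dy \<psi>) (x, y)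
      - deriv U (fst (x, y)) * (dy \<psi> (x, y) * p (x, y) + \<psi> (x, y) * dy p (x, y))) (at y)"
      unfolding \<Phi>2_def fst_conv
      by (auto intro!: derivative_eq_intros partialsD pp simp: algebra_simps)
  qed
  have c1: "continuous_on UNIV \<Phi>1" "continuous_on UNIV (dx \<Phi>1)"
    unfolding \<Phi>1_def d1[unfolded \<Phi>1_def] by (intro continuous_intros cc)+
  have c2: "continuous_on UNIV \<Phi>2" "continuous_on UNIV (dy \<Phi>2)"
    unfolding d2 unfolding \<Phi>2_def by (intro continuous_intros cc continuous_drift)+
  have s1: "compact_supp \<Phi>1" unfolding \<Phi>1_def by (intro compact_supp_mult cs)
  have s2: "compact_supp \<Phi>2" unfolding \<Phi>2_def by (intro compact_supp_mult compact_supp_add cs)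
  have i1: "integrable \<mu> (\<lambda>z. dx \<Phi>1 z - deriv U (fst z) * \<Phi>1 z)"
  proof -
    have "integrable \<mu> (\<lambda>z. dx \<Phi>1 z + (- deriv U (fst z)) * \<Phi>1 z)"
      by (intro compact_supp_integrable compact_supp_add compact_supp_mult compact_supp_derivative s1 p1 c1 continuous_intros continuous_drift)
    then show ?thesis by simp
  qed
  have eq: "\<psi> z * kfp U p z - p z * kfp_adj U \<psi> z
      = (dx \<Phi>1 z - deriv U (fst z) * \<Phi>1 z) + (dy \<Phi>2 z - snd z * \<Phi>2 z)" for z
    unfolding d1 d2 by (simp add: \<Phi>1_def \<Phi>2_def kfp_fun_eq kfp_adj_def algebra_simps)
  have i2: "integrable \<mu> (\<lambda>z. dy \<Phi>2 z - snd z * \<Phi>2 z)"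
  proof -
    have "integrable \<mu> (\<lambda>z. dy \<Phi>2 z + (- snd z) * \<Phi>2 z)"
      by (intro compact_supp_integrable compact_supp_add compact_supp_mult compact_supp_derivative s2 p2 c2 continuous_intros)
    then show ?thesis by simp
  qed
  have "(\<integral>z. \<psi> z * kfp U p z \<partial>\<mu>) - (\<integral>z. p z * kfp_adj U \<psi> z \<partial>\<mu>)
      = (\<integral>z. \<psi> z * kfp U p z - p z * kfp_adj U \<psi> z \<partial>\<mu>)"
    using int by simp
  also have "\<dots> = 0"
    unfolding eq using i1 i2 integration_by_parts_x[OF p1 s1 c1] integration_by_parts_y[OF p2 s2 c2] by simp
  finally show "(\<integral>z. \<psi> z * kfp U p z \<partial>\<mu>) = (\<integral>z. p z * kfp_adj U \<psi> z \<partial>\<mu>)" by simp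
qed

text \<open>The scale is \<open>n + 1\<close> rather than \<open>n\<close>, so that it never vanishes.\<close>

definition cut :: "nat \<Rightarrow> real \<times> real \<Rightarrow> real" where
  "cut n z = bump 3 (fst z / real (Suc n)) * bump 3 (snd z / real (Suc n))"

lemma bump3: "(bump 3 has_real_derivative - 6 * s * bump 2 s) (at s)"
  using bump_DERIV[of 1 s] by (simp add: eval_nat_numeral)

lemma bump2: "(bump 2 has_real_derivative - 4 * s * bump 1 s) (at s)"
  using bump_DERIV[of 0 s] by (simp add: eval_nat_numeral)

lemma cut_derivs:
  fixes n defines "N \<equiv> real (Suc n)"
  shows "partials (cut n)"
    and "dx (cut n) = (\<lambda>z. (- 6 * (fst z / N) * bump 2 (fst z / N) / N) * bump 3 (snd z / N))"
    and "dy (cut n) = (\<lambda>z. bump 3 (fst z / N) * (- 6 * (snd z / N) * bump 2 (snd z / N) / N))"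
    and "partials (dy (cut n))"
    and "dy (dy (cut n)) = (\<lambda>z. bump 3 (fst z / N) *
       ((24 * (snd z / N)\<^sup>2 * bump 1 (snd z / N) - 6 * bump 2 (snd z / N)) / N\<^sup>2))"
proof -
  have N: "N > 0" by (simp add: N_def)
  have lin: "((\<lambda>s. s / N) has_real_derivative 1 / N) (at s)" for s
    using N by (auto intro!: derivative_eq_intros)
  note b3 = DERIV_chain2[OF bump3 lin] and b2 = DERIV_chain2[OF bump2 lin]
  have x: "((\<lambda>s. cut n (s, y)) has_real_derivative (- 6 * (x / N) * bump 2 (x / N) / N) * bump 3 (y / N)) (at x)" for x y
    unfolding cut_def fst_conv snd_conv N_def[symmetric]
    by (rule DERIV_cong[OF DERIV_mult[OF b3 DERIV_const]]) simp
  have y: "((\<lambda>s. cut n (x, s)) has_real_derivative bump 3 (x / N) * (- 6 * (y / N) * bump 2 (y / N) / N)) (at y)" for x y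
    unfolding cut_def fst_conv snd_conv N_def[symmetric]
    by (rule DERIV_cong[OF DERIV_mult[OF DERIV_const b3]]) simp
  show "partials (cut n)"
    using x y unfolding partials_def by (meson real_differentiable_def)
  show "dx (cut n) = (\<lambda>z. (- 6 * (fst z / N) * bump 2 (fst z / N) / N) * bump 3 (snd z / N))"
    by (rule dx_eqI) (use x in simp)
  show dy: "dy (cut n) = (\<lambda>z. bump 3 (fst z / N) * (- 6 * (snd z / N) * bump 2 (snd z / N) / N))"
    by (rule dy_eqI) (use y in simp)
  have yx: "((\<lambda>s. dy (cut n) (s, y)) has_real_derivative
      (- 6 * (x / N) * bump 2 (x / N) / N) * (- 6 * (y / N) * bump 2 (y / N) / N)) (at x)" for x y
    unfolding dy fst_conv snd_conv
    by (rule DERIV_cong[OF DERIV_mult[OF b3 DERIV_const]]) simp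
  have yy: "((\<lambda>s. dy (cut n) (x, s)) has_real_derivative bump 3 (x / N) *
     ((24 * (y / N)\<^sup>2 * bump 1 (y / N) - 6 * bump 2 (y / N)) / N\<^sup>2)) (at y)" for x y
    unfolding dy fst_conv snd_conv
    by (rule DERIV_cong[OF DERIV_cmult[OF DERIV_cdivide[OF DERIV_mult[OF DERIV_cmult[OF lin] b2]]]])
       (use N in \<open>simp add: field_simps power2_eq_square\<close>)
  show "partials (dy (cut n))"
    using yx yy unfolding partials_def by (meson real_differentiable_def)
  show "dy (dy (cut n)) = (\<lambda>z. bump 3 (fst z / N) *
       ((24 * (snd z / N)\<^sup>2 * bump 1 (snd z / N) - 6 * bump 2 (snd z / N)) / N\<^sup>2))"
    by (rule dy_eqI) (use yy in simp)
qed

lemma cut_C12: "C12 (cut n)"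
proof -
  have b: "continuous_on UNIV (\<lambda>z::real\<times>real. bump k (fst z / real (Suc n)))"
     "continuous_on UNIV (\<lambda>z::real\<times>real. bump k (snd z / real (Suc n)))" for k
    by (intro continuous_on_compose2[OF bump_continuous[of UNIV]] continuous_intros; simp)+
  have "continuous_on UNIV (cut n)"
    unfolding cut_def[abs_def] by (intro continuous_intros b)
  moreover have "continuous_on UNIV (dx (cut n))" "continuous_on UNIV (dy (cut n))"
    unfolding cut_derivs(2,3) by (intro continuous_intros b; simp)+
  moreover have "continuous_on UNIV (dy (dy (cut n)))"
    unfolding cut_derivs(5) by (intro continuous_intros b; simp)
  ultimately show ?thesis
    unfolding C12_def using cut_derivs(1,4) by blast
qed

lemma cut_compact_supp: "compact_supp (cut n)"
  unfolding compact_supp_def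
proof (intro exI allI impI)
  fix x y assume "real (Suc n) < \<bar>x\<bar> \<or> real (Suc n) < \<bar>y\<bar>"
  then have "1 \<le> \<bar>x / real (Suc n)\<bar> \<or> 1 \<le> \<bar>y / real (Suc n)\<bar>" by (auto simp: abs_divide)
  then show "cut n (x, y) = 0"
    using bump_zero[of _ 2] by (auto simp: cut_def eval_nat_numeral)
qed

lemma cut_bounds: "0 \<le> cut n z" "cut n z \<le> 1"
  by (auto simp: cut_def bump_bounds intro!: mult_nonneg_nonneg mult_le_one)

lemma tendsto_over_Suc: "(\<lambda>n. a / real (Suc n)) \<longlonglongrightarrow> 0"
  using LIMSEQ_Suc[OF lim_const_over_n[of a]] by simp

lemma cut_tendsto: "(\<lambda>n. cut n z) \<longlonglongrightarrow> 1"
proof -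
  have "isCont (bump 3) 0" using bump_continuous[of UNIV 3] by (simp add: continuous_on_eq_continuous_at)
  then have *: "(\<lambda>n. bump 3 (a / real (Suc n))) \<longlonglongrightarrow> bump 3 0" for a
    using tendsto_over_Suc[of a] by (rule isCont_tendsto_compose)
  have "(\<lambda>n. cut n z) \<longlonglongrightarrow> bump 3 0 * bump 3 0"
    unfolding cut_def by (intro tendsto_mult *)
  then show ?thesis by (simp add: bump_def)
qed

lemma drift_growth: "\<bar>deriv U x\<bar> \<le> \<bar>deriv U 0\<bar> + M * \<bar>x\<bar>"
proof -
  have "\<bar>deriv U x - deriv U 0\<bar> \<le> M * \<bar>x - 0\<bar>"
    using field_differentiable_bound[of UNIV "deriv U" "deriv (deriv U)" M x 0]
      smooth1_DERIV[OF smooth1_deriv[OF smooth]] hess_bounded by auto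
  then show ?thesis by simp
qed

text \<open>The first bound is uniform, because the drift is at most of the order of the scale on the support of the
  cutoff; the second one gives the pointwise limit \<open>0\<close>. Together they are what dominated convergence needs.\<close>

lemma cut_adj_bounds:
  shows "\<bar>kfp_adj U (cut n) z\<bar> \<le> 42 + 6 * (\<bar>deriv U 0\<bar> + M)"
    and "\<bar>kfp_adj U (cut n) z\<bar> \<le> (12 * \<bar>snd z\<bar> + 6 * \<bar>deriv U (fst z)\<bar> + 30) / real (Suc n)"
proof -
  define N where "N = real (Suc n)"
  have N: "N \<ge> 1" by (simp add: N_def)
  obtain x y where z: "z = (x, y)" by (cases z)
  define s where "s = x / N"
  define r where "r = y / N"
  have xy: "x = N * s" "y = N * r" using N by (auto simp: s_def r_def)
  have b: "0 \<le> bump k a" "bump k a \<le> 1" for k a by (rule bump_bounds)+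
  have q: "\<bar>6 * a * bump 2 a\<bar> \<le> 6" "\<bar>24 * a\<^sup>2 * bump 1 a - 6 * bump 2 a\<bar> \<le> 30" for a
  proof -
    have "\<bar>6 * a * bump 2 a\<bar> \<le> 6 \<and> \<bar>24 * a\<^sup>2 * bump 1 a - 6 * bump 2 a\<bar> \<le> 30"
    proof (cases "1 \<le> \<bar>a\<bar>")
      case True
      then show ?thesis using bump_zero[of a 0] bump_zero[of a 1] by (simp add: eval_nat_numeral)
    next
      case False
      have "\<bar>a\<bar> * bump 2 a \<le> 1" using False b by (intro mult_le_one) auto
      moreover have "a\<^sup>2 * bump 1 a \<le> 1" "0 \<le> a\<^sup>2 * bump 1 a" using False b[of 1 a]
        by (auto intro!: mult_le_one simp: abs_square_le_1)
      ultimately show ?thesis using b[of 2 a] by (auto simp: abs_mult)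
    qed
    then show "\<bar>6 * a * bump 2 a\<bar> \<le> 6" "\<bar>24 * a\<^sup>2 * bump 1 a - 6 * bump 2 a\<bar> \<le> 30" by auto
  qed
  \<comment> \<open>In the rescaled variables \<open>s = x / N\<close> and \<open>r = y / N\<close> the terms are bounded one by one.\<close>
  have e: "kfp_adj U (cut n) z = (6 * s * bump 2 s) * (r * bump 3 r)
      - (deriv U x * bump 3 s / N) * (6 * r * bump 2 r) + (bump 3 s * r) * (6 * r * bump 2 r)
      + bump 3 s * ((24 * r\<^sup>2 * bump 1 r - 6 * bump 2 r) / N\<^sup>2)"
    unfolding kfp_adj_def cut_derivs(5) unfolding cut_derivs(2,3) N_def[symmetric] z fst_conv snd_conv s_def[symmetric] r_def[symmetric]
    using N by (simp add: xy field_simps)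
  have T4: "\<bar>bump 3 s * ((24 * r\<^sup>2 * bump 1 r - 6 * bump 2 r) / N\<^sup>2)\<bar> \<le> 30 / N"
  proof -
    have "1 * N \<le> N * N" using N by (intro mult_right_mono) auto
    then have "N \<le> N\<^sup>2" by (simp add: power2_eq_square)
    then have "\<bar>(24 * r\<^sup>2 * bump 1 r - 6 * bump 2 r)\<bar> / N\<^sup>2 \<le> 30 / N"
      using q(2)[of r] N by (intro frac_le) auto
    then have "bump 3 s * (\<bar>(24 * r\<^sup>2 * bump 1 r - 6 * bump 2 r)\<bar> / N\<^sup>2) \<le> 1 * (30 / N)"
      using b by (intro mult_mono) auto
    then show ?thesis using b by (simp add: abs_mult abs_divide)
  qed
  have T1: "\<bar>(6 * s * bump 2 s) * (r * bump 3 r)\<bar> \<le> 6 * A" if "\<bar>r * bump 3 r\<bar> \<le> A" for A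
    unfolding abs_mult[of "6 * s * bump 2 s"] using q(1)[of s] that by (intro mult_mono) auto
  have T2: "\<bar>(deriv U x * bump 3 s / N) * (6 * r * bump 2 r)\<bar> \<le> A * 6" if "\<bar>deriv U x * bump 3 s / N\<bar> \<le> A" for A
    unfolding abs_mult[of _ "6 * r * bump 2 r"]
    using q(1)[of r] that by (intro mult_mono order_trans[OF abs_ge_zero that]) simp_all
  have T3: "\<bar>(bump 3 s * r) * (6 * r * bump 2 r)\<bar> \<le> 6 * \<bar>r\<bar>"
  proof -
    have "\<bar>bump 3 s * r\<bar> \<le> 1 * \<bar>r\<bar>" unfolding abs_mult using b[of 3 s] by (intro mult_mono) auto
    then have "\<bar>(bump 3 s * r)\<bar> * \<bar>(6 * r * bump 2 r)\<bar> \<le> \<bar>r\<bar> * 6"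
      using q(1)[of r] by (intro mult_mono) auto
    then show ?thesis
      unfolding abs_mult[of "bump 3 s * r" "6 * r * bump 2 r"] by linarith
  qed
  have T3': "\<bar>(bump 3 s * r) * (6 * r * bump 2 r)\<bar> \<le> 6"
  proof (cases "1 \<le> \<bar>r\<bar>")
    case True
    then show ?thesis using bump_zero[of r 1] by (simp add: eval_nat_numeral)
  next
    case False
    then show ?thesis using T3 by linarith
  qed
  have r1: "\<bar>r * bump 3 r\<bar> \<le> 1"
  proof (cases "1 \<le> \<bar>r\<bar>")
    case True
    then show ?thesis using bump_zero[of r 2] by (simp add: eval_nat_numeral)
  next
    case False
    then show ?thesis using b[of 3 r] unfolding abs_mult by (intro mult_le_one) auto
  qed
  have r2: "\<bar>r * bump 3 r\<bar> \<le> \<bar>r\<bar>"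
    using b[of 3 r] mult_left_mono[of "bump 3 r" 1 "\<bar>r\<bar>"] by (simp add: abs_mult)
  have d1: "\<bar>deriv U x * bump 3 s / N\<bar> \<le> \<bar>deriv U 0\<bar> + M"
  proof (cases "1 \<le> \<bar>s\<bar>")
    case True
    then show ?thesis using bump_zero[of s 2] M_nonneg by (simp add: eval_nat_numeral)
  next
    case False
    have "M * \<bar>x\<bar> \<le> M * N"
      using False N M_nonneg by (intro mult_left_mono) (auto simp: s_def)
    then have "\<bar>deriv U x\<bar> \<le> \<bar>deriv U 0\<bar> * 1 + M * N" using drift_growth[of x] by simp
    also have "\<dots> \<le> \<bar>deriv U 0\<bar> * N + M * N" using N by (intro add_right_mono mult_left_mono) auto
    finally have "\<bar>deriv U x\<bar> / N \<le> \<bar>deriv U 0\<bar> + M" using N by (simp add: field_simps)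
    then have "bump 3 s * (\<bar>deriv U x\<bar> / N) \<le> 1 * (\<bar>deriv U 0\<bar> + M)"
      using b[of 3 s] N by (intro mult_mono) auto
    then show ?thesis using b[of 3 s] N by (simp add: abs_mult mult.commute)
  qed
  have d2: "\<bar>deriv U x * bump 3 s / N\<bar> \<le> \<bar>deriv U x\<bar> / N"
    using b[of 3 s] N mult_left_mono[of "bump 3 s" 1 "\<bar>deriv U x\<bar>"]
    by (simp add: abs_mult divide_right_mono)
  have "30 / N \<le> 30" using N by (simp add: field_simps)
  then show "\<bar>kfp_adj U (cut n) z\<bar> \<le> 42 + 6 * (\<bar>deriv U 0\<bar> + M)"
    using T1[OF r1] T2[OF d1] T3' T4 unfolding e by linarith
  have "\<bar>kfp_adj U (cut n) z\<bar> \<le> 6 * \<bar>r\<bar> + \<bar>deriv U x\<bar> / N * 6 + 6 * \<bar>r\<bar> + 30 / N"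
    using T1[OF r2] T2[OF d2] T3 T4 unfolding e by linarith
  also have "\<dots> = (12 * \<bar>snd z\<bar> + 6 * \<bar>deriv U (fst z)\<bar> + 30) / real (Suc n)"
    unfolding N_def[symmetric] z using N by (simp add: r_def abs_divide field_simps)
  finally show "\<bar>kfp_adj U (cut n) z\<bar> \<le> (12 * \<bar>snd z\<bar> + 6 * \<bar>deriv U (fst z)\<bar> + 30) / real (Suc n)" .
qed

lemma cut_adj_tendsto: "(\<lambda>n. kfp_adj U (cut n) z) \<longlonglongrightarrow> 0"
  by (rule Lim_null_comparison[OF always_eventually tendsto_over_Suc])
     (use cut_adj_bounds(2) in \<open>simp only: real_norm_def, blast\<close>)

lemma cut_integral_tendsto:
  assumes "integrable \<mu> q"
  shows "(\<lambda>n. \<integral>z. cut n z * q z \<partial>\<mu>) \<longlonglongrightarrow> (\<integral>z. q z \<partial>\<mu>)"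
proof (rule integral_dominated_convergence[where w="\<lambda>z. \<bar>q z\<bar>"])
  show "(\<lambda>z. cut n z * q z) \<in> borel_measurable \<mu>" for n
    using cut_C12[of n] assms
    by (intro borel_measurable_times borel_measurable_integrable[of _ q] continuous_measurable) (auto simp: C12_def)
  show "AE z in \<mu>. (\<lambda>n. cut n z * q z) \<longlonglongrightarrow> q z"
    using tendsto_mult_right[OF cut_tendsto] by (intro AE_I2) fastforce
  show "AE z in \<mu>. norm (cut n z * q z) \<le> \<bar>q z\<bar>" for n
    using cut_bounds by (intro AE_I2) (simp add: abs_mult mult_left_le_one_le)
qed (use assms in auto)

lemma cut_adj_integral_tendsto:
  assumes "integrable \<mu> q"
  shows "(\<lambda>n. \<integral>z. q z * kfp_adj U (cut n) z \<partial>\<mu>) \<longlonglongrightarrow> 0"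
proof -
  let ?K = "42 + 6 * (\<bar>deriv U 0\<bar> + M)"
  have "(\<lambda>n. \<integral>z. q z * kfp_adj U (cut n) z \<partial>\<mu>) \<longlonglongrightarrow> (\<integral>z. 0 \<partial>\<mu>)"
  proof (rule integral_dominated_convergence[where w="\<lambda>z. \<bar>q z\<bar> * ?K"])
    show "(\<lambda>z. q z * kfp_adj U (cut n) z) \<in> borel_measurable \<mu>" for n
      using assms
      by (intro borel_measurable_times borel_measurable_integrable[of _ q] continuous_measurable continuous_kfp_adj cut_C12)
    show "AE z in \<mu>. (\<lambda>n. q z * kfp_adj U (cut n) z) \<longlonglongrightarrow> 0"
      using tendsto_mult_left[OF cut_adj_tendsto] by (intro AE_I2) fastforce
    show "AE z in \<mu>. norm (q z * kfp_adj U (cut n) z) \<le> \<bar>q z\<bar> * ?K" for n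
      using cut_adj_bounds(1) by (intro AE_I2) (auto simp: abs_mult intro!: mult_left_mono)
  qed (use assms in auto)
  then show ?thesis by simp
qed

text \<open>By the diffusion property the identity says that the integral of \<open>L (u v)\<close> vanishes. Against a cutoff, the
  operator is moved to the cutoff, where it meets the integrable function \<open>u v\<close> and disappears in the limit.\<close>

lemma dirichlet_form:
  assumes C: "C12 u" "C12 v"
    and L: "L2 \<mu> u" "L2 \<mu> v" "L2 \<mu> (dy u)" "L2 \<mu> (dy v)" "L2 \<mu> (kfp U u)" "L2 \<mu> (kfp U v)"
  shows "(\<integral>z. u z * kfp U v z \<partial>\<mu>) + (\<integral>z. v z * kfp U u z \<partial>\<mu>) = - 2 * (\<integral>z. dy u z * dy v z \<partial>\<mu>)"
proof -
  let ?q = "\<lambda>z. u z * kfp U v z + v z * kfp U u z + 2 * (dy u z * dy v z)"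
  note i = L2_mult_integrable[OF L(1,6)] L2_mult_integrable[OF L(2,5)] L2_mult_integrable[OF L(3,4)]
  have iq: "integrable \<mu> ?q" using i by simp
  have "(\<integral>z. cut n z * ?q z \<partial>\<mu>) = (\<integral>z. (u z * v z) * kfp_adj U (cut n) z \<partial>\<mu>)" for n
    using kfp_adjoint(1)[OF C12_mult(1)[OF C] cut_C12 cut_compact_supp, of n] by (simp add: kfp_mult[OF C])
  then have "(\<lambda>n. \<integral>z. cut n z * ?q z \<partial>\<mu>) \<longlonglongrightarrow> 0"
    using cut_adj_integral_tendsto[OF L2_mult_integrable[OF L(1,2)]] by simp
  then have "(\<integral>z. ?q z \<partial>\<mu>) = 0"
    using cut_integral_tendsto[OF iq] LIMSEQ_unique by blast
  then show ?thesis using i by simp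
qed

end

section \<open>Poincare inequality for the invariant measure\<close>

text \<open>Ground state transform with the eigenfunction \<open>y\<close> of the Ornstein-Uhlenbeck operator: the integrand equals
  \<open>exp (- y\<^sup>2 / 2) (g' - g / y)\<^sup>2\<close> plus the derivative of \<open>exp (- y\<^sup>2 / 2) g\<^sup>2 / y\<close>, a function that vanishes at
  \<open>0\<close> and is nonnegative at \<open>R\<close>.\<close>

lemma half_line_hardy:
  fixes g :: "real \<Rightarrow> real"
  assumes g: "\<And>y. (g has_real_derivative g' y) (at y)" and cont: "continuous_on UNIV g'"
    and g0: "g 0 = 0" and R: "0 \<le> R"
  shows "0 \<le> integral {0..R} (\<lambda>y. exp (- (y\<^sup>2 / 2)) * ((g' y)\<^sup>2 - (g y)\<^sup>2))"
proof -
  have cg: "continuous_on A g" for A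
    using g by (meson DERIV_isCont continuous_at_imp_continuous_on)
  define F where "F = (\<lambda>y. exp (- (y\<^sup>2 / 2)) * ((g y)\<^sup>2 / y))"
  define F' where "F' = (\<lambda>y. exp (- (y\<^sup>2 / 2)) * (2 * g y * g' y / y - (g y)\<^sup>2 / y\<^sup>2 - (g y)\<^sup>2))"
  have F: "(F has_real_derivative F' y) (at y)" if "y > 0" for y
    unfolding F_def F'_def using that
    by (auto intro!: derivative_eq_intros g simp: field_simps power2_eq_square)
  have cF: "continuous_on {0..R} F"
  proof -
    have "isCont F 0"
    proof -
      have "((\<lambda>h. (g (0 + h) - g 0) / h) \<longlongrightarrow> g' 0) (at 0)"
        using g[of 0] by (simp add: DERIV_def)
      then have q: "((\<lambda>y. g y / y) \<longlongrightarrow> g' 0) (at 0)" by (simp add: g0)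
      have l: "(g \<longlongrightarrow> 0) (at 0)" using DERIV_isCont[OF g, of 0] by (simp add: isCont_def g0)
      have e: "((\<lambda>y. exp (- (y\<^sup>2 / 2))) \<longlongrightarrow> exp (- (0\<^sup>2 / 2))) (at (0::real))"
        by (intro tendsto_intros) auto
      have "((\<lambda>y. exp (- (y\<^sup>2 / 2)) * (g y * (g y / y))) \<longlongrightarrow> exp (- (0\<^sup>2 / 2)) * (0 * g' 0)) (at 0)"
        by (intro tendsto_mult q l e)
      then show ?thesis by (simp add: isCont_def F_def power2_eq_square)
    qed
    then have "isCont F y" if "y \<in> {0..R}" for y
      using that F[of y] by (cases "y = 0") (auto intro: DERIV_isCont)
    then show ?thesis by (simp add: continuous_at_imp_continuous_on)
  qed
  have "(F' has_integral F R - F 0) {0..R}"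
    using R cF F by (intro fundamental_theorem_of_calculus_interior)
      (auto simp: has_real_derivative_iff_has_vector_derivative[symmetric])
  moreover have "((\<lambda>y. exp (- (y\<^sup>2 / 2)) * ((g' y)\<^sup>2 - (g y)\<^sup>2)) has_integral
      integral {0..R} (\<lambda>y. exp (- (y\<^sup>2 / 2)) * ((g' y)\<^sup>2 - (g y)\<^sup>2))) {0..R}"
    by (intro integrable_integral integrable_continuous_real continuous_intros cg
        continuous_on_subset[OF cont]) auto
  moreover have "F' y \<le> exp (- (y\<^sup>2 / 2)) * ((g' y)\<^sup>2 - (g y)\<^sup>2)" for y
  proof -
    have "0 \<le> (g' y - g y / y)\<^sup>2" by simp
    then have "2 * g y * g' y / y - (g y)\<^sup>2 / y\<^sup>2 \<le> (g' y)\<^sup>2"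
      by (simp add: power2_diff power_divide algebra_simps)
    then show ?thesis unfolding F'_def by (intro mult_left_mono) auto
  qed
  ultimately have "F R - F 0 \<le> integral {0..R} (\<lambda>y. exp (- (y\<^sup>2 / 2)) * ((g' y)\<^sup>2 - (g y)\<^sup>2))"
    by (rule has_integral_le)
  moreover have "F 0 = 0" "F R \<ge> 0" using R by (auto simp: F_def)
  ultimately show ?thesis by linarith
qed

text \<open>Subtracting \<open>g 0\<close> instead of the mean is allowed since the mean minimises the distance of \<open>g\<close> to the constants. The
  anchored form splits into two half lines, to each of which the previous lemma applies.\<close>

lemma gaussian_poincare_anchored:
  fixes g :: "real \<Rightarrow> real"
  assumes g: "\<And>y. (g has_real_derivative g' y) (at y)" and cont: "continuous_on UNIV g'"
    and g0: "g 0 = 0"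
    and L: "L2 (gibbs (\<lambda>y. y\<^sup>2 / 2)) g" "L2 (gibbs (\<lambda>y. y\<^sup>2 / 2)) g'"
  shows "normsq (gibbs (\<lambda>y. y\<^sup>2 / 2)) g \<le> normsq (gibbs (\<lambda>y. y\<^sup>2 / 2)) g'"
proof -
  let ?\<gamma> = "gibbs (\<lambda>y. y\<^sup>2 / 2)"
  let ?q = "\<lambda>y. (g' y)\<^sup>2 - (g y)\<^sup>2"
  let ?e = "\<lambda>y::real. exp (- (y\<^sup>2 / 2)) * ?q y"
  have cg: "continuous_on A g" for A
    using g by (meson DERIV_isCont continuous_at_imp_continuous_on)
  have cq: "continuous_on A ?e" for A
    by (intro continuous_intros cg continuous_on_subset[OF cont]) auto
  have mq: "?q \<in> borel_measurable borel"
    by (intro borel_measurable_continuous_onI continuous_intros cg cont)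
  have iq: "integrable ?\<gamma> ?q" using L by (simp add: L2_def)
  have pos: "0 \<le> (\<integral>y. indicator {- real n .. real n} y * ?q y \<partial>?\<gamma>)" for n
  proof -
    have "0 \<le> integral {0..real n} (\<lambda>y. exp (- (y\<^sup>2 / 2)) * ((- g' (- y))\<^sup>2 - (g (- y))\<^sup>2))"
    proof (rule half_line_hardy)
      show "((\<lambda>y. g (- y)) has_real_derivative - g' (- y)) (at y)" for y
        using g[of "- y"] by (simp add: DERIV_mirror)
      show "continuous_on UNIV (\<lambda>y. - g' (- y))"
        by (intro continuous_intros continuous_on_compose2[OF cont]) auto
    qed (use g0 in auto)
    moreover have "integral {- real n..- 0} (\<lambda>y. ?e (- (- y))) = integral {0..real n} (\<lambda>y. ?e (- y))"
      using Henstock_Kurzweil_Integration.integral_reflect_real[where a=0 and b="real n" and f="\<lambda>y. ?e (- y)"] .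
    ultimately have "0 \<le> integral {- real n..0} ?e"
      by (simp only: minus_minus power2_minus minus_zero)
    moreover have "0 \<le> integral {0..real n} ?e"
      by (rule half_line_hardy[OF g cont g0]) auto
    moreover have "integral {- real n..0} ?e + integral {0..real n} ?e = integral {- real n..real n} ?e"
      by (intro Henstock_Kurzweil_Integration.integral_combine integrable_continuous_real cq) auto
    moreover have "integral {- real n..real n} ?e = (LINT y:{- real n..real n}|lborel. ?e y)"
      by (intro set_borel_integral_eq_integral(2)[symmetric] borel_integrable_atLeastAtMost' cq)
    moreover have "(LINT y:{- real n..real n}|lborel. ?e y)
       = (\<integral>y. exp (- (y\<^sup>2 / 2)) * (indicator {- real n .. real n} y * ?q y) \<partial>lborel)"
      unfolding set_lebesgue_integral_def by (intro Bochner_Integration.integral_cong) auto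
    ultimately have "0 \<le> (\<integral>y. exp (- (y\<^sup>2 / 2)) * (indicator {- real n .. real n} y * ?q y) \<partial>lborel)"
      by linarith
    moreover have "0 \<le> (\<integral>y. exp (- (y\<^sup>2 / 2)) \<partial>(lborel::real measure))" by simp
    ultimately show ?thesis
      using mq by (subst integral_gibbs[OF smooth1_half_square]) (auto intro!: divide_nonneg_nonneg)
  qed
  have "(\<lambda>n. \<integral>y. indicator {- real n .. real n} y * ?q y \<partial>?\<gamma>) \<longlonglongrightarrow> (\<integral>y. ?q y \<partial>?\<gamma>)"
  proof (rule integral_dominated_convergence[where w="\<lambda>y. \<bar>?q y\<bar>"])
    show "AE y in ?\<gamma>. (\<lambda>n. indicator {- real n .. real n} y * ?q y) \<longlonglongrightarrow> ?q y"
    proof (rule AE_I2, rule tendsto_eventually)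
      fix y
      obtain N :: nat where "\<bar>y\<bar> \<le> real N" using real_arch_simple by blast
      then show "\<forall>\<^sub>F n in sequentially. indicator {- real n .. real n} y * ?q y = ?q y"
        unfolding eventually_sequentially by (intro exI[of _ N]) (auto simp: indicator_def)
    qed
    show "AE y in ?\<gamma>. norm (indicator {- real n .. real n} y * ?q y) \<le> \<bar>?q y\<bar>" for n
      by (intro AE_I2) (auto simp: indicator_def)
    show "(\<lambda>y. indicator {- real n .. real n} y * ?q y) \<in> borel_measurable ?\<gamma>" for n
      using mq by (intro borel_measurable_times borel_measurable_indicator) auto
  qed (use iq in auto)
  then have "0 \<le> (\<integral>y. ?q y \<partial>?\<gamma>)"
    using pos by (intro LIMSEQ_le_const) auto
  then show ?thesis using L by (simp add: L2_def normsq_def)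
qed

lemma (in prob_space) integral_square_le:
  assumes "integrable M (\<lambda>x. (f x)\<^sup>2)" "f \<in> borel_measurable M"
  shows "integrable M f" "(\<integral>x. f x \<partial>M)\<^sup>2 \<le> (\<integral>x. (f x)\<^sup>2 \<partial>M)"
    and "normsq M (\<lambda>x. f x - (\<integral>x. f x \<partial>M)) = (\<integral>x. (f x)\<^sup>2 \<partial>M) - (\<integral>x. f x \<partial>M)\<^sup>2"
proof -
  have 1: "L2 M f" "L2 M (\<lambda>x. 1)" using assms by (auto simp: L2_def)
  show "integrable M f" using L2_mult_integrable[OF 1] by simp
  show *: "normsq M (\<lambda>x. f x - (\<integral>x. f x \<partial>M)) = (\<integral>x. (f x)\<^sup>2 \<partial>M) - (\<integral>x. f x \<partial>M)\<^sup>2"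
    using normsq_linear[OF 1, of 1 "- (\<integral>x. f x \<partial>M)"]
    by (simp add: normsq_def prob_space power2_eq_square algebra_simps)
  show "(\<integral>x. f x \<partial>M)\<^sup>2 \<le> (\<integral>x. (f x)\<^sup>2 \<partial>M)"
    using normsq_nonneg[of M "\<lambda>x. f x - (\<integral>x. f x \<partial>M)"] unfolding * by simp
qed

text \<open>Tensorisation of the variance in the style of Efron and Stein: \<open>u\<close> minus both conditional means has a
  nonnegative norm, and the two conditional means are orthogonal because \<open>u\<close> has mean zero.\<close>

lemma (in pair_prob_space) marginal_means_le:
  fixes u :: "'a \<times> 'b \<Rightarrow> real"
  assumes u: "L2 (M1 \<Otimes>\<^sub>M M2) u" and mean: "(\<integral>z. u z \<partial>(M1 \<Otimes>\<^sub>M M2)) = 0"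
  shows "integrable M2 (\<lambda>y. (\<integral>x. u (x, y) \<partial>M1)\<^sup>2)" "integrable M1 (\<lambda>x. (\<integral>y. u (x, y) \<partial>M2)\<^sup>2)"
    and "(\<integral>y. (\<integral>x. u (x, y) \<partial>M1)\<^sup>2 \<partial>M2) + (\<integral>x. (\<integral>y. u (x, y) \<partial>M2)\<^sup>2 \<partial>M1) \<le> normsq (M1 \<Otimes>\<^sub>M M2) u"
proof -
  interpret YX: pair_prob_space M2 M1 ..
  let ?P = "M1 \<Otimes>\<^sub>M M2"
  have mu [measurable]: "u \<in> borel_measurable ?P" and isq: "integrable ?P (\<lambda>z. (u z)\<^sup>2)"
    using u by (auto simp: L2_def)
  have iu: "integrable ?P u" using integral_square_le(1)[OF isq mu] .
  have isq': "integrable ?P (\<lambda>(x, y). (u (x, y))\<^sup>2)" and iu': "integrable ?P (\<lambda>(x, y). u (x, y))"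
    using isq iu by (simp_all add: case_prod_beta')
  define m where "m = (\<lambda>y. \<integral>x. u (x, y) \<partial>M1)"
  define n where "n = (\<lambda>x. \<integral>y. u (x, y) \<partial>M2)"
  have mm [measurable]: "m \<in> borel_measurable M2"
    unfolding m_def using measurable_pair_swap[OF mu]
    by (intro M1.borel_measurable_lebesgue_integral) (simp add: case_prod_beta')
  have mn [measurable]: "n \<in> borel_measurable M1"
    unfolding n_def by (rule M2.borel_measurable_lebesgue_integral) (simp add: case_prod_beta')
  have im: "integrable M2 (\<lambda>y. (m y)\<^sup>2)"
  proof (rule Bochner_Integration.integrable_bound[OF integrable_snd[OF isq']])
    show "AE y in M2. norm ((m y)\<^sup>2) \<le> norm (\<integral>x. (u (x, y))\<^sup>2 \<partial>M1)"
      using AE_integrable_snd[OF isq'] AE_space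
    proof eventually_elim
      case (elim y)
      then show ?case
        unfolding m_def using M1.integral_square_le(2)[OF _ measurable_compose[OF measurable_Pair2' mu]] by simp
    qed
  qed simp
  have inn: "integrable M1 (\<lambda>x. (n x)\<^sup>2)"
  proof (rule Bochner_Integration.integrable_bound[OF integrable_fst[OF isq']])
    show "AE x in M1. norm ((n x)\<^sup>2) \<le> norm (\<integral>y. (u (x, y))\<^sup>2 \<partial>M2)"
      using AE_integrable_fst[OF isq'] AE_space
    proof eventually_elim
      case (elim x)
      then show ?case
        unfolding n_def using M2.integral_square_le(2)[OF _ measurable_compose[OF measurable_Pair1' mu]] by simp
    qed
  qed simp
  have imP: "integrable ?P (\<lambda>z. (m (snd z))\<^sup>2)"
  proof -
    have "integrable (M2 \<Otimes>\<^sub>M M1) (\<lambda>z. (m (fst z))\<^sup>2)"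
      by (rule YX.Fubini_integrable) (use im in \<open>simp_all add: M1.prob_space\<close>)
    then show ?thesis
      using integrable_product_swap_iff[of "\<lambda>z. (m (snd z))\<^sup>2"] by (simp add: case_prod_beta')
  qed
  have inP: "integrable ?P (\<lambda>z. (n (fst z))\<^sup>2)"
    by (rule Fubini_integrable) (use inn in \<open>simp_all add: M2.prob_space\<close>)
  have Lm: "L2 ?P (\<lambda>z. m (snd z))" and Ln: "L2 ?P (\<lambda>z. n (fst z))"
    using imP inP by (auto simp: L2_def)
  have um: "(\<integral>z. u z * m (snd z) \<partial>?P) = (\<integral>y. (m y)\<^sup>2 \<partial>M2)"
  proof -
    have "(\<integral>z. u z * m (snd z) \<partial>?P) = (\<integral>y. (\<integral>x. u (x, y) * m y \<partial>M1) \<partial>M2)"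
      using integral_snd[of "\<lambda>x y. u (x, y) * m y"] L2_mult_integrable[OF u Lm] by (simp add: case_prod_beta')
    also have "\<dots> = (\<integral>y. (m y)\<^sup>2 \<partial>M2)" by (simp add: m_def power2_eq_square)
    finally show ?thesis .
  qed
  have un: "(\<integral>z. u z * n (fst z) \<partial>?P) = (\<integral>x. (n x)\<^sup>2 \<partial>M1)"
  proof -
    have "(\<integral>z. u z * n (fst z) \<partial>?P) = (\<integral>x. (\<integral>y. u (x, y) * n x \<partial>M2) \<partial>M1)"
      using integral_fst[of "\<lambda>x y. u (x, y) * n x"] L2_mult_integrable[OF u Ln] by (simp add: case_prod_beta')
    also have "\<dots> = (\<integral>x. (n x)\<^sup>2 \<partial>M1)" by (simp add: n_def power2_eq_square)
    finally show ?thesis .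
  qed
  have sm: "(\<integral>z. (m (snd z))\<^sup>2 \<partial>?P) = (\<integral>y. (m y)\<^sup>2 \<partial>M2)"
    using integral_snd[of "\<lambda>x y. (m y)\<^sup>2"] imP by (simp add: case_prod_beta' M1.prob_space)
  have sn: "(\<integral>z. (n (fst z))\<^sup>2 \<partial>?P) = (\<integral>x. (n x)\<^sup>2 \<partial>M1)"
    using integral_fst[of "\<lambda>x y. (n x)\<^sup>2"] inP by (simp add: case_prod_beta' M2.prob_space)
  have "(\<integral>y. m y \<partial>M2) = 0"
    using integral_snd[OF iu'] mean by (simp add: m_def case_prod_beta')
  \<comment> \<open>Fubini: the two conditional means depend on different variables, and \<open>m\<close> has mean zero.\<close>
  then have mn0: "(\<integral>z. m (snd z) * n (fst z) \<partial>?P) = 0"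
    using integral_fst[of "\<lambda>x y. m y * n x"] L2_mult_integrable[OF Lm Ln] by (simp add: case_prod_beta')
  have "0 \<le> normsq ?P (\<lambda>z. u z - (m (snd z) + n (fst z)))" by (rule normsq_nonneg)
  also have "\<dots> = normsq ?P u - 2 * (\<integral>z. u z * (m (snd z) + n (fst z)) \<partial>?P)
      + normsq ?P (\<lambda>z. m (snd z) + n (fst z))"
    by (rule normsq_diff[OF u L2_add[OF Lm Ln]])
  also have "(\<integral>z. u z * (m (snd z) + n (fst z)) \<partial>?P) = (\<integral>y. (m y)\<^sup>2 \<partial>M2) + (\<integral>x. (n x)\<^sup>2 \<partial>M1)"
    using L2_mult_integrable[OF u Lm] L2_mult_integrable[OF u Ln] by (simp add: distrib_left um un)
  also have "normsq ?P (\<lambda>z. m (snd z) + n (fst z)) = (\<integral>y. (m y)\<^sup>2 \<partial>M2) + (\<integral>x. (n x)\<^sup>2 \<partial>M1)"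
    using normsq_add[OF Lm Ln] sm sn mn0 by (simp add: normsq_def)
  finally have "(\<integral>y. (m y)\<^sup>2 \<partial>M2) + (\<integral>x. (n x)\<^sup>2 \<partial>M1) \<le> normsq ?P u" by simp
  then show "(\<integral>y. (\<integral>x. u (x, y) \<partial>M1)\<^sup>2 \<partial>M2) + (\<integral>x. (\<integral>y. u (x, y) \<partial>M2)\<^sup>2 \<partial>M1) \<le> normsq ?P u"
    by (simp add: m_def n_def)
  show "integrable M2 (\<lambda>y. (\<integral>x. u (x, y) \<partial>M1)\<^sup>2)" "integrable M1 (\<lambda>x. (\<integral>y. u (x, y) \<partial>M2)\<^sup>2)"
    using im inn by (simp_all add: m_def n_def)
qed

context kinetic
begin

lemma continuous_slices:
  assumes "continuous_on UNIV f"
  shows "(\<lambda>x. f (x, y)) \<in> borel_measurable borel" "(\<lambda>y. f (x, y)) \<in> borel_measurable borel"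
    "continuous_on UNIV (\<lambda>x. f (x, y))" "continuous_on UNIV (\<lambda>y. f (x, y))"
proof -
  show *: "continuous_on UNIV (\<lambda>x. f (x, y))" "continuous_on UNIV (\<lambda>y. f (x, y))"
    by (rule continuous_on_compose2[OF assms], auto intro!: continuous_intros)+
  show "(\<lambda>x. f (x, y)) \<in> borel_measurable borel" "(\<lambda>y. f (x, y)) \<in> borel_measurable borel"
    using * by (auto intro: borel_measurable_continuous_onI)
qed

text \<open>On almost every slice the one-dimensional inequalities bound the variance in one variable. Their integrals, \<open>|u|\<^sup>2\<close>
  minus the squared norms of the conditional means, add up to at least \<open>|u|\<^sup>2\<close>.\<close>

lemma poincare_kinetic:
  assumes c: "c > 0" and P: "poincare (gibbs U) c"
    and u: "C12 u" "L2 \<mu> u" "L2 \<mu> (dx u)" "L2 \<mu> (dy u)" and mean: "(\<integral>z. u z \<partial>\<mu>) = 0"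
  shows "normsq \<mu> u \<le> normsq \<mu> (dx u) / c + normsq \<mu> (dy u)"
proof -
  have cont: "continuous_on UNIV u" "continuous_on UNIV (dx u)" "continuous_on UNIV (dy u)" and pu: "partials u"
    using u(1) by (auto simp: C12_def)
  have iu: "integrable (gibbs U \<Otimes>\<^sub>M \<gamma>) (\<lambda>(x, y). (u (x, y))\<^sup>2)"
    and iw: "integrable (gibbs U \<Otimes>\<^sub>M \<gamma>) (\<lambda>(x, y). (dx u (x, y))\<^sup>2)"
    and ih: "integrable (gibbs U \<Otimes>\<^sub>M \<gamma>) (\<lambda>(x, y). (dy u (x, y))\<^sup>2)"
    using u by (simp_all add: L2_def case_prod_beta' \<mu>_eq)
  note mm = XY.marginal_means_le[OF u(2)[unfolded \<mu>_eq] mean[unfolded \<mu>_eq], folded \<mu>_eq]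
  have x: "AE y in \<gamma>. (\<integral>x. (u (x, y))\<^sup>2 \<partial>gibbs U) - (\<integral>x. u (x, y) \<partial>gibbs U)\<^sup>2
      \<le> (\<integral>x. (dx u (x, y))\<^sup>2 \<partial>gibbs U) / c"
    using XY.AE_integrable_snd[OF iu] XY.AE_integrable_snd[OF iw]
  proof eventually_elim
    case (elim y)
    let ?m = "\<integral>x. u (x, y) \<partial>gibbs U"
    let ?g = "\<lambda>x. u (x, y) - ?m"
    have L: "L2 (gibbs U) (\<lambda>x. u (x, y))" "L2 (gibbs U) (\<lambda>x. dx u (x, y))" "L2 (gibbs U) (\<lambda>x. ?m)"
      using elim continuous_slices[OF cont(1)] continuous_slices[OF cont(2)] by (auto simp: L2_def)
    have g: "(?g has_real_derivative dx u (x, y)) (at x)" for x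
      by (auto intro!: derivative_eq_intros partialsD pu)
    have g': "deriv ?g = (\<lambda>x. dx u (x, y))"
      using g by (auto intro: DERIV_imp_deriv)
    have "integrable (gibbs U) (\<lambda>x. u (x, y))"
      using X.integral_square_le(1)[of "\<lambda>x. u (x, y)"] L by (simp add: L2_def)
    then have "(\<integral>x. ?g x \<partial>gibbs U) = 0" using X.prob_space by simp
    moreover have "L2 (gibbs U) ?g" by (rule L2_diff[OF L(1,3)])
    moreover have "\<forall>x. ?g differentiable (at x)" using g real_differentiable_def by blast
    ultimately have "c * normsq (gibbs U) ?g \<le> normsq (gibbs U) (\<lambda>x. dx u (x, y))"
      using P[unfolded poincare_def, THEN spec[of _ ?g], unfolded g'] L(2) continuous_slices(3)[OF cont(2)]
      by blast
    then have "normsq (gibbs U) ?g \<le> (\<integral>x. (dx u (x, y))\<^sup>2 \<partial>gibbs U) / c"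
      using c by (simp add: normsq_def[of _ "\<lambda>x. dx u (x, y)"] field_simps)
    moreover have "normsq (gibbs U) ?g = (\<integral>x. (u (x, y))\<^sup>2 \<partial>gibbs U) - ?m\<^sup>2"
      using X.integral_square_le(3)[of "\<lambda>x. u (x, y)"] L by (simp add: L2_def)
    ultimately show ?case by simp
  qed
  have y: "AE x in gibbs U. (\<integral>y. (u (x, y))\<^sup>2 \<partial>\<gamma>) - (\<integral>y. u (x, y) \<partial>\<gamma>)\<^sup>2 \<le> (\<integral>y. (dy u (x, y))\<^sup>2 \<partial>\<gamma>)"
    using XY.AE_integrable_fst[OF iu] XY.AE_integrable_fst[OF ih]
  proof eventually_elim
    case (elim x)
    let ?n = "\<integral>y. u (x, y) \<partial>\<gamma>"
    let ?g = "\<lambda>y. u (x, y) - u (x, 0)"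
    have L: "L2 \<gamma> (\<lambda>y. u (x, y))" "L2 \<gamma> (\<lambda>y. dy u (x, y))" "\<And>c. L2 \<gamma> (\<lambda>y. c)"
      using elim continuous_slices[OF cont(1)] continuous_slices[OF cont(3)] by (auto simp: L2_def)
    have Lg: "L2 \<gamma> ?g" by (rule L2_diff[OF L(1,3)])
    have i: "integrable \<gamma> (\<lambda>y. u (x, y))"
      using Y.integral_square_le(1)[of "\<lambda>y. u (x, y)"] L by (simp add: L2_def)
    have "normsq \<gamma> ?g \<le> normsq \<gamma> (\<lambda>y. dy u (x, y))"
      by (rule gaussian_poincare_anchored[OF _ continuous_slices(4)[OF cont(3)] _ Lg L(2)])
         (auto intro!: derivative_eq_intros partialsD pu)
    moreover have "(\<integral>y. (u (x, y))\<^sup>2 \<partial>\<gamma>) - ?n\<^sup>2 \<le> normsq \<gamma> ?g"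
    proof -
      have "normsq \<gamma> ?g = (\<integral>y. (u (x, y))\<^sup>2 \<partial>\<gamma>) - 2 * u (x, 0) * ?n + (u (x, 0))\<^sup>2"
        using normsq_diff[OF L(1) L(3)[of "u (x, 0)"]] Y.prob_space
        by (simp add: normsq_def)
      moreover have "0 \<le> (u (x, 0) - ?n)\<^sup>2" by simp
      ultimately show ?thesis by (simp add: power2_diff)
    qed
    ultimately show ?case by (simp add: normsq_def)
  qed
  have Fy: "(\<integral>y. (\<integral>x. (u (x, y))\<^sup>2 \<partial>gibbs U) \<partial>\<gamma>) = normsq \<mu> u"
    and Fx: "(\<integral>x. (\<integral>y. (u (x, y))\<^sup>2 \<partial>\<gamma>) \<partial>gibbs U) = normsq \<mu> u"
    and A: "(\<integral>y. (\<integral>x. (dx u (x, y))\<^sup>2 \<partial>gibbs U) \<partial>\<gamma>) = normsq \<mu> (dx u)"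
    and H: "(\<integral>x. (\<integral>y. (dy u (x, y))\<^sup>2 \<partial>\<gamma>) \<partial>gibbs U) = normsq \<mu> (dy u)"
    using XY.integral_snd[OF iu] XY.integral_fst[OF iu] XY.integral_snd[OF iw] XY.integral_fst[OF ih]
    by (simp_all add: normsq_def \<mu>_eq case_prod_beta')
  have "(\<integral>y. (\<integral>x. (u (x, y))\<^sup>2 \<partial>gibbs U) - (\<integral>x. u (x, y) \<partial>gibbs U)\<^sup>2 \<partial>\<gamma>)
      \<le> (\<integral>y. (\<integral>x. (dx u (x, y))\<^sup>2 \<partial>gibbs U) / c \<partial>\<gamma>)"
    by (intro integral_mono_AE x Bochner_Integration.integrable_diff XY.integrable_snd[OF iu] mm
        integrable_divide XY.integrable_snd[OF iw])
  then have 1: "normsq \<mu> u - (\<integral>y. (\<integral>x. u (x, y) \<partial>gibbs U)\<^sup>2 \<partial>\<gamma>) \<le> normsq \<mu> (dx u) / c"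
    using XY.integrable_snd[OF iu] mm(1) by (simp add: Fy A)
  have "(\<integral>x. (\<integral>y. (u (x, y))\<^sup>2 \<partial>\<gamma>) - (\<integral>y. u (x, y) \<partial>\<gamma>)\<^sup>2 \<partial>gibbs U)
      \<le> (\<integral>x. (\<integral>y. (dy u (x, y))\<^sup>2 \<partial>\<gamma>) \<partial>gibbs U)"
    by (intro integral_mono_AE y Bochner_Integration.integrable_diff XY.integrable_fst[OF iu] mm
        XY.integrable_fst[OF ih])
  then have 2: "normsq \<mu> u - (\<integral>x. (\<integral>y. u (x, y) \<partial>\<gamma>)\<^sup>2 \<partial>gibbs U) \<le> normsq \<mu> (dy u)"
    using XY.integrable_fst[OF iu] mm(2) by (simp add: Fx H)
  show ?thesis using 1 2 mm(3) by linarith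
qed

end

section \<open>Dissipation identities\<close>

context kinetic
begin

definition regular_fun :: "(real \<times> real \<Rightarrow> real) \<Rightarrow> bool" where
  "regular_fun u \<longleftrightarrow> smooth2 u \<and> L2 \<mu> u \<and> L2 \<mu> (dx u) \<and> L2 \<mu> (dy u) \<and> L2 \<mu> (dx (dy u)) \<and>
     L2 \<mu> (dy (dy u)) \<and> L2 \<mu> (dy (dy (dy u)))"

lemma regular_funD:
  assumes "regular_fun u"
  shows "smooth2 u" "L2 \<mu> u" "L2 \<mu> (dx u)" "L2 \<mu> (dy u)" "L2 \<mu> (dx (dy u))"
     "L2 \<mu> (dy (dy u))" "L2 \<mu> (dy (dy (dy u)))"
  using assms by (auto simp: regular_fun_def)

lemma L2_hess: "L2 \<mu> f \<Longrightarrow> L2 \<mu> (\<lambda>z. deriv (deriv U) (fst z) * f z)"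
  by (rule L2_bounded_mult[OF _ continuous_measurable[OF continuous_hess] hess_bounded])

lemma dirichlet_inner:
  assumes "smooth2 u" "smooth2 v" "L2 \<mu> u" "L2 \<mu> v" "L2 \<mu> (dy u)" "L2 \<mu> (dy v)"
    "L2 \<mu> (kfp U u)" "L2 \<mu> (kfp U v)"
  shows "l2_inner \<mu> u (kfp U v) + l2_inner \<mu> v (kfp U u) = - 2 * l2_inner \<mu> (dy u) (dy v)"
  using dirichlet_form[OF assms(1,2)[THEN smooth2_C12] assms(3-)] by (simp add: l2_inner_def)

lemma kfp_of_derivatives:
  assumes "smooth2 u"
  shows "kfp U (dy u) = (\<lambda>z. dy (kfp U u) z - dx u z + dy u z)"
    and "kfp U (dx u) = (\<lambda>z. dx (kfp U u) z + deriv (deriv U) (fst z) * dy u z)"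
    and "kfp U (dy (dy u)) = (\<lambda>z. dy (dy (kfp U u)) z - 2 * dx (dy u) z + 2 * dy (dy u) z)"
proof -
  note s = assms smooth2_dy[OF assms] smooth2_dx[OF assms]
  show 1: "kfp U (dy u) = (\<lambda>z. dy (kfp U u) z - dx u z + dy u z)"
    by (simp add: dy_kfp[OF smooth assms])
  show "kfp U (dx u) = (\<lambda>z. dx (kfp U u) z + deriv (deriv U) (fst z) * dy u z)"
    by (simp add: dx_kfp[OF smooth assms])
  have "dy (kfp U u) = (\<lambda>z. 1 * (1 * dx u z + 1 * kfp U (dy u) z) + (-1) * dy u z)"
    by (simp add: 1)
  then have "dy (dy (kfp U u)) = (\<lambda>z. dy (dx u) z + dy (kfp U (dy u)) z - dy (dy u) z)"
    by (simp only:) (simp only: partials_linear(1,3) s[THEN smooth2_partials]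
        smooth2_partials[OF smooth2_kfp[OF smooth s(2)]], simp)
  then show "kfp U (dy (dy u)) = (\<lambda>z. dy (dy (kfp U u)) z - 2 * dx (dy u) z + 2 * dy (dy u) z)"
    by (simp add: dy_kfp[OF smooth s(2)] dx_dy_commute[OF assms])
qed

text \<open>With \<open>u\<close> on the trajectory and \<open>v\<close>, \<open>a\<close>, \<open>b\<close> its successive time derivatives, the left-hand sides are the
  first three time derivatives of \<open>|u|\<^sup>2\<close> and the first one of \<open>|w|\<^sup>2\<close>. Each step is one use of the Dirichlet form,
  combined with the commutators to express \<open>L h\<close>, \<open>L w\<close>, \<open>L k\<close> and \<open>L (\<partial>\<^sub>y v)\<close>; everything else is linear.\<close>

lemma dissipation_identities:
  assumes u: "regular_fun u" and v: "regular_fun v" and a: "regular_fun a" and b: "L2 \<mu> b"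
    and uv: "kfp U u = v" and va: "kfp U v = a" and ab: "kfp U a = b"
  defines "h \<equiv> dy u" and "w \<equiv> dx u" and "k \<equiv> dy (dy u)"
  shows "2 * l2_inner \<mu> u v = - 2 * normsq \<mu> h"
    and "2 * l2_inner \<mu> v v + 2 * l2_inner \<mu> u a = - 4 * l2_inner \<mu> h w + 4 * normsq \<mu> k + 4 * normsq \<mu> h"
    and "6 * l2_inner \<mu> v a + 2 * l2_inner \<mu> u b = - 4 * normsq \<mu> w + 12 * l2_inner \<mu> h w
       + 4 * l2_inner \<mu> h (\<lambda>z. deriv (deriv U) (fst z) * h z) + 24 * l2_inner \<mu> k (dy w)
       - 8 * normsq \<mu> (dy k) - 24 * normsq \<mu> k - 8 * normsq \<mu> h"
    and "2 * l2_inner \<mu> w (dx v) = - 2 * normsq \<mu> (dy w) - 2 * l2_inner \<mu> w (\<lambda>z. deriv (deriv U) (fst z) * h z)"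
proof -
  note U = regular_funD[OF u] and V = regular_funD[OF v] and A = regular_funD[OF a]
  note s = U(1) V(1) A(1) smooth2_dy[OF U(1)] smooth2_dx[OF U(1)] smooth2_dy[OF V(1)] smooth2_dy[OF smooth2_dy[OF U(1)]]
  have dyw: "dy w = dx h" by (simp add: w_def h_def dx_dy_commute[OF U(1)])
  have Lh: "kfp U h = (\<lambda>z. dy v z - w z + h z)"
    using kfp_of_derivatives(1)[OF U(1)] by (simp add: uv h_def w_def)
  have Lw: "kfp U w = (\<lambda>z. dx v z + deriv (deriv U) (fst z) * h z)"
    using kfp_of_derivatives(2)[OF U(1)] by (simp add: uv h_def w_def)
  have Lk: "kfp U k = (\<lambda>z. dy (dy v) z - 2 * dx h z + 2 * k z)"
    using kfp_of_derivatives(3)[OF U(1)] by (simp add: uv h_def k_def)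
  have Lhv: "kfp U (dy v) = (\<lambda>z. dy a z - dx v z + dy v z)"
    using kfp_of_derivatives(1)[OF V(1)] by (simp add: va)
  have sm: "smooth2 h" "smooth2 w" "smooth2 k" "smooth2 (dy v)"
    using s by (simp_all add: h_def w_def k_def)
  have L: "L2 \<mu> h" "L2 \<mu> w" "L2 \<mu> k" "L2 \<mu> (dx h)" "L2 \<mu> (dy h)" "L2 \<mu> (dy k)" "L2 \<mu> (dy w)"
      "L2 \<mu> (\<lambda>z. deriv (deriv U) (fst z) * h z)"
    using U L2_hess[OF U(4)] by (simp_all add: h_def w_def k_def dx_dy_commute[OF U(1), symmetric])
  note L = L U V A b
  have dyh: "dy h = k" by (simp add: h_def k_def)
  have LL: "L2 \<mu> (kfp U h)" "L2 \<mu> (kfp U w)" "L2 \<mu> (kfp U k)" "L2 \<mu> (kfp U (dy v))"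
    unfolding Lh Lw Lk Lhv by (intro L2_add L2_diff L2_scale L)+
  have L': "L2 \<mu> (\<lambda>z. dy v z - w z)" "L2 \<mu> (\<lambda>z. dy a z - dx v z)" "L2 \<mu> (\<lambda>z. dy (dy v) z - 2 * dx h z)"
     "L2 \<mu> (\<lambda>z. 2 * dx h z)" "L2 \<mu> (\<lambda>z. 2 * k z)"
    by (intro L2_add L2_diff L2_scale L)+
  have uvE: "l2_inner \<mu> u v + l2_inner \<mu> u v = - 2 * l2_inner \<mu> h h"
    using dirichlet_inner[of u u] L s by (simp add: uv h_def)
  have vv: "l2_inner \<mu> u a + l2_inner \<mu> v v = - 2 * l2_inner \<mu> h (dy v)"
    using dirichlet_inner[of u v] L s by (simp add: uv va h_def)
  have va': "l2_inner \<mu> v a + l2_inner \<mu> v a = - 2 * l2_inner \<mu> (dy v) (dy v)"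
    using dirichlet_inner[of v v] L s by (simp add: va)
  have ua: "l2_inner \<mu> u b + l2_inner \<mu> v a = - 2 * l2_inner \<mu> h (dy a)"
    using dirichlet_inner[of u a] L s by (simp add: uv ab h_def l2_inner_commute[of \<mu> a v])
  have hh: "l2_inner \<mu> h (dy v) - l2_inner \<mu> h w + l2_inner \<mu> h h = - l2_inner \<mu> k k"
    using dirichlet_inner[of h h] L LL(1) sm unfolding Lh dyh by (simp add: l2_inner_linear L L')
  have hw: "l2_inner \<mu> h (dx v) + l2_inner \<mu> h (\<lambda>z. deriv (deriv U) (fst z) * h z)
      + (l2_inner \<mu> w (dy v) - l2_inner \<mu> w w + l2_inner \<mu> h w) = - 2 * l2_inner \<mu> k (dy w)"
    using dirichlet_inner[of h w] L LL(1,2) sm unfolding Lh Lw dyh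
    by (simp add: l2_inner_linear L L' l2_inner_commute[of \<mu> w h])
  have hhv: "l2_inner \<mu> h (dy a) - l2_inner \<mu> h (dx v) + l2_inner \<mu> h (dy v)
      + (l2_inner \<mu> (dy v) (dy v) - l2_inner \<mu> w (dy v) + l2_inner \<mu> h (dy v)) = - 2 * l2_inner \<mu> k (dy (dy v))"
    using dirichlet_inner[of h "dy v"] L LL(1,4) sm unfolding Lh Lhv dyh
    by (simp add: l2_inner_linear L L' l2_inner_commute[of \<mu> "dy v" w] l2_inner_commute[of \<mu> "dy v" h])
  have kk: "l2_inner \<mu> k (dy (dy v)) - 2 * l2_inner \<mu> k (dy w) + 2 * l2_inner \<mu> k k = - l2_inner \<mu> (dy k) (dy k)"
    using dirichlet_inner[of k k] L LL(3) sm unfolding Lk dyw by (simp add: l2_inner_linear L L')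
  have ww: "l2_inner \<mu> w (dx v) + l2_inner \<mu> w (\<lambda>z. deriv (deriv U) (fst z) * h z) = - l2_inner \<mu> (dy w) (dy w)"
    using dirichlet_inner[of w w] L LL(2) sm unfolding Lw by (simp add: l2_inner_linear L L')
  show "2 * l2_inner \<mu> u v = - 2 * normsq \<mu> h"
    using uvE by (simp add: l2_inner_self)
  show "2 * l2_inner \<mu> v v + 2 * l2_inner \<mu> u a = - 4 * l2_inner \<mu> h w + 4 * normsq \<mu> k + 4 * normsq \<mu> h"
    using vv hh unfolding l2_inner_self by linarith
  show "6 * l2_inner \<mu> v a + 2 * l2_inner \<mu> u b = - 4 * normsq \<mu> w + 12 * l2_inner \<mu> h w
       + 4 * l2_inner \<mu> h (\<lambda>z. deriv (deriv U) (fst z) * h z) + 24 * l2_inner \<mu> k (dy w)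
       - 8 * normsq \<mu> (dy k) - 24 * normsq \<mu> k - 8 * normsq \<mu> h"
    using va' ua hhv hh hw kk unfolding l2_inner_self by linarith
  show "2 * l2_inner \<mu> w (dx v) = - 2 * normsq \<mu> (dy w) - 2 * l2_inner \<mu> w (\<lambda>z. deriv (deriv U) (fst z) * h z)"
    using ww unfolding l2_inner_self by linarith
qed

end

section \<open>Derivatives of square integrable curves and semigroups\<close>

lemma normsq_cong_AE:
  assumes "AE z in N. f z = g z" "f \<in> borel_measurable N" "g \<in> borel_measurable N"
  shows "normsq N f = normsq N g"
  unfolding normsq_def using assms by (intro integral_cong_AE) (auto elim: eventually_mono)

lemma l2_inner_tendsto:
  assumes f: "((\<lambda>s. normsq N (\<lambda>z. f s z - f0 z)) \<longlongrightarrow> 0) F"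
    and g: "((\<lambda>s. normsq N (\<lambda>z. g s z - g0 z)) \<longlongrightarrow> 0) F"
    and L: "eventually (\<lambda>s. L2 N (f s)) F" "eventually (\<lambda>s. L2 N (g s)) F" "L2 N f0" "L2 N g0"
  shows "((\<lambda>s. l2_inner N (f s) (g s)) \<longlongrightarrow> l2_inner N f0 g0) F"
proof -
  let ?nf = "\<lambda>s. sqrt (normsq N (\<lambda>z. f s z - f0 z))" and ?ng = "\<lambda>s. sqrt (normsq N (\<lambda>z. g s z - g0 z))"
  have nf: "(?nf \<longlongrightarrow> 0) F" and ng: "(?ng \<longlongrightarrow> 0) F"
    using tendsto_real_sqrt[OF f] tendsto_real_sqrt[OF g] by simp_all
  have "((\<lambda>s. l2_inner N (f s) (g s) - l2_inner N f0 g0) \<longlongrightarrow> 0) F"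
  proof (rule Lim_null_comparison)
    show "\<forall>\<^sub>F s in F. norm (l2_inner N (f s) (g s) - l2_inner N f0 g0)
        \<le> ?nf s * sqrt (normsq N g0) + sqrt (normsq N f0) * ?ng s + ?nf s * ?ng s"
      using L(1,2)
    proof eventually_elim
      case (elim s)
      let ?a = "\<lambda>z. f s z - f0 z" and ?b = "\<lambda>z. g s z - g0 z"
      have La: "L2 N ?a" and Lb: "L2 N ?b"
        using elim L by (auto intro: L2_diff)
      have 1: "l2_inner N ?a ?b = l2_inner N (f s) (g s) - l2_inner N (f s) g0 - (l2_inner N f0 (g s) - l2_inner N f0 g0)"
        using l2_inner_linear(2)[OF elim(2) L(4) La] l2_inner_diff_left[OF elim(1) L(3) elim(2)]
          l2_inner_diff_left[OF elim(1) L(3) L(4)] by linarith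
      have 2: "l2_inner N ?a g0 = l2_inner N (f s) g0 - l2_inner N f0 g0"
        by (rule l2_inner_diff_left[OF elim(1) L(3) L(4)])
      have 3: "l2_inner N f0 ?b = l2_inner N f0 (g s) - l2_inner N f0 g0"
        using l2_inner_linear(2)[OF elim(2) L(4) L(3)] .
      have "l2_inner N (f s) (g s) - l2_inner N f0 g0 = l2_inner N ?a g0 + l2_inner N f0 ?b + l2_inner N ?a ?b"
        unfolding 1 2 3 by simp
      then show ?case
        using l2_inner_abs_le[OF La L(4)] l2_inner_abs_le[OF L(3) Lb] l2_inner_abs_le[OF La Lb] by simp
    qed
    have "((\<lambda>s. ?nf s * sqrt (normsq N g0) + sqrt (normsq N f0) * ?ng s + ?nf s * ?ng s)
        \<longlongrightarrow> 0 * sqrt (normsq N g0) + sqrt (normsq N f0) * 0 + 0 * 0) F"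
      by (intro tendsto_intros nf ng)
    then show "((\<lambda>s. ?nf s * sqrt (normsq N g0) + sqrt (normsq N f0) * ?ng s + ?nf s * ?ng s) \<longlongrightarrow> 0) F"
      by simp
  qed
  then show ?thesis by (rule Lim_null[THEN iffD2])
qed

text \<open>Differentiability on the half-line as a curve in \<open>L\<^sup>2\<close>; at \<open>t = 0\<close> the derivative is the right one.\<close>

definition L2_deriv :: "'a measure \<Rightarrow> (real \<Rightarrow> 'a \<Rightarrow> real) \<Rightarrow> ('a \<Rightarrow> real) \<Rightarrow> real \<Rightarrow> bool" where
  "L2_deriv N q q' t \<longleftrightarrow>
     ((\<lambda>s. normsq N (\<lambda>z. (q s z - q t z) / (s - t) - q' z)) \<longlongrightarrow> 0) (at t within {0..})"

lemma L2_deriv_const: "L2_deriv N (\<lambda>t. f) (\<lambda>z. 0) t"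
  by (simp add: L2_deriv_def normsq_def)

lemma eventually_at_within_self: "eventually (\<lambda>s. s \<in> S \<and> s \<noteq> t) (at t within S)"
  by (auto simp: eventually_at_filter)

lemma L2_deriv_inner:
  assumes d: "L2_deriv N p p' t" "L2_deriv N q q' t"
    and L: "\<And>s. s \<ge> 0 \<Longrightarrow> L2 N (p s)" "\<And>s. s \<ge> 0 \<Longrightarrow> L2 N (q s)" "L2 N p'" "L2 N q'" and t: "t \<ge> 0"
  shows "((\<lambda>s. l2_inner N (p s) (q s)) has_real_derivative l2_inner N p' (q t) + l2_inner N (p t) q') (at t within {0..})"
proof -
  let ?F = "at t within {0..}"
  let ?p = "\<lambda>s z. (p s z - p t z) / (s - t)" and ?q = "\<lambda>s z. (q s z - q t z) / (s - t)"
  have Lpt: "L2 N (p t)" "L2 N (q t)" using L t by auto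
  have Lp: "L2 N (?p s)" and Lq: "L2 N (?q s)" if "s \<ge> 0" for s
    using L2_scale[OF L2_diff[OF L(1)[OF that] Lpt(1)], of "1 / (s - t)"]
      L2_scale[OF L2_diff[OF L(2)[OF that] Lpt(2)], of "1 / (s - t)"] by simp_all
  have ev: "eventually (\<lambda>s. L2 N (?p s)) ?F" "eventually (\<lambda>s. L2 N (?q s)) ?F"
    using eventually_at_within_self[of "{0..}" t] by (auto elim!: eventually_mono intro: Lp Lq)
  have c: "((\<lambda>s. normsq N (\<lambda>z. f z - f z)) \<longlongrightarrow> 0) ?F" for f by (simp add: normsq_def)
  have lim: "((\<lambda>s. l2_inner N (?p s) (q t) + l2_inner N (p t) (?q s) + (s - t) * l2_inner N (?p s) (?q s))
      \<longlongrightarrow> l2_inner N p' (q t) + l2_inner N (p t) q' + (t - t) * l2_inner N p' q') ?F"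
    using d[unfolded L2_deriv_def] by (intro tendsto_intros l2_inner_tendsto c ev L Lpt) (auto simp: Lpt)
  have "((\<lambda>s. (l2_inner N (p s) (q s) - l2_inner N (p t) (q t)) / (s - t)) \<longlongrightarrow> l2_inner N p' (q t) + l2_inner N (p t) q') ?F"
  proof (rule Lim_transform_eventually)
    show "((\<lambda>s. l2_inner N (?p s) (q t) + l2_inner N (p t) (?q s) + (s - t) * l2_inner N (?p s) (?q s))
      \<longlongrightarrow> l2_inner N p' (q t) + l2_inner N (p t) q') ?F" using lim by simp
    show "\<forall>\<^sub>F s in ?F. l2_inner N (?p s) (q t) + l2_inner N (p t) (?q s) + (s - t) * l2_inner N (?p s) (?q s)
        = (l2_inner N (p s) (q s) - l2_inner N (p t) (q t)) / (s - t)"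
      using eventually_at_within_self[of "{0..}" t]
    proof eventually_elim
      case (elim s)
      then have Ls: "L2 N (p s)" "L2 N (q s)" using L by auto
      have L1: "L2 N (\<lambda>z. p s z - p t z)" "L2 N (\<lambda>z. q s z - q t z)"
        by (intro L2_diff Ls Lpt)+
      have 0: "?p s = (\<lambda>z. (1 / (s - t)) * (p s z - p t z))" "?q s = (\<lambda>z. (1 / (s - t)) * (q s z - q t z))"
        by auto
      have 1: "l2_inner N (?p s) f = (l2_inner N (p s) f - l2_inner N (p t) f) / (s - t)" if "L2 N f" for f
      proof -
        have "l2_inner N f (?p s) = (1 / (s - t)) * l2_inner N f (\<lambda>z. p s z - p t z)"
          unfolding 0 by (rule l2_inner_linear(3)[OF L1(1) L1(1) that])
        then show ?thesis
          using l2_inner_linear(2)[OF Ls(1) Lpt(1) that] unfolding l2_inner_commute[of N f] by simp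
      qed
      have 2: "l2_inner N f (?q s) = (l2_inner N f (q s) - l2_inner N f (q t)) / (s - t)" if "L2 N f" for f
      proof -
        have "l2_inner N f (?q s) = (1 / (s - t)) * l2_inner N f (\<lambda>z. q s z - q t z)"
          unfolding 0 by (rule l2_inner_linear(3)[OF L1(2) L1(2) that])
        then show ?thesis using l2_inner_linear(2)[OF Ls(2) Lpt(2) that] by simp
      qed
      have "(s - t) * l2_inner N (?p s) (?q s) = l2_inner N (p s) (?q s) - l2_inner N (p t) (?q s)"
        using elim 1[OF Lq, of s] by simp
      then show ?case
        unfolding 1[OF Lpt(2)] 2[OF Lpt(1)] 2[OF Ls(1)] by (simp add: diff_divide_distrib)
    qed
  qed
  then show ?thesis by (simp add: has_field_derivative_iff)
qed

lemma markov_semigroupD: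
  assumes "markov_semigroup N P" "t \<ge> 0"
  shows "L2 N f \<Longrightarrow> L2 N (P t f)" "L2 N f \<Longrightarrow> normsq N (P t f) \<le> normsq N f"
    and "L2 N f \<Longrightarrow> L2 N g \<Longrightarrow> AE z in N. P t (\<lambda>w. a * f w + b * g w) z = a * P t f z + b * P t g z"
    and "L2 N f \<Longrightarrow> AE z in N. P 0 f z = f z"
    and "s \<ge> 0 \<Longrightarrow> L2 N f \<Longrightarrow> AE z in N. P (s + t) f z = P s (P t f) z"
    and "L2 N f \<Longrightarrow> ((\<lambda>t. normsq N (\<lambda>z. P t f z - f z)) \<longlongrightarrow> 0) (at_right 0)"
proof -
  note 1 = assms(1)[unfolded markov_semigroup_def, THEN conjunct1]
    and 2 = assms(1)[unfolded markov_semigroup_def, THEN conjunct2, THEN conjunct1]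
    and 5 = assms(1)[unfolded markov_semigroup_def, THEN conjunct2, THEN conjunct2, THEN conjunct2, THEN conjunct2, THEN conjunct1]
    and 6 = assms(1)[unfolded markov_semigroup_def, THEN conjunct2, THEN conjunct2, THEN conjunct2, THEN conjunct2, THEN conjunct2, THEN conjunct1]
    and 7 = assms(1)[unfolded markov_semigroup_def, THEN conjunct2, THEN conjunct2, THEN conjunct2, THEN conjunct2, THEN conjunct2, THEN conjunct2]
  show "L2 N f \<Longrightarrow> L2 N (P t f)" "L2 N f \<Longrightarrow> normsq N (P t f) \<le> normsq N f"
    using 1 assms(2) by simp_all
  show "L2 N f \<Longrightarrow> L2 N g \<Longrightarrow> AE z in N. P t (\<lambda>w. a * f w + b * g w) z = a * P t f z + b * P t g z"
    using 2 assms(2) by simp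
  show "L2 N f \<Longrightarrow> AE z in N. P 0 f z = f z"
    using 5 by simp
  show "s \<ge> 0 \<Longrightarrow> L2 N f \<Longrightarrow> AE z in N. P (s + t) f z = P s (P t f) z"
    using 6 assms(2) by simp
  show "L2 N f \<Longrightarrow> ((\<lambda>t. normsq N (\<lambda>z. P t f z - f z)) \<longlongrightarrow> 0) (at_right 0)"
    using 7 by simp
qed

text \<open>By the semigroup law, the function on the left is the image of the one on the right under the contraction \<open>P \<tau>\<close>.\<close>

lemma semigroup_difference_quotient:
  assumes P: "markov_semigroup N P" and L: "L2 N f" "L2 N g" and t: "\<tau> \<ge> 0" "h \<ge> 0"
  shows "normsq N (\<lambda>z. (P (\<tau> + h) f z - P \<tau> f z) / h - P \<tau> g z)
       \<le> normsq N (\<lambda>z. (P h f z - f z) / h - g z)"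
    and "L2 N (\<lambda>z. (P h f z - f z) / h - g z)"
proof -
  note m = markov_semigroupD[OF P t(1)] markov_semigroupD[OF P t(2)]
  define q where "q = (\<lambda>w. (1 / h) * P h f w + (- 1 / h) * f w)"
  have Ph: "L2 N (P h f)" "L2 N (P (\<tau> + h) f)" "L2 N (P \<tau> f)" "L2 N (P \<tau> g)"
    using m(7) L t markov_semigroupD(1)[OF P, of "\<tau> + h"] markov_semigroupD(1)[OF P, of \<tau>] by auto
  have Lq: "L2 N q" unfolding q_def by (intro L2_linear Ph L)
  have r: "(\<lambda>w. 1 * q w + (- 1) * g w) = (\<lambda>z. (P h f z - f z) / h - g z)"
    by (auto simp: q_def diff_divide_distrib)
  show Lr: "L2 N (\<lambda>z. (P h f z - f z) / h - g z)"
    using L2_linear[OF Lq L(2), of 1 "-1"] unfolding r .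
  have "AE z in N. (P (\<tau> + h) f z - P \<tau> f z) / h - P \<tau> g z = P \<tau> (\<lambda>z. (P h f z - f z) / h - g z) z"
    using m(3)[OF Lq L(2), of 1 "-1", unfolded r] m(3)[OF Ph(1) L(1), of "1 / h" "- 1 / h", folded q_def]
      markov_semigroupD(5)[OF P t(2,1) L(1)]
    by eventually_elim (simp add: diff_divide_distrib)
  moreover have "L2 N (\<lambda>z. (P (\<tau> + h) f z - P \<tau> f z) / h - P \<tau> g z)"
    using L2_diff[OF L2_scale[OF L2_diff[OF Ph(2,3)], of "1 / h"] Ph(4)] by simp
  ultimately have "normsq N (\<lambda>z. (P (\<tau> + h) f z - P \<tau> f z) / h - P \<tau> g z)
      = normsq N (P \<tau> (\<lambda>z. (P h f z - f z) / h - g z))"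
    using m(1)[OF Lr] by (intro normsq_cong_AE) (auto simp: L2_def)
  then show "normsq N (\<lambda>z. (P (\<tau> + h) f z - P \<tau> f z) / h - P \<tau> g z)
       \<le> normsq N (\<lambda>z. (P h f z - f z) / h - g z)"
    using m(2)[OF Lr] by simp
qed

lemma generator_semigroup:
  assumes P: "markov_semigroup N P" and g: "generator N P f g" and t: "t \<ge> 0"
  shows "generator N P (P t f) (P t g)"
proof -
  have L: "L2 N f" "L2 N g" and lim: "((\<lambda>h. normsq N (\<lambda>z. (P h f z - f z) / h - g z)) \<longlongrightarrow> 0) (at_right 0)"
    using g by (auto simp: generator_def)
  have Lt: "L2 N (P t f)" "L2 N (P t g)" using markov_semigroupD(1)[OF P t] L by auto
  have "((\<lambda>h. normsq N (\<lambda>z. (P h (P t f) z - P t f z) / h - P t g z)) \<longlongrightarrow> 0) (at_right 0)"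
  proof (rule tendsto_sandwich[OF _ _ tendsto_const lim])
    show "\<forall>\<^sub>F h in at_right 0. 0 \<le> normsq N (\<lambda>z. (P h (P t f) z - P t f z) / h - P t g z)"
      by (simp add: normsq_nonneg)
    show "\<forall>\<^sub>F h in at_right 0. normsq N (\<lambda>z. (P h (P t f) z - P t f z) / h - P t g z)
        \<le> normsq N (\<lambda>z. (P h f z - f z) / h - g z)"
      using eventually_at_right_less[of 0]
    proof eventually_elim
      case (elim h)
      have Lh: "L2 N (P h (P t f))" "L2 N (P (t + h) f)"
        using markov_semigroupD(1)[OF P] elim t L Lt by auto
      have "AE z in N. P (t + h) f z = P h (P t f) z"
        using markov_semigroupD(5)[OF P t, of h f] elim L by (simp add: add.commute)
      then have "AE z in N. (P h (P t f) z - P t f z) / h - P t g z = (P (t + h) f z - P t f z) / h - P t g z"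
        by eventually_elim simp
      then have "normsq N (\<lambda>z. (P h (P t f) z - P t f z) / h - P t g z)
          = normsq N (\<lambda>z. (P (t + h) f z - P t f z) / h - P t g z)"
        using Lh Lt by (intro normsq_cong_AE) (auto simp: L2_def)
      then show ?case
        using semigroup_difference_quotient(1)[OF P L t, of h] elim by simp
    qed
  qed
  then show ?thesis using Lt by (simp add: generator_def)
qed

text \<open>The generator only controls right difference quotients at time \<open>0\<close>. For \<open>s < t\<close> the quotient at \<open>t\<close> is rewritten as
  a right quotient at \<open>s\<close>, and strong continuity replaces \<open>P (t - s) g\<close> by \<open>g\<close>.\<close>

lemma semigroup_L2_deriv:
  assumes P: "markov_semigroup N P" and g: "generator N P f g" and t: "t \<ge> 0"
  shows "L2_deriv N (\<lambda>s. P s f) (P t g) t"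
proof -
  let ?r = "\<lambda>h. normsq N (\<lambda>z. (P h f z - f z) / h - g z)"
  let ?e = "\<lambda>h. normsq N (\<lambda>z. P h g z - g z)"
  have L: "L2 N f" "L2 N g" and lim: "(?r \<longlongrightarrow> 0) (at_right 0)"
    using g by (auto simp: generator_def)
  have e: "(?e \<longlongrightarrow> 0) (at_right 0)" by (rule markov_semigroupD(6)[OF P t L(2)])
  have abs: "filterlim (\<lambda>s. \<bar>s - t\<bar>) (at_right 0) (at t within {0..})"
    unfolding filterlim_at
  proof
    show "\<forall>\<^sub>F s in at t within {0..}. \<bar>s - t\<bar> \<in> {0<..} \<and> \<bar>s - t\<bar> \<noteq> 0"
      using eventually_at_within_self[of "{0..}" t] by eventually_elim auto
    have "((\<lambda>s. \<bar>s - t\<bar>) \<longlongrightarrow> \<bar>t - t\<bar>) (at t within {0..})" by (intro tendsto_intros)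
    then show "((\<lambda>s. \<bar>s - t\<bar>) \<longlongrightarrow> 0) (at t within {0..})" by simp
  qed
  have lim': "((\<lambda>s. 2 * ?r \<bar>s - t\<bar> + 2 * ?e \<bar>s - t\<bar>) \<longlongrightarrow> 0) (at t within {0..})"
    using tendsto_add[OF tendsto_mult_left[OF filterlim_compose[OF lim abs], of 2]
        tendsto_mult_left[OF filterlim_compose[OF e abs], of 2]] by simp
  have "((\<lambda>s. normsq N (\<lambda>z. (P s f z - P t f z) / (s - t) - P t g z)) \<longlongrightarrow> 0) (at t within {0..})"
  proof (rule tendsto_sandwich[OF _ _ tendsto_const lim'])
    show "\<forall>\<^sub>F s in at t within {0..}. 0 \<le> normsq N (\<lambda>z. (P s f z - P t f z) / (s - t) - P t g z)"
      by (simp add: normsq_nonneg)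
    show "\<forall>\<^sub>F s in at t within {0..}. normsq N (\<lambda>z. (P s f z - P t f z) / (s - t) - P t g z)
        \<le> 2 * ?r \<bar>s - t\<bar> + 2 * ?e \<bar>s - t\<bar>"
      using eventually_at_within_self[of "{0..}" t]
    proof eventually_elim
      case (elim s)
      define h where "h = \<bar>s - t\<bar>"
      have h: "h > 0" using elim by (auto simp: h_def)
      have nn: "0 \<le> ?r h" "0 \<le> ?e h" by (simp_all add: normsq_nonneg)
      show ?case
      proof (cases "t < s")
        case True
        then have s: "s = t + h" "s - t = h" by (auto simp: h_def)
        then have "normsq N (\<lambda>z. (P s f z - P t f z) / (s - t) - P t g z) \<le> ?r h"
          using semigroup_difference_quotient(1)[OF P L t, of h] h unfolding s(2) s(1)[symmetric] by simp
        then show ?thesis using nn unfolding h_def[symmetric] by linarith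
      next
        case False
        then have s: "t = s + h" "s - t = - h" "s \<ge> 0" using elim by (auto simp: h_def)
        have Lh: "L2 N (P h g)" "L2 N (P h f)" using markov_semigroupD(1)[OF P, of h] h L by auto
        have Ls: "L2 N (P s f)" "L2 N (P s (P h g))" using markov_semigroupD(1)[OF P s(3)] L Lh by auto
        have Lt: "L2 N (P t f)" "L2 N (P t g)" using markov_semigroupD(1)[OF P t] L by auto
        have "AE z in N. P t g z = P s (P h g) z"
          using markov_semigroupD(5)[OF P, of h s g] h s(3) L unfolding s(1)[symmetric] by simp
        then have "AE z in N. (P s f z - P t f z) / (s - t) - P t g z
            = (P (s + h) f z - P s f z) / h - P s (P h g) z"
          unfolding s(2) s(1)[symmetric] by eventually_elim (use h in \<open>simp add: field_simps\<close>)
        then have "normsq N (\<lambda>z. (P s f z - P t f z) / (s - t) - P t g z)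
            = normsq N (\<lambda>z. (P (s + h) f z - P s f z) / h - P s (P h g) z)"
          using Ls Lt unfolding s(1)[symmetric] by (intro normsq_cong_AE) (auto simp: L2_def)
        also have "\<dots> \<le> normsq N (\<lambda>z. (P h f z - f z) / h - P h g z)"
          using h s by (intro semigroup_difference_quotient(1)[OF P L(1) Lh(1)]) auto
        also have "\<dots> = normsq N (\<lambda>z. ((P h f z - f z) / h - g z) + (-1) * (P h g z - g z))"
          by (simp add: algebra_simps)
        also have "\<dots> \<le> 2 * ?r h + 2 * normsq N (\<lambda>z. (-1) * (P h g z - g z))"
          using h by (intro normsq_add_le semigroup_difference_quotient(2)[OF P L(1) L(2)] L2_scale L2_diff Lh L) auto
        also have "normsq N (\<lambda>z. (-1) * (P h g z - g z)) = ?e h"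
          using normsq_scale[of N "-1" "\<lambda>z. P h g z - g z"] by simp
        finally show ?thesis unfolding h_def .
      qed
    qed
  qed
  then show ?thesis by (simp add: L2_deriv_def)
qed

section \<open>The trajectory of the kinetic semigroup\<close>

context kinetic
begin

text \<open>The kinetic measure has a positive density, so that its null sets contain no nonempty open set.\<close>

lemma nonneg_continuous_integral_zero:
  fixes f :: "real \<times> real \<Rightarrow> real"
  assumes c: "continuous_on UNIV f" and nn: "\<And>z. 0 \<le> f z" and i: "integrable \<mu> f" and z: "(\<integral>z. f z \<partial>\<mu>) = 0"
  shows "f w = 0"
proof -
  let ?p = "\<lambda>V x. ennreal (exp (- V x) / (\<integral>s. exp (- V s) \<partial>lborel))"
  have [measurable]: "(\<lambda>x. exp (- U x)) \<in> borel_measurable borel"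
    by (rule gibbs_density_measurable[OF smooth])
  have m [measurable]: "?p U \<in> borel_measurable lborel" "?p (\<lambda>y. y\<^sup>2 / 2) \<in> borel_measurable lborel"
    by measurable
  note pos = gibbs_normaliser_pos[OF smooth integrable_weight]
    gibbs_normaliser_pos[OF smooth1_half_square integrable_half_square]
  have \<mu>d: "\<mu> = density lborel (\<lambda>(x, y). ?p U x * ?p (\<lambda>y. y\<^sup>2 / 2) y)"
    using pair_measure_density[OF m sigma_finite_lborel] Y.sigma_finite_measure_axioms
    unfolding kin_measure_def gibbs_def by (simp add: lborel_prod)
  have "AE z in \<mu>. f z = 0"
    using integral_nonneg_eq_0_iff_AE[OF i] nn z by simp
  moreover have "(\<lambda>(x, y). ?p U x * ?p (\<lambda>y. y\<^sup>2 / 2) y) \<in> borel_measurable (lborel :: (real \<times> real) measure)"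
    unfolding lborel_prod[symmetric] by measurable
  ultimately have "AE z in (lborel :: (real \<times> real) measure). f z = 0"
    unfolding \<mu>d by (subst (asm) AE_density) (auto simp: split_beta' ennreal_zero_less_mult_iff zero_less_divide_iff pos)
  moreover have op: "open {z. f z \<noteq> 0}"
    using open_Collect_neq[OF c continuous_on_const[of UNIV 0]] by simp
  ultimately have "{z. f z \<noteq> 0} \<in> null_sets lborel"
    by (subst AE_iff_null_sets) (auto simp: borel_open)
  then have "negligible {z. f z \<noteq> 0}"
    unfolding negligible_iff_null_sets by (rule null_sets_completionI)
  then have "{z. f z \<noteq> 0} = {}" using open_not_negligible[OF op] by blast
  then show ?thesis by blast
qed

lemma dx_tested:
  assumes "smooth2 u" and \<phi>: "partials \<phi>" "compact_supp \<phi>" "continuous_on UNIV \<phi>" "continuous_on UNIV (dx \<phi>)"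
  shows "l2_inner \<mu> (dx u) \<phi> = l2_inner \<mu> u (\<lambda>z. deriv U (fst z) * \<phi> z - dx \<phi> z)"
    and "L2 \<mu> (\<lambda>z. deriv U (fst z) * \<phi> z - dx \<phi> z)"
proof -
  note u = smooth2_partials[OF assms(1)] smooth2_continuous[OF assms(1)] smooth2_continuous[OF smooth2_dx[OF assms(1)]]
  have d: "dx (\<lambda>z. u z * \<phi> z) = (\<lambda>z. dx u z * \<phi> z + u z * dx \<phi> z)"
    by (rule partials_mult(2)[OF u(1) \<phi>(1)])
  have cs: "compact_supp (dx \<phi>)" by (rule compact_supp_derivative[OF \<phi>(2,1)])
  have "continuous_on UNIV (dx (\<lambda>z. u z * \<phi> z))" unfolding d by (intro continuous_intros u \<phi>)
  then have 0: "(\<integral>z. (dx (\<lambda>z. u z * \<phi> z) z - deriv U (fst z) * (u z * \<phi> z)) \<partial>\<mu>) = 0"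
    by (intro integration_by_parts_x partials_mult u \<phi> compact_supp_mult continuous_intros)
  have cs': "compact_supp (\<lambda>z. deriv U (fst z) * \<phi> z + (-1) * dx \<phi> z)" by (intro compact_supp_add compact_supp_mult \<phi> cs)
  have cc: "continuous_on UNIV (\<lambda>z. deriv U (fst z) * \<phi> z + (-1) * dx \<phi> z)"
    by (intro continuous_intros continuous_drift \<phi>)
  have i1: "integrable \<mu> (\<lambda>z. dx u z * \<phi> z)"
    by (intro compact_supp_integrable compact_supp_mult continuous_intros u \<phi>)
  have i2: "integrable \<mu> (\<lambda>z. u z * (deriv U (fst z) * \<phi> z + (-1) * dx \<phi> z))"
    by (intro compact_supp_integrable compact_supp_mult(2)[OF cs'] continuous_on_mult[OF u(2) cc])
  have "(\<integral>z. dx u z * \<phi> z - u z * (deriv U (fst z) * \<phi> z + (-1) * dx \<phi> z) \<partial>\<mu>) = 0"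
    using 0 unfolding d by (simp add: algebra_simps)
  then show "l2_inner \<mu> (dx u) \<phi> = l2_inner \<mu> u (\<lambda>z. deriv U (fst z) * \<phi> z - dx \<phi> z)"
    using i1 i2 by (simp add: l2_inner_def)
  show "L2 \<mu> (\<lambda>z. deriv U (fst z) * \<phi> z - dx \<phi> z)"
    using compact_supp_integrable(2)[OF cs' cc] by simp
qed

end

text \<open>The last assumption is pointwise, not just almost everywhere: it transfers the smoothness of the trajectory at
  time \<open>0\<close> to the elements of \<open>D\<close> themselves.\<close>

locale kinetic_semigroup = kinetic +
  fixes P :: "real \<Rightarrow> (real \<times> real \<Rightarrow> real) \<Rightarrow> real \<times> real \<Rightarrow> real"
    and D :: "(real \<times> real \<Rightarrow> real) set"
  assumes markov: "markov_semigroup \<mu> P"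
    and invariant: "invariant_measure \<mu> P"
    and core: "core \<mu> P (kfp U) D"
    and stable: "\<And>f. f \<in> D \<Longrightarrow> kfp U f \<in> D"
    and regular: "\<And>f. f \<in> D \<Longrightarrow> regular_trajectory \<mu> (centered \<mu> P f)"
    and initial: "\<And>f. f \<in> borel_measurable \<mu> \<Longrightarrow> P 0 f = f"
begin

abbreviation traj :: "(real \<times> real \<Rightarrow> real) \<Rightarrow> real \<Rightarrow> real \<times> real \<Rightarrow> real" where
  "traj \<equiv> centered \<mu> P"

lemma D_generator: "f \<in> D \<Longrightarrow> generator \<mu> P f (kfp U f)"
  using core by (auto simp: core_def)

lemma D_L2: "f \<in> D \<Longrightarrow> L2 \<mu> f"
  using D_generator by (auto simp: generator_def)

lemma traj_smooth: "f \<in> D \<Longrightarrow> t \<ge> 0 \<Longrightarrow> smooth2 (traj f t)"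
  using regular by (auto simp: regular_trajectory_def)

lemma P_eq_traj: "P t f = (\<lambda>z. traj f t z + (\<integral>w. f w \<partial>\<mu>))"
  by (simp add: centered_def)

lemma P_smooth: "f \<in> D \<Longrightarrow> t \<ge> 0 \<Longrightarrow> smooth2 (P t f)"
  by (subst P_eq_traj) (rule smooth2_add[OF traj_smooth smooth2_const])

lemma D_smooth: "f \<in> D \<Longrightarrow> smooth2 f"
  using P_smooth[of f 0] initial[OF L2_measurable[OF D_L2]] by simp

lemma L2_const: "L2 \<mu> (\<lambda>z. c)"
  by (simp add: L2_def)

lemma traj_L2:
  assumes "f \<in> D" "t \<ge> 0" shows "L2 \<mu> (traj f t)"
  unfolding centered_def by (intro L2_diff L2_const markov_semigroupD(1)[OF markov] assms D_L2)

lemma traj_mean: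
  assumes "f \<in> D" "t \<ge> 0" shows "(\<integral>z. traj f t z \<partial>\<mu>) = 0"
proof -
  have "integrable \<mu> (P t f)"
    using L2_mult_integrable[OF markov_semigroupD(1)[OF markov assms(2) D_L2[OF assms(1)]] L2_const[of 1]] by simp
  then show ?thesis
    using invariant assms D_L2 kin.prob_space by (simp add: centered_def invariant_measure_def)
qed

text \<open>By invariance, the mean of the difference quotients of \<open>P\<^sub>t f\<close> at time \<open>0\<close> vanishes.\<close>

lemma mean_kfp:
  assumes "f \<in> D" shows "(\<integral>z. kfp U f z \<partial>\<mu>) = 0"
proof -
  let ?g = "kfp U f"
  have L: "L2 \<mu> f" "L2 \<mu> ?g" and lim: "((\<lambda>h. normsq \<mu> (\<lambda>z. (P h f z - f z) / h - ?g z)) \<longlongrightarrow> 0) (at_right 0)"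
    using D_generator[OF assms] by (auto simp: generator_def)
  have "\<forall>\<^sub>F h in at_right 0. (\<integral>z. ?g z \<partial>\<mu>)\<^sup>2 \<le> normsq \<mu> (\<lambda>z. (P h f z - f z) / h - ?g z)"
    using eventually_at_right_less[of 0]
  proof eventually_elim
    case (elim h)
    have Lh: "L2 \<mu> (P h f)" using markov_semigroupD(1)[OF markov, of h] elim L by auto
    have i: "integrable \<mu> (P h f)" "integrable \<mu> f" "integrable \<mu> ?g"
      using L2_mult_integrable[OF Lh L2_const[of 1]] L2_mult_integrable[OF L(1) L2_const[of 1]]
        L2_mult_integrable[OF L(2) L2_const[of 1]] by simp_all
    have "(\<integral>z. (P h f z - f z) / h - ?g z \<partial>\<mu>) = - (\<integral>z. ?g z \<partial>\<mu>)"
      using i invariant elim L by (simp add: invariant_measure_def)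
    then show ?case
      using kin.integral_square_le(2)[of "\<lambda>z. (P h f z - f z) / h - ?g z"]
        semigroup_difference_quotient(2)[OF markov L order_refl, of h] elim
      by (simp add: L2_def normsq_def)
  qed
  then have "(\<integral>z. ?g z \<partial>\<mu>)\<^sup>2 \<le> 0"
    by (intro tendsto_le[OF _ lim tendsto_const]) auto
  then show ?thesis by simp
qed

lemma traj_kfp: "f \<in> D \<Longrightarrow> traj (kfp U f) t = P t (kfp U f)"
  by (simp add: centered_def mean_kfp)

lemma traj_L2_deriv:
  assumes "f \<in> D" "t \<ge> 0"
  shows "L2_deriv \<mu> (traj f) (traj (kfp U f) t) t"
  using semigroup_L2_deriv[OF markov D_generator[OF assms(1)] assms(2)]
  by (simp add: L2_deriv_def traj_kfp[OF assms(1)]) (simp add: centered_def)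

text \<open>The pair of \<open>P\<^sub>t f\<close> and \<open>P\<^sub>t (L f)\<close> belongs to the graph of the generator, hence is a limit of pairs
  \<open>(u\<^sub>n, L u\<^sub>n)\<close> with \<open>u\<^sub>n\<close> in \<open>D\<close>. Passing to the limit in \<open>\<langle>\<phi>, L u\<^sub>n\<rangle> = \<langle>u\<^sub>n, L\<^sup>* \<phi>\<rangle>\<close> identifies \<open>P\<^sub>t (L f)\<close> with the
  differential operator applied to \<open>P\<^sub>t f\<close> against every test function. Both are continuous; taking as \<open>\<phi>\<close> a cutoff
  of their difference gives equality at every point.\<close>

lemma kfp_traj:
  assumes f: "f \<in> D" and t: "t \<ge> 0"
  shows "kfp U (traj f t) = traj (kfp U f) t"
proof -
  let ?p = "P t f" and ?g = "P t (kfp U f)"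
  have gen: "generator \<mu> P ?p ?g"
    by (rule generator_semigroup[OF markov D_generator[OF f] t])
  then have L: "L2 \<mu> ?p" "L2 \<mu> ?g" by (auto simp: generator_def)
  obtain un where un: "\<And>n. un n \<in> D" "(\<lambda>n. normsq \<mu> (\<lambda>z. un n z - ?p z)) \<longlonglongrightarrow> 0"
      "(\<lambda>n. normsq \<mu> (\<lambda>z. kfp U (un n) z - ?g z)) \<longlonglongrightarrow> 0"
    using core gen unfolding core_def by blast
  have sp: "smooth2 ?p" "smooth2 ?g"
    using P_smooth f t stable by auto
  have Lun: "L2 \<mu> (un n)" "L2 \<mu> (kfp U (un n))" for n
    using D_L2 un(1) stable by auto
  have weak: "l2_inner \<mu> \<phi> ?g = l2_inner \<mu> \<phi> (kfp U ?p)" if \<phi>: "C12 \<phi>" "compact_supp \<phi>" for \<phi>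
  proof -
    have L\<phi>: "L2 \<mu> \<phi>" "L2 \<mu> (kfp_adj U \<phi>)"
      using \<phi> by (auto intro!: compact_supp_integrable(2) compact_supp_kfp_adj continuous_kfp_adj simp: C12_def)
    have c: "((\<lambda>s. normsq \<mu> (\<lambda>z. h z - h z)) \<longlongrightarrow> 0) sequentially" for h by (simp add: normsq_def)
    have "(\<lambda>n. l2_inner \<mu> \<phi> (kfp U (un n))) \<longlonglongrightarrow> l2_inner \<mu> \<phi> ?g"
      by (rule l2_inner_tendsto[OF c un(3)]) (use L\<phi> Lun L in auto)
    moreover have "(\<lambda>n. l2_inner \<mu> (un n) (kfp_adj U \<phi>)) \<longlonglongrightarrow> l2_inner \<mu> ?p (kfp_adj U \<phi>)"
      by (rule l2_inner_tendsto[OF un(2) c]) (use L\<phi> Lun L in auto)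
    moreover have "l2_inner \<mu> \<phi> (kfp U v) = l2_inner \<mu> v (kfp_adj U \<phi>)" if "smooth2 v" for v
      unfolding l2_inner_def by (rule kfp_adjoint(1)[OF smooth2_C12[OF that] \<phi>])
    ultimately show ?thesis using LIMSEQ_unique D_smooth[OF un(1)] sp(1) by simp
  qed
  let ?q = "\<lambda>z. ?g z - kfp U ?p z"
  have sq: "smooth2 ?q" by (intro smooth2_diff sp smooth2_kfp smooth)
  have "?q w = 0" for w
  proof -
    obtain n where n: "cut n w > 0"
    proof -
      have "eventually (\<lambda>n. cut n w > 0) sequentially"
        using order_tendstoD(1)[OF cut_tendsto, of 0 w] by simp
      then show thesis using that eventually_sequentially by auto
    qed
    let ?\<phi> = "\<lambda>z. cut n z * ?q z"
    have C: "C12 ?\<phi>" and cs: "compact_supp ?\<phi>"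
      by (intro C12_mult cut_C12 smooth2_C12 sq) (intro compact_supp_mult cut_compact_supp)
    have cont: "continuous_on UNIV ?\<phi>" using C by (simp add: C12_def)
    have i: "integrable \<mu> (\<lambda>z. ?\<phi> z * h z)" if "smooth2 h" for h
      by (intro compact_supp_integrable compact_supp_mult(1)[OF cs] continuous_on_mult[OF cont] smooth2_continuous that)
    have 0: "(\<integral>z. ?\<phi> z * ?q z \<partial>\<mu>) = 0"
      using weak[OF C cs] i[OF sp(2)] i[OF smooth2_kfp[OF smooth sp(1)]]
      by (simp add: l2_inner_def right_diff_distrib)
    have "?\<phi> w * ?q w = 0"
    proof (rule nonneg_continuous_integral_zero[OF _ _ i[OF sq] 0])
      show "continuous_on UNIV (\<lambda>z. ?\<phi> z * ?q z)"
        by (intro continuous_on_mult[OF cont] smooth2_continuous sq)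
      show "0 \<le> ?\<phi> z * ?q z" for z
        using cut_bounds(1)[of n z] by (simp add: mult.assoc)
    qed
    then show ?thesis using n by simp
  qed
  then have 1: "?g = kfp U ?p" by auto
  have pt: "partials (traj f t)" "partials (dy (traj f t))"
    using traj_smooth[OF f t] by (auto intro: smooth2_partials smooth2_dy)
  have e: "P t f = (\<lambda>z. 1 * traj f t z + (\<integral>w. f w \<partial>\<mu>) * 1)" by (simp add: centered_def)
  have "kfp U ?p = kfp U (traj f t)"
    unfolding kfp_fun_eq e partials_linear(2,3)[OF pt(1) partials_const(1)] partials_const by simp
  then show ?thesis using 1 traj_kfp[OF f] by simp
qed

lemma traj_regular:
  assumes "f \<in> D" "t \<ge> 0" shows "regular_fun (traj f t)"
  using regular[OF assms(1)] assms traj_L2[OF assms] by (simp add: regular_fun_def regular_trajectory_def)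

end

section \<open>Differentiability of the position derivative\<close>

lemma dt_eqI:
  assumes "(F has_real_derivative d) (at t within {0..})" "t \<ge> 0"
  shows "dt F t = d" "dt_exists F t"
proof -
  have vd: "(F has_vector_derivative d) (at t within {0..})"
    using assms(1) by (simp add: has_real_derivative_iff_has_vector_derivative)
  have "\<nexists>a. {0::real..} = {a}" using infinite_Ici[of "0::real"] by (metis finite.emptyI finite_insert)
  then have "t islimpt {0..}" using assms(2) by (intro connected_imp_perfect) auto
  then have nb: "at t within {0..} \<noteq> bot" by (simp add: trivial_limit_within)
  show "dt F t = d" unfolding dt_def by (rule vector_derivative_within[OF nb vd])
  show "dt_exists F t"
    using vd unfolding dt_exists_def by (auto simp: has_vector_derivative_def intro: differentiableI)
qed

lemma deriv_on_half_line_cong: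
  fixes F :: "real \<Rightarrow> real"
  assumes "(F has_real_derivative d) (at t within {0..})" "t \<ge> 0" "\<And>s. s \<ge> 0 \<Longrightarrow> F s = G s"
  shows "(G has_real_derivative d) (at t within {0..})"
  by (rule has_field_derivative_transform_within[OF assms(1), of 1]) (use assms in auto)

text \<open>Two applications of the mean value inequality: to \<open>q1\<close>, and to the remainder as a function of the end point.\<close>

lemma second_order_taylor_bound:
  fixes q q1 q2 :: "real \<Rightarrow> real"
  assumes q: "\<And>r. r \<in> closed_segment t s \<Longrightarrow> (q has_real_derivative q1 r) (at r within {0..})"
    and q1: "\<And>r. r \<in> closed_segment t s \<Longrightarrow> (q1 has_real_derivative q2 r) (at r within {0..})"
    and q2: "\<And>r. r \<in> closed_segment t s \<Longrightarrow> \<bar>q2 r\<bar> \<le> K"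
    and st: "0 \<le> t" "0 \<le> s"
  shows "\<bar>q s - q t - (s - t) * q1 t\<bar> \<le> K * (s - t)\<^sup>2"
proof -
  let ?S = "closed_segment t s"
  have S: "?S \<subseteq> {0..}" using st by (auto simp: closed_segment_eq_real_ivl split: if_splits)
  have b1: "\<bar>q1 r - q1 t\<bar> \<le> K * \<bar>s - t\<bar>" if r: "r \<in> ?S" for r
  proof -
    have "norm (q1 r - q1 t) \<le> K * norm (r - t)"
      by (rule field_differentiable_bound[of ?S q1 q2])
         (use r q1 q2 S in \<open>auto intro: DERIV_subset\<close>)
    also have "\<dots> \<le> K * \<bar>s - t\<bar>"
    proof (rule mult_left_mono)
      show "norm (r - t) \<le> \<bar>s - t\<bar>"
        using r by (auto simp: closed_segment_eq_real_ivl split: if_splits)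
      show "0 \<le> K" using q2[OF r] by linarith
    qed
    finally show ?thesis by simp
  qed
  have e: "((\<lambda>r. q r - r * q1 t) has_real_derivative q1 r - q1 t) (at r within ?S)" if "r \<in> ?S" for r
    by (auto intro!: derivative_eq_intros DERIV_subset[OF q[OF that] S])
  have "norm ((q s - s * q1 t) - (q t - t * q1 t)) \<le> (K * \<bar>s - t\<bar>) * norm (s - t)"
    by (rule field_differentiable_bound[of ?S "\<lambda>r. q r - r * q1 t" "\<lambda>r. q1 r - q1 t"])
       (use e b1 in auto)
  then show ?thesis by (simp add: algebra_simps power2_eq_square abs_mult_self_eq)
qed

context kinetic_semigroup
begin

lemma traj_inner_deriv:
  assumes f: "f \<in> D" and g: "g \<in> D" and t: "t \<ge> 0"
  shows "((\<lambda>s. l2_inner \<mu> (traj f s) (traj g s)) has_real_derivative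
     l2_inner \<mu> (traj (kfp U f) t) (traj g t) + l2_inner \<mu> (traj f t) (traj (kfp U g) t)) (at t within {0..})"
  by (rule L2_deriv_inner[OF traj_L2_deriv[OF f t] traj_L2_deriv[OF g t]])
     (use f g t stable traj_L2 in auto)

text \<open>Against a test function the position derivative moves to the test function, and the trajectory itself is
  differentiable in \<open>L\<^sup>2\<close>.\<close>

lemma weak_dx_deriv:
  assumes f: "f \<in> D" and t: "t \<ge> 0"
    and \<phi>: "partials \<phi>" "compact_supp \<phi>" "continuous_on UNIV \<phi>" "continuous_on UNIV (dx \<phi>)"
  shows "((\<lambda>s. l2_inner \<mu> (dx (traj f s)) \<phi>) has_real_derivative l2_inner \<mu> (dx (traj (kfp U f) t)) \<phi>) (at t within {0..})"
proof -
  let ?\<phi> = "\<lambda>z. deriv U (fst z) * \<phi> z - dx \<phi> z"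
  have test: "l2_inner \<mu> (dx (traj g s)) \<phi> = l2_inner \<mu> (traj g s) ?\<phi>" if "g \<in> D" "s \<ge> 0" for g s
    by (rule dx_tested(1)[OF traj_smooth[OF that] \<phi>])
  have L: "L2 \<mu> ?\<phi>" by (rule dx_tested(2)[OF traj_smooth[OF f t] \<phi>])
  have "((\<lambda>s. l2_inner \<mu> (traj f s) ?\<phi>) has_real_derivative
      l2_inner \<mu> (traj (kfp U f) t) ?\<phi> + l2_inner \<mu> (traj f t) (\<lambda>z. 0)) (at t within {0..})"
    by (rule L2_deriv_inner[OF traj_L2_deriv[OF f t] L2_deriv_const])
       (use f t stable traj_L2 L in \<open>auto simp: L2_const\<close>)
  then have "((\<lambda>s. l2_inner \<mu> (traj f s) ?\<phi>) has_real_derivative l2_inner \<mu> (dx (traj (kfp U f) t)) \<phi>) (at t within {0..})"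
    using test[OF stable[OF f] t] by (simp add: l2_inner_def)
  then show ?thesis
    by (rule deriv_on_half_line_cong[OF _ t]) (use test[OF f] in simp)
qed

text \<open>This is where the differentiability in time of \<open>|\<partial>\<^sub>x u|\<^sup>2\<close> along the regular trajectories is used.\<close>

lemma dx_normsq_locally_bounded:
  assumes f: "f \<in> D"
  obtains C where "\<And>r. 0 \<le> r \<Longrightarrow> r \<le> T \<Longrightarrow> normsq \<mu> (dx (traj f r)) \<le> C"
proof -
  let ?N = "\<lambda>r. normsq \<mu> (dx (traj f r))"
  have "continuous_on {0..} ?N"
    using regular[OF f] unfolding regular_trajectory_def dt_exists_def
    by (auto simp: continuous_on_eq_continuous_within intro!: differentiable_imp_continuous_within)
  then have "compact (?N ` {0..T})"
    by (intro compact_continuous_image) (auto intro: continuous_on_subset)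
  then obtain C where "\<forall>x \<in> ?N ` {0..T}. norm x \<le> C"
    by (meson bounded_iff compact_imp_bounded)
  then have "normsq \<mu> (dx (traj f r)) \<le> C" if "0 \<le> r" "r \<le> T" for r
    using that by force
  then show thesis by (rule that)
qed

text \<open>Let \<open>\<psi>\<close> be the Taylor remainder. Tested with \<open>\<phi> = cut n \<psi>\<close>, a fixed function of the space variables, it is
  the remainder of a scalar function whose second derivative is at most \<open>sqrt C |\<phi>|\<close>. Since \<open>0 \<le> cut n \<le> 1\<close>, the
  integral \<open>I\<close> of \<open>cut n \<psi>\<^sup>2\<close> dominates \<open>|\<phi>|\<^sup>2\<close>. Hence \<open>I \<le> sqrt C (s - t)\<^sup>2 sqrt I\<close>, a bound that does not depend
  on \<open>n\<close>.\<close>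

lemma traj_dx_taylor:
  assumes f: "f \<in> D" and st: "0 \<le> t" "0 \<le> s"
    and C: "\<And>r. r \<in> closed_segment t s \<Longrightarrow> normsq \<mu> (dx (traj (kfp U (kfp U f)) r)) \<le> C"
  shows "normsq \<mu> (\<lambda>z. dx (traj f s) z - dx (traj f t) z - (s - t) * dx (traj (kfp U f) t) z) \<le> C * (s - t) ^ 4"
    and "L2 \<mu> (\<lambda>z. dx (traj f s) z - dx (traj f t) z - (s - t) * dx (traj (kfp U f) t) z)"
proof -
  let ?u = "traj f" and ?v = "traj (kfp U f)" and ?a = "traj (kfp U (kfp U f))"
  let ?\<psi> = "\<lambda>z. dx (?u s) z - dx (?u t) z - (s - t) * dx (?v t) z"
  have D: "kfp U f \<in> D" "kfp U (kfp U f) \<in> D" using stable f by auto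
  have L: "L2 \<mu> (dx (?u r))" "L2 \<mu> (dx (?v r))" "L2 \<mu> (dx (?a r))" if "r \<ge> 0" for r
    using traj_regular that f D by (auto simp: regular_fun_def)
  have seg: "closed_segment t s \<subseteq> {0..}"
    using st by (auto simp: closed_segment_eq_real_ivl split: if_splits)
  have C0: "C \<ge> 0" using C[of t] normsq_nonneg[of \<mu> "dx (?a t)"] by simp
  have s\<psi>: "smooth2 ?\<psi>"
    by (intro smooth2_diff smooth2_mult smooth2_const smooth2_dx traj_smooth f D st)
  show L\<psi>: "L2 \<mu> ?\<psi>" by (intro L2_diff L2_scale L st)
  have bound: "(\<integral>z. cut n z * (?\<psi> z)\<^sup>2 \<partial>\<mu>) \<le> C * (s - t) ^ 4" for n
  proof -
    let ?\<phi> = "\<lambda>z. cut n z * ?\<psi> z"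
    have C12: "C12 ?\<phi>" by (intro C12_mult cut_C12 smooth2_C12 s\<psi>)
    have cs: "compact_supp ?\<phi>" by (intro compact_supp_mult cut_compact_supp)
    have \<phi>: "partials ?\<phi>" "compact_supp ?\<phi>" "continuous_on UNIV ?\<phi>" "continuous_on UNIV (dx ?\<phi>)"
      using C12 cs by (auto simp: C12_def)
    have L\<phi>: "L2 \<mu> ?\<phi>" by (rule compact_supp_integrable(2)[OF cs \<phi>(3)])
    define I where "I = (\<integral>z. cut n z * (?\<psi> z)\<^sup>2 \<partial>\<mu>)"
    have I: "I = l2_inner \<mu> ?\<psi> ?\<phi>" unfolding I_def l2_inner_def
      by (intro Bochner_Integration.integral_cong) (auto simp: power2_eq_square algebra_simps)
    have I0: "I \<ge> 0" unfolding I_def by (intro integral_nonneg_AE AE_I2) (simp add: cut_bounds)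
    have nI: "normsq \<mu> ?\<phi> \<le> I"
      unfolding I_def normsq_def
    proof (rule integral_mono)
      show "integrable \<mu> (\<lambda>z. (?\<phi> z)\<^sup>2)" using L\<phi> by (simp add: L2_def)
      show "integrable \<mu> (\<lambda>z. cut n z * (?\<psi> z)\<^sup>2)"
        using L2_mult_integrable[OF L\<phi> L\<psi>] by (simp add: power2_eq_square mult.assoc)
      show "(?\<phi> z)\<^sup>2 \<le> cut n z * (?\<psi> z)\<^sup>2" for z
        using cut_bounds[of n z] unfolding power_mult_distrib
        by (intro mult_right_mono) (simp_all add: power2_eq_square mult_left_le)
    qed
    have K: "\<bar>l2_inner \<mu> (dx (?a r)) ?\<phi>\<bar> \<le> sqrt C * sqrt I" if "r \<in> closed_segment t s" for r
    proof -
      have "\<bar>l2_inner \<mu> (dx (?a r)) ?\<phi>\<bar> \<le> sqrt (normsq \<mu> (dx (?a r))) * sqrt (normsq \<mu> ?\<phi>)"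
        using seg that by (intro l2_inner_abs_le L L\<phi>) auto
      also have "\<dots> \<le> sqrt C * sqrt I"
        by (intro mult_mono real_sqrt_le_mono C that nI) (simp_all add: C0 normsq_nonneg)
      finally show ?thesis .
    qed
    have "\<bar>l2_inner \<mu> (dx (?u s)) ?\<phi> - l2_inner \<mu> (dx (?u t)) ?\<phi> - (s - t) * l2_inner \<mu> (dx (?v t)) ?\<phi>\<bar>
        \<le> (sqrt C * sqrt I) * (s - t)\<^sup>2"
      by (rule second_order_taylor_bound[OF weak_dx_deriv[OF f _ \<phi>] weak_dx_deriv[OF D(1) _ \<phi>] K st])
         (use seg in auto)
    moreover have "I = l2_inner \<mu> (dx (?u s)) ?\<phi> - l2_inner \<mu> (dx (?u t)) ?\<phi> - (s - t) * l2_inner \<mu> (dx (?v t)) ?\<phi>"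
      unfolding I l2_inner_commute[of \<mu> _ ?\<phi>]
      using l2_inner_linear(2)[OF L2_diff[OF L(1)[OF st(2)] L(1)[OF st(1)]] L2_scale[OF L(2)[OF st(1)]] L\<phi>, of "s - t"]
        l2_inner_linear(2)[OF L(1)[OF st(2)] L(1)[OF st(1)] L\<phi>]
        l2_inner_linear(3)[OF L(2)[OF st(1)] L(2)[OF st(1)] L\<phi>, of "s - t"] by simp
    ultimately have "I \<le> (sqrt C * (s - t)\<^sup>2) * sqrt I"
      using I0 by (simp add: mult_ac)
    then have le: "sqrt I * sqrt I \<le> (sqrt C * (s - t)\<^sup>2) * sqrt I"
      using I0 by (simp only: real_sqrt_mult_self abs_of_nonneg)
    have "sqrt I \<le> sqrt C * (s - t)\<^sup>2"
    proof (cases "I = 0")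
      case False
      then show ?thesis using I0 by (intro mult_right_le_imp_le[OF le]) simp
    qed (simp add: C0)
    then have "(sqrt I)\<^sup>2 \<le> (sqrt C * (s - t)\<^sup>2)\<^sup>2" using I0 by (intro power_mono) auto
    then show ?thesis using I0 C0 by (simp add: power_mult_distrib I_def)
  qed
  have i: "integrable \<mu> (\<lambda>z. (?\<psi> z)\<^sup>2)" using L\<psi> by (simp add: L2_def)
  show "normsq \<mu> ?\<psi> \<le> C * (s - t) ^ 4"
    unfolding normsq_def by (rule LIMSEQ_le_const2[OF cut_integral_tendsto[OF i]]) (use bound in blast)
qed

lemma traj_dx_L2_deriv:
  assumes f: "f \<in> D" and t: "t \<ge> 0"
  shows "L2_deriv \<mu> (\<lambda>s. dx (traj f s)) (dx (traj (kfp U f) t)) t"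
proof -
  obtain C where C: "\<And>r. 0 \<le> r \<Longrightarrow> r \<le> t + 1 \<Longrightarrow> normsq \<mu> (dx (traj (kfp U (kfp U f)) r)) \<le> C"
    using dx_normsq_locally_bounded[of "kfp U (kfp U f)" "t + 1"] stable f by blast
  have lim: "((\<lambda>s. C * (s - t)\<^sup>2) \<longlongrightarrow> 0) (at t within {0..})"
  proof -
    have "((\<lambda>s. C * (s - t)\<^sup>2) \<longlongrightarrow> C * (t - t)\<^sup>2) (at t within {0..})" by (intro tendsto_intros)
    then show ?thesis by simp
  qed
  have "((\<lambda>s. normsq \<mu> (\<lambda>z. (dx (traj f s) z - dx (traj f t) z) / (s - t) - dx (traj (kfp U f) t) z)) \<longlongrightarrow> 0)
     (at t within {0..})"
  proof (rule tendsto_sandwich[OF _ _ tendsto_const lim])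
    show "\<forall>\<^sub>F s in at t within {0..}.
        0 \<le> normsq \<mu> (\<lambda>z. (dx (traj f s) z - dx (traj f t) z) / (s - t) - dx (traj (kfp U f) t) z)"
      by (simp add: normsq_nonneg)
    have near: "\<forall>\<^sub>F s in at t within {0..}. s < t + 1"
      by (intro order_tendstoD(2)[OF tendsto_ident_at]) simp
    show "\<forall>\<^sub>F s in at t within {0..}.
        normsq \<mu> (\<lambda>z. (dx (traj f s) z - dx (traj f t) z) / (s - t) - dx (traj (kfp U f) t) z) \<le> C * (s - t)\<^sup>2"
      using near eventually_at_within_self[of "{0..}" t]
    proof eventually_elim
      case (elim s)
      then have s: "0 \<le> s" "s \<noteq> t" "s \<le> t + 1" by auto
      let ?\<psi> = "\<lambda>z. dx (traj f s) z - dx (traj f t) z - (s - t) * dx (traj (kfp U f) t) z"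
      have "normsq \<mu> ?\<psi> \<le> C * (s - t) ^ 4"
      proof (rule traj_dx_taylor(1)[OF f t s(1)])
        fix r assume "r \<in> closed_segment t s"
        then show "normsq \<mu> (dx (traj (kfp U (kfp U f)) r)) \<le> C"
          using s t by (intro C) (auto simp: closed_segment_eq_real_ivl split: if_splits)
      qed
      moreover have "(\<lambda>z. (dx (traj f s) z - dx (traj f t) z) / (s - t) - dx (traj (kfp U f) t) z)
          = (\<lambda>z. (1 / (s - t)) * ?\<psi> z)"
        using s by (auto simp: field_simps)
      ultimately show ?case
        using s by (simp only: normsq_scale) (simp add: power_divide divide_le_eq power2_eq_square power4_eq_xxxx mult.assoc)
    qed
  qed
  then show ?thesis by (simp add: L2_deriv_def)
qed

end

section \<open>The third order differential inequality\<close>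

text \<open>The scalar part of the argument, with \<open>A = |w|\<^sup>2\<close>, \<open>H = |h|\<^sup>2\<close>, \<open>K = |k|\<^sup>2\<close>, \<open>Z = |\<partial>\<^sub>y w|\<^sup>2\<close>, \<open>J = |\<partial>\<^sub>y k|\<^sup>2\<close>,
  \<open>S = \<langle>h, w\<rangle>\<close>, \<open>T = \<langle>k, \<partial>\<^sub>y w\<rangle>\<close>, \<open>Q = \<langle>h, U'' h\<rangle>\<close> and \<open>Q' = \<langle>w, U'' h\<rangle>\<close>. The left-hand side is
  \<open>F''' + 2 F'' + (1 + b) F' + 6 A' + \<lambda> (F'' + 2 F' + (1 + b) F + 6 A)\<close>.

  The term \<open>24 T\<close> costs \<open>12 K + 12 Z\<close>; the derivative of \<open>6 A\<close> pays for \<open>12 Z\<close>. The coefficient of \<open>K\<close>, which is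
  \<open>- 24 + 8 \<eta> = - 16\<close> before this expense, stays negative because \<open>\<eta> = 1\<close> is small. The terms \<open>S\<close> and \<open>Q'\<close> cost one
  of the four units of \<open>A\<close>, the terms with \<open>\<lambda>\<close> less than two more, and their share of \<open>H\<close> determines \<open>b\<close>.\<close>

lemma hypocoercive_inequality:
  fixes A H K Z J S T Q Q' F M \<kappa> lam b :: real
  assumes pos: "A \<ge> 0" "H \<ge> 0" "K \<ge> 0" "Z \<ge> 0" "J \<ge> 0" "M \<ge> 0"
    and S: "S\<^sup>2 \<le> H * A" and T: "T\<^sup>2 \<le> K * Z" and Q: "Q \<le> M * H" and Q': "Q'\<^sup>2 \<le> A * (M\<^sup>2 * H)"
    and k: "0 < \<kappa>" "\<kappa> \<le> 1" "\<kappa> * F \<le> A + H"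
    and b: "b = 36 * M\<^sup>2 + 2 * M + 4" and lam: "lam = \<kappa> / (6 * (1 + b))"
  shows "(- 4 * A + 12 * S + 4 * Q + 24 * T - 8 * J - 24 * K - 8 * H)
     + 2 * (- 4 * S + 4 * K + 4 * H) + (1 + b) * (- 2 * H) + 6 * (- 2 * Z - 2 * Q')
     + lam * ((- 4 * S + 4 * K + 4 * H) + 2 * (- 2 * H) + (1 + b) * F + 6 * A) \<le> 0"
proof -
  have b4: "b \<ge> 4" using pos(6) b by simp
  have lam0: "0 < lam" using k(1) b4 by (simp add: lam)
  have lam1: "lam \<le> 1 / 6"
  proof -
    have "\<kappa> / (6 * (1 + b)) \<le> 1 / 6" using k b4 by (intro frac_le) auto
    then show ?thesis by (simp add: lam)
  qed
  have amgm: "2 * \<bar>x\<bar> \<le> p + q" if "x\<^sup>2 \<le> p * q" "0 \<le> p" "0 \<le> q" for x p q :: real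
  proof (rule power2_le_imp_le)
    have "0 \<le> (p - q)\<^sup>2" by simp
    then show "(2 * \<bar>x\<bar>)\<^sup>2 \<le> (p + q)\<^sup>2"
      using that(1) by (simp add: power2_sum power2_diff power_mult_distrib)
  qed (use that in simp)
  have T': "2 * \<bar>T\<bar> \<le> K + Z" by (rule amgm[OF T pos(3,4)])
  have S': "2 * \<bar>2 * S\<bar> \<le> A / 2 + 8 * H"
    by (rule amgm) (use S pos in \<open>simp_all add: power_mult_distrib mult.commute\<close>)
  have Q'': "2 * \<bar>6 * Q'\<bar> \<le> A / 2 + 72 * (M\<^sup>2 * H)"
    by (rule amgm) (use Q' pos in \<open>simp_all add: power_mult_distrib mult.commute\<close>)
  have e1: "lam * ((1 + b) * F) \<le> (A + H) / 6"
  proof -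
    have "lam * (6 * (1 + b)) = \<kappa>" using b4 by (simp add: lam)
    then have "\<kappa> * F = 6 * (lam * ((1 + b) * F))" by (simp only: mult_ac flip: \<open>lam * (6 * (1 + b)) = \<kappa>\<close>)
    then have "lam * ((1 + b) * F) = \<kappa> * F / 6" by (simp only: nonzero_mult_div_cancel_left)
    also have "\<dots> \<le> (A + H) / 6" using k(3) by (rule divide_right_mono) simp
    finally show ?thesis .
  qed
  have e2: "(4 - 4 * lam) * S \<le> 4 * \<bar>S\<bar>"
  proof -
    have "(4 - 4 * lam) * S \<le> (4 - 4 * lam) * \<bar>S\<bar>" using lam1 by (intro mult_left_mono) auto
    also have "\<dots> \<le> 4 * \<bar>S\<bar>" using lam0 by (intro mult_right_mono) auto
    finally show ?thesis .
  qed
  have e3: "lam * K \<le> K / 6" "lam * A \<le> A / 6"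
    using mult_right_mono[OF lam1, of K] mult_right_mono[OF lam1, of A] pos by simp_all
  have e4: "b * H = 36 * (M\<^sup>2 * H) + 2 * (M * H) + 4 * H" by (simp add: b algebra_simps)
  have "(- 4 * A + 12 * S + 4 * Q + 24 * T - 8 * J - 24 * K - 8 * H)
     + 2 * (- 4 * S + 4 * K + 4 * H) + (1 + b) * (- 2 * H) + 6 * (- 2 * Z - 2 * Q')
     + lam * ((- 4 * S + 4 * K + 4 * H) + 2 * (- 2 * H) + (1 + b) * F + 6 * A)
    = - 4 * A + (4 - 4 * lam) * S + 4 * Q + 24 * T - 8 * J - 16 * K - 2 * H - 2 * (b * H)
      - 12 * Z - 12 * Q' + 4 * (lam * K) + lam * ((1 + b) * F) + 6 * (lam * A)"
    by (simp add: algebra_simps)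
  also have "\<dots> \<le> 0"
  proof -
    have "24 * T \<le> 12 * K + 12 * Z" using T' by linarith
    moreover have "(4 - 4 * lam) * S \<le> A / 2 + 8 * H" using S' e2 by (simp add: abs_mult)
    moreover have "- 12 * Q' \<le> A / 2 + 72 * (M\<^sup>2 * H)" using Q'' by linarith
    moreover have "6 * (lam * A) \<le> A" "4 * (lam * K) \<le> 2 / 3 * K" using e3 by linarith+
    moreover have "4 * Q - 2 * (b * H) \<le> - 72 * (M\<^sup>2 * H) - 8 * H" using Q e4 by linarith
    ultimately show ?thesis using e1 pos(1-5) by argo
  qed
  finally show ?thesis .
qed

context kinetic_semigroup
begin

lemma normsq_hess_le:
  assumes "L2 \<mu> h"
  shows "normsq \<mu> (\<lambda>z. deriv (deriv U) (fst z) * h z) \<le> M\<^sup>2 * normsq \<mu> h"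
proof -
  have "normsq \<mu> (\<lambda>z. deriv (deriv U) (fst z) * h z) \<le> (\<integral>z. M\<^sup>2 * (h z)\<^sup>2 \<partial>\<mu>)"
    unfolding normsq_def
  proof (rule integral_mono)
    show "integrable \<mu> (\<lambda>z. (deriv (deriv U) (fst z) * h z)\<^sup>2)"
      using L2_hess[OF assms] by (simp add: L2_def)
    show "integrable \<mu> (\<lambda>z. M\<^sup>2 * (h z)\<^sup>2)" using assms by (simp add: L2_def)
    show "(deriv (deriv U) (fst z) * h z)\<^sup>2 \<le> M\<^sup>2 * (h z)\<^sup>2" for z
      using hess_bounded[of "fst z"] M_nonneg unfolding power_mult_distrib
      by (intro mult_right_mono) (auto simp: abs_le_square_iff[symmetric])
  qed
  then show ?thesis by (simp add: normsq_def)
qed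

text \<open>Here \<open>\<nu>\<^sub>t = b + 6|w|\<^sup>2 / F\<close>. When \<open>F\<close> vanishes at some time, the trajectory and hence \<open>w\<close> vanish as well, so that
  \<open>\<nu>\<^sub>t F = b F + 6|w|\<^sup>2\<close> at all times, although \<open>\<nu>\<close> need not be continuous.\<close>

lemma third_order_inequality:
  assumes c: "c > 0" and P: "poincare (gibbs U) c" and f: "f \<in> D"
    and \<kappa>: "\<kappa> = min 1 c" and b: "b = 36 * M\<^sup>2 + 2 * M + 4" and lam: "lam = \<kappa> / (6 * (1 + b))"
  defines "F \<equiv> \<lambda>t. normsq \<mu> (traj f t)"
  shows "\<exists>\<nu> :: real \<Rightarrow> real. (\<forall>t\<ge>0. \<nu> t \<ge> b) \<and>
      (let g = (\<lambda>t. dt (dt F) t + 2 * 1 * dt F t + (1\<^sup>2 + \<nu> t) * F t)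
       in \<forall>t\<ge>0. dt_exists F t \<and> dt_exists (dt F) t \<and> dt_exists (\<lambda>s. \<nu> s * F s) t \<and>
                dt_exists g t \<and> dt g t + lam * g t \<le> 0)"
proof -
  define u where "u = traj f"
  define v where "v = traj (kfp U f)"
  define a where "a = traj (kfp U (kfp U f))"
  define e where "e = traj (kfp U (kfp U (kfp U f)))"
  have D: "kfp U f \<in> D" "kfp U (kfp U f) \<in> D" "kfp U (kfp U (kfp U f)) \<in> D"
    using stable f by auto
  have reg: "regular_fun (u t)" "regular_fun (v t)" "regular_fun (a t)" "L2 \<mu> (e t)" if "t \<ge> 0" for t
    using that f D by (auto simp: u_def v_def a_def e_def intro: traj_regular traj_L2)
  have L: "kfp U (u t) = v t" "kfp U (v t) = a t" "kfp U (a t) = e t" if "t \<ge> 0" for t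
    using that f D by (auto simp: u_def v_def a_def e_def kfp_traj)
  define A where "A = (\<lambda>t. normsq \<mu> (dx (u t)))"
  define F1 where "F1 = (\<lambda>t. 2 * l2_inner \<mu> (u t) (v t))"
  define F2 where "F2 = (\<lambda>t. 2 * l2_inner \<mu> (v t) (v t) + 2 * l2_inner \<mu> (u t) (a t))"
  define F3 where "F3 = (\<lambda>t. 6 * l2_inner \<mu> (v t) (a t) + 2 * l2_inner \<mu> (u t) (e t))"
  define A1 where "A1 = (\<lambda>t. 2 * l2_inner \<mu> (dx (u t)) (dx (v t)))"
  note ipd = traj_inner_deriv[OF f f, folded u_def v_def] traj_inner_deriv[OF f D(1), folded u_def v_def a_def]
    traj_inner_deriv[OF D(1) D(1), folded v_def a_def] traj_inner_deriv[OF f D(2), folded u_def v_def a_def e_def]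
  have dF: "(F has_real_derivative F1 t) (at t within {0..})" if "t \<ge> 0" for t
    using ipd(1)[OF that] by (simp add: F_def F1_def u_def[symmetric] l2_inner_self l2_inner_commute[of \<mu> "v t" "u t"])
  have dF1: "(F1 has_real_derivative F2 t) (at t within {0..})" if "t \<ge> 0" for t
    unfolding F1_def F2_def by (rule DERIV_cong[OF DERIV_cmult[OF ipd(2)[OF that]]]) simp
  have dF2: "(F2 has_real_derivative F3 t) (at t within {0..})" if "t \<ge> 0" for t
    unfolding F2_def F3_def
    by (rule DERIV_cong[OF DERIV_add[OF DERIV_cmult[OF ipd(3)[OF that]] DERIV_cmult[OF ipd(4)[OF that]]]])
       (simp add: l2_inner_commute[of \<mu> "a t" "v t"])
  have dA: "(A has_real_derivative A1 t) (at t within {0..})" if "t \<ge> 0" for t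
  proof -
    note d = traj_dx_L2_deriv[OF f that, folded u_def v_def]
    have "((\<lambda>s. l2_inner \<mu> (dx (u s)) (dx (u s))) has_real_derivative
       l2_inner \<mu> (dx (v t)) (dx (u t)) + l2_inner \<mu> (dx (u t)) (dx (v t))) (at t within {0..})"
      by (rule L2_deriv_inner[OF d d]) (use reg that in \<open>auto simp: regular_fun_def\<close>)
    then show ?thesis by (simp add: A_def A1_def l2_inner_self l2_inner_commute[of \<mu> "dx (v t)" "dx (u t)"])
  qed
  define \<nu> where "\<nu> = (\<lambda>t. b + 6 * A t / F t)"
  have \<nu>F: "\<nu> t * F t = b * F t + 6 * A t" if "t \<ge> 0" for t
  proof (cases "F t = 0")
    case True
    have "(u t z)\<^sup>2 = 0" for z
    proof (rule nonneg_continuous_integral_zero)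
      show "continuous_on UNIV (\<lambda>z. (u t z)\<^sup>2)"
        using reg(1)[OF that] by (intro continuous_intros smooth2_continuous) (simp add: regular_fun_def)
      show "integrable \<mu> (\<lambda>z. (u t z)\<^sup>2)" using reg(1)[OF that] by (simp add: regular_fun_def L2_def)
      show "(\<integral>z. (u t z)\<^sup>2 \<partial>\<mu>) = 0" using True by (simp add: F_def normsq_def u_def)
    qed simp
    then have "u t = (\<lambda>z. 0)" by auto
    then have "A t = 0" by (simp add: A_def partials_const normsq_def)
    then show ?thesis using True by simp
  qed (simp add: \<nu>_def field_simps)
  have \<nu>b: "\<nu> t \<ge> b" for t
    by (simp add: \<nu>_def A_def F_def normsq_nonneg)
  define g where "g = (\<lambda>t. dt (dt F) t + 2 * 1 * dt F t + (1\<^sup>2 + \<nu> t) * F t)"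
  have dtF: "dt F t = F1 t" if "t \<ge> 0" for t by (rule dt_eqI(1)[OF dF[OF that] that])
  have ddF: "(dt F has_real_derivative F2 t) (at t within {0..})" if "t \<ge> 0" for t
    by (rule deriv_on_half_line_cong[OF dF1[OF that] that]) (simp add: dtF)
  have dtdtF: "dt (dt F) t = F2 t" if "t \<ge> 0" for t by (rule dt_eqI(1)[OF ddF[OF that] that])
  have g: "g t = F2 t + 2 * F1 t + (1 + b) * F t + 6 * A t" if "t \<ge> 0" for t
    using that \<nu>F[OF that] by (simp add: g_def dtF dtdtF distrib_right)
  have d\<nu>F: "((\<lambda>s. \<nu> s * F s) has_real_derivative b * F1 t + 6 * A1 t) (at t within {0..})" if "t \<ge> 0" for t
    by (rule deriv_on_half_line_cong[OF DERIV_add[OF DERIV_cmult[OF dF[OF that]] DERIV_cmult[OF dA[OF that]]] that])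
       (simp add: \<nu>F)
  have dg: "(g has_real_derivative F3 t + 2 * F2 t + (1 + b) * F1 t + 6 * A1 t) (at t within {0..})" if "t \<ge> 0" for t
    by (rule deriv_on_half_line_cong[OF DERIV_add[OF DERIV_add[OF DERIV_add[OF dF2[OF that] DERIV_cmult[OF dF1[OF that]]]
          DERIV_cmult[OF dF[OF that]]] DERIV_cmult[OF dA[OF that]]] that])
       (simp add: g)
  \<comment> \<open>By the dissipation identities every term is one of those of the scalar inequality.\<close>
  have ineq: "dt g t + lam * g t \<le> 0" if t: "t \<ge> 0" for t
  proof -
    let ?h = "dy (u t)" and ?w = "dx (u t)" and ?k = "dy (dy (u t))"
    let ?Uh = "\<lambda>z. deriv (deriv U) (fst z) * ?h z"
    let ?H = "normsq \<mu> ?h" and ?Q = "l2_inner \<mu> ?h ?Uh" and ?Q' = "l2_inner \<mu> ?w ?Uh"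
    note r = regular_funD[OF reg(1)[OF t]]
    have Lw: "L2 \<mu> (dy ?w)" using r(5) by (simp add: dx_dy_commute[OF r(1)])
    note id = dissipation_identities[OF reg[OF t] L[OF t]]
    have Q': "?Q'\<^sup>2 \<le> A t * (M\<^sup>2 * ?H)"
    proof -
      have "?Q'\<^sup>2 \<le> A t * normsq \<mu> ?Uh"
        unfolding A_def by (rule l2_inner_square_le[OF r(3) L2_hess[OF r(4)]])
      also have "\<dots> \<le> A t * (M\<^sup>2 * ?H)"
        by (intro mult_left_mono normsq_hess_le r) (simp add: A_def normsq_nonneg)
      finally show ?thesis .
    qed
    have Q: "?Q \<le> M * ?H"
    proof (rule power2_le_imp_le)
      have "?Q\<^sup>2 \<le> ?H * normsq \<mu> ?Uh" by (rule l2_inner_square_le[OF r(4) L2_hess[OF r(4)]])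
      also have "\<dots> \<le> ?H * (M\<^sup>2 * ?H)"
        by (intro mult_left_mono normsq_hess_le r normsq_nonneg)
      finally show "?Q\<^sup>2 \<le> (M * ?H)\<^sup>2" by (simp add: power2_eq_square mult_ac)
    qed (simp add: M_nonneg normsq_nonneg)
    have "F t \<le> A t / c + ?H"
      unfolding F_def A_def u_def
      by (rule poincare_kinetic[OF c P]) (use r f t in \<open>auto simp: u_def traj_mean smooth2_C12\<close>)
    then have "\<kappa> * F t \<le> \<kappa> * (A t / c + ?H)"
      using c by (intro mult_left_mono) (auto simp: \<kappa>)
    also have "\<dots> \<le> A t + ?H"
    proof -
      have "\<kappa> * A t \<le> c * A t" "\<kappa> * ?H \<le> 1 * ?H"
        by (intro mult_right_mono; simp add: \<kappa> A_def normsq_nonneg)+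
      moreover from this have "\<kappa> * (A t / c) \<le> A t" using c by (simp add: divide_le_eq mult.commute)
      ultimately show ?thesis by (simp add: distrib_left)
    qed
    finally have kF: "\<kappa> * F t \<le> A t + ?H" .
    have "F3 t + 2 * F2 t + (1 + b) * F1 t + 6 * A1 t + lam * (F2 t + 2 * F1 t + (1 + b) * F t + 6 * A t) \<le> 0"
      unfolding F1_def F2_def F3_def A1_def id
      using hypocoercive_inequality[OF _ _ _ _ _ M_nonneg l2_inner_square_le[OF r(4,3)] l2_inner_square_le[OF r(6) Lw] Q
          Q'[unfolded A_def] _ _ kF[unfolded A_def] b lam] c
      by (simp add: A_def normsq_nonneg \<kappa>)
    then show ?thesis
      using dt_eqI(1)[OF dg[OF t] t] g[OF t] by simp
  qed
  show ?thesis
  proof (intro exI[of _ \<nu>] conjI)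
    show "\<forall>t\<ge>0. b \<le> \<nu> t" using \<nu>b by blast
    show "let g = (\<lambda>t. dt (dt F) t + 2 * 1 * dt F t + (1\<^sup>2 + \<nu> t) * F t)
       in \<forall>t\<ge>0. dt_exists F t \<and> dt_exists (dt F) t \<and> dt_exists (\<lambda>s. \<nu> s * F s) t \<and>
                dt_exists g t \<and> dt g t + lam * g t \<le> 0"
      unfolding Let_def g_def[symmetric]
      using dt_eqI(2)[OF dF] dt_eqI(2)[OF ddF] dt_eqI(2)[OF d\<nu>F] dt_eqI(2)[OF dg] ineq by simp
  qed
qed

end

text \<open>At time \<open>0\<close> the integral equations reduce to the initial condition almost surely.\<close>

lemma transition_at_zero:
  assumes BM: "brownian_motion W B" and SDE: "kinetic_solution U W B X Y"
    and f: "f \<in> borel_measurable borel"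
  shows "transition W X Y 0 f = f"
proof (rule ext, safe)
  fix x y :: real
  interpret W: prob_space W using BM by (simp add: brownian_motion_def)
  have m: "X (x, y) 0 \<in> borel_measurable W" "Y (x, y) 0 \<in> borel_measurable W"
    using SDE unfolding kinetic_solution_def by auto
  have "(\<lambda>\<omega>. (X (x, y) 0 \<omega>, Y (x, y) 0 \<omega>)) \<in> borel_measurable W"
    using measurable_Pair[OF m] by (simp add: borel_prod)
  then have mf: "(\<lambda>\<omega>. f (X (x, y) 0 \<omega>, Y (x, y) 0 \<omega>)) \<in> borel_measurable W"
    by (rule measurable_compose[OF _ f])
  have B: "AE \<omega> in W. B 0 \<omega> = 0"
    using BM unfolding brownian_motion_def by (auto elim: eventually_mono)
  have S: "AE \<omega> in W. \<forall>t\<ge>0. X (x, y) t \<omega> = x + integral {0..t} (\<lambda>s. Y (x, y) s \<omega>) \<and>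
      Y (x, y) t \<omega> = y - integral {0..t} (\<lambda>s. deriv U (X (x, y) s \<omega>) + Y (x, y) s \<omega>) + sqrt 2 * B t \<omega>"
    using SDE unfolding kinetic_solution_def by (auto elim: eventually_mono)
  have "AE \<omega> in W. f (X (x, y) 0 \<omega>, Y (x, y) 0 \<omega>) = f (x, y)"
    using B S
  proof eventually_elim
    case (elim \<omega>)
    from elim(2)[rule_format, of 0] elim(1) show ?case by simp
  qed
  then have "(\<integral>\<omega>. f (X (x, y) 0 \<omega>, Y (x, y) 0 \<omega>) \<partial>W) = (\<integral>\<omega>. f (x, y) \<partial>W)"
    using mf by (intro integral_cong_AE) auto
  then show "transition W X Y 0 f (x, y) = f (x, y)"
    by (simp add: transition_def W.prob_space)
qed

theorem theorem2:
  fixes U :: "real \<Rightarrow> real" and c\<^sub>U :: real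
    and W :: "'w measure" and B :: "real \<Rightarrow> 'w \<Rightarrow> real"
    and X Y :: "real \<times> real \<Rightarrow> real \<Rightarrow> 'w \<Rightarrow> real"
    and \<mu> :: "(real \<times> real) measure"
    and P :: "real \<Rightarrow> (real \<times> real \<Rightarrow> real) \<Rightarrow> real \<times> real \<Rightarrow> real"
    and D :: "(real \<times> real \<Rightarrow> real) set"
  assumes U_smooth: "smooth1 U"
    and U''_bounded: "bounded (range (deriv (deriv U)))"
    and U_integrable: "integrable lborel (\<lambda>x. exp (- U x))"
    and c_pos: "c\<^sub>U > 0"
    and U_poincare: "poincare (gibbs U) c\<^sub>U"
    and \<mu>_eq: "\<mu> = kin_measure U"
    and BM: "brownian_motion W B"
    and SDE: "kinetic_solution U W B X Y"
    and P_eq: "P = transition W X Y"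
    and markov: "markov_semigroup \<mu> P"
    and invariant: "invariant_measure \<mu> P"
    and D_core: "core \<mu> P (kfp U) D"
    and D_dense: "dense_L2 \<mu> D"
    and D_stable: "\<forall>f\<in>D. kfp U f \<in> D"
    and regular: "\<forall>f\<in>D. regular_trajectory \<mu> (centered \<mu> P f)"
  shows "\<exists>(lam::real) (\<eta>::real) (\<nu>\<^sub>s::real). lam > 0 \<and> \<eta> > 0 \<and>
    Re (complex_of_real \<eta> - csqrt (- complex_of_real \<nu>\<^sub>s)) > 0 \<and>
    (\<forall>f\<in>D. \<exists>\<nu> :: real \<Rightarrow> real. (\<forall>t\<ge>0. \<nu> t \<ge> \<nu>\<^sub>s) \<and>
      (let F = (\<lambda>t. normsq \<mu> (centered \<mu> P f t));
           g = (\<lambda>t. dt (dt F) t + 2 * \<eta> * dt F t + (\<eta>\<^sup>2 + \<nu> t) * F t)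
       in \<forall>t\<ge>0. dt_exists F t \<and> dt_exists (dt F) t \<and> dt_exists (\<lambda>s. \<nu> s * F s) t \<and>
                dt_exists g t \<and> dt g t + lam * g t \<le> 0))"
proof -
  obtain M where M: "\<And>x. \<bar>deriv (deriv U) x\<bar> \<le> M"
    using U''_bounded by (auto simp: bounded_iff)
  interpret kin: kinetic U M
    using U_smooth U_integrable M by unfold_locales auto
  interpret kinetic_semigroup U M P D
  proof unfold_locales
    show "P 0 f = f" if "f \<in> borel_measurable (kin_measure U)" for f
      using transition_at_zero[OF BM SDE] that unfolding P_eq kin.measurable_\<mu> by simp
  qed (use markov invariant D_core D_stable regular in \<open>auto simp: \<mu>_eq\<close>)
  define b where "b = 36 * M\<^sup>2 + 2 * M + 4"
  define \<kappa> where "\<kappa> = min 1 c\<^sub>U"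
  define lam where "lam = \<kappa> / (6 * (1 + b))"
  have b: "b > 0" using kin.M_nonneg by (simp add: b_def add_nonneg_pos)
  have lam: "lam > 0" using b c_pos by (simp add: lam_def \<kappa>_def)
  \<comment> \<open>The square root of a negative number is purely imaginary, so that \<open>\<nu>\<^sub>s = b\<close> is harmless.\<close>
  have "Re (csqrt (- complex_of_real b)) = 0"
    using b by (simp add: csqrt_of_real_nonpos flip: of_real_minus)
  then have re: "Re (complex_of_real 1 - csqrt (- complex_of_real b)) > 0" by simp
  show ?thesis
    unfolding \<mu>_eq
    using third_order_inequality[OF c_pos U_poincare _ \<kappa>_def b_def lam_def]
    by (intro exI[of _ lam] exI[of _ 1] exI[of _ b] conjI lam re ballI) (simp_all add: Let_def)
qed

end
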